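(* For basic instances of the \textsc{Spanner} problem there is a kernelization-based FPT algorithm w.r.t. $(\varrho,\alpha)$: given a connected undirected graph $G=(V,E)$ with $n=|V|$, $m=|E|$, unit weights and unit lengths ($w(e)=\ell(e)=1$ for all $e\in E$), a stretch factor $\alpha\ge1$ and $\varrho\in\mathbb{N}$, it decides whether $G$ has an $\alpha$-spanner $H=(V,F)$ obtained by removing at least $\varrho$ nontrivial edges from $G$, and returns such a witness if it exists, in $$\mathcal{O}\big(\varrho^{2\varrho+3}\alpha^{2\varrho+2}+nm\big)$$ time.
   Context: For a subgraph $G'\subseteq G$ and $u,v\in V$, $\ell_{G'}[u,v]$ is the length of a shortest $u$-$v$-path in $G'$ w.r.t. $\ell$. A subgraph $H=(V,F)$, $F\subseteq E$, is an $\alpha$-spanner of $G$ if $\ell_H[u,v]\le\alpha\,\ell_G[u,v]$ for all $u,v\in V$; equivalently, for all $\{u,v\}\in E$. For basic instances, an edge $\{u,v\}\in E$ is trivial if there is no simple $u$-$v$-path $P$ avoiding the edge $\{u,v\}$ with $\ell(P)\le\alpha\,\ell_G[u,v]$ (such an edge is in every $\alpha$-spanner); all other edges are nontrivial. A kernelization computes, in polynomial time, an answer-equivalent problem instance (kernel) whose size is bounded by a function of the parameters only. An algorithm is FPT w.r.t. a (possibly combined) parameter $k$ if on instance $I$ it runs in $\mathcal{O}(f(k)\cdot p(\langle I\rangle))$ time for a computable function $f$ and a polynomial $p$ in the encoding length $\langle I\rangle$. *)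

theory Defs
  imports "HOL-Library.Extended_Real" "HOL-Library.Log_Nat"
begin

section \<open>Paths, shortest path lengths and spanners\<close>

text \<open>An undirected simple graph is given by a vertex set and a set of two-element edges;
  a path is its list of vertices.\<close>

fun path_edges :: "'a list \<Rightarrow> 'a set list" where
  "path_edges (x # y # zs) = {x, y} # path_edges (y # zs)"
| "path_edges _ = []"

definition simple_path :: "'a set \<Rightarrow> 'a set set \<Rightarrow> 'a \<Rightarrow> 'a list \<Rightarrow> 'a \<Rightarrow> bool" where
  "simple_path V E u P v \<longleftrightarrow>
     P \<noteq> [] \<and> hd P = u \<and> last P = v \<and> distinct P \<and> set P \<subseteq> V \<and> set (path_edges P) \<subseteq> E"

definition path_length :: "('a set \<Rightarrow> real) \<Rightarrow> 'a list \<Rightarrow> real" where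
  "path_length l P = sum_list (map l (path_edges P))"

text \<open>The infimum is \<open>\<infinity>\<close> if there is no path; otherwise it is attained if \<open>V\<close> is finite.\<close>

definition sp_length :: "('a set \<Rightarrow> real) \<Rightarrow> 'a set \<Rightarrow> 'a set set \<Rightarrow> 'a \<Rightarrow> 'a \<Rightarrow> ereal" where
  "sp_length l V E u v = (INF P\<in>{P. simple_path V E u P v}. ereal (path_length l P))"

definition connected_graph :: "'a set \<Rightarrow> 'a set set \<Rightarrow> bool" where
  "connected_graph V E \<longleftrightarrow> V \<noteq> {} \<and> (\<forall>u\<in>V. \<forall>v\<in>V. \<exists>P. simple_path V E u P v)"

definition spanner :: "('a set \<Rightarrow> real) \<Rightarrow> 'a set \<Rightarrow> 'a set set \<Rightarrow> real \<Rightarrow> 'a set set \<Rightarrow> bool" where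
  "spanner l V E \<alpha> F \<longleftrightarrow>
     F \<subseteq> E \<and> (\<forall>u\<in>V. \<forall>v\<in>V. sp_length l V F u v \<le> ereal \<alpha> * sp_length l V E u v)"

definition trivial_edge :: "('a set \<Rightarrow> real) \<Rightarrow> 'a set \<Rightarrow> 'a set set \<Rightarrow> real \<Rightarrow> 'a set \<Rightarrow> bool" where
  "trivial_edge l V E \<alpha> e \<longleftrightarrow> e \<in> E \<and>
     \<not> (\<exists>u v P. e = {u, v} \<and> simple_path V E u P v \<and> e \<notin> set (path_edges P) \<and>
          ereal (path_length l P) \<le> ereal \<alpha> * sp_length l V E u v)"

definition nontrivial_edges :: "('a set \<Rightarrow> real) \<Rightarrow> 'a set \<Rightarrow> 'a set set \<Rightarrow> real \<Rightarrow> 'a set set" where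
  "nontrivial_edges l V E \<alpha> = {e \<in> E. \<not> trivial_edge l V E \<alpha> e}"


section \<open>Basic instances\<close>

text \<open>The vertices are \<open>0, \<dots>, n - 1\<close>; the edges come in a list, in arbitrary order and with
  arbitrary orientation. The stretch factor is rational, so that it is a finite input.\<close>

record inst =
  nverts :: nat
  elist :: "(nat \<times> nat) list"
  stretch :: rat
  removals :: nat

definition nedges :: "inst \<Rightarrow> nat" where
  "nedges I = length (elist I)"

definition verts :: "inst \<Rightarrow> nat set" where
  "verts I = {..<nverts I}"

definition edge :: "inst \<Rightarrow> nat \<Rightarrow> nat set" where
  "edge I i = {fst (elist I ! i), snd (elist I ! i)}"

definition edges :: "inst \<Rightarrow> nat set set" where
  "edges I = edge I ` {..<nedges I}"

definition basic_instance :: "inst \<Rightarrow> bool" where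
  "basic_instance I \<longleftrightarrow>
     (\<forall>i<nedges I. edge I i \<subseteq> verts I \<and> card (edge I i) = 2) \<and>
     inj_on (edge I) {..<nedges I} \<and>
     connected_graph (verts I) (edges I) \<and>
     stretch I \<ge> 1"

definition unit_length :: "nat set \<Rightarrow> real" where
  "unit_length e = 1"

definition solution :: "inst \<Rightarrow> nat set set \<Rightarrow> bool" where
  "solution I F \<longleftrightarrow>
     (\<exists>R. R \<subseteq> nontrivial_edges unit_length (verts I) (edges I) (of_rat (stretch I)) \<and>
          card R \<ge> removals I \<and> F = edges I - R) \<and>
     spanner unit_length (verts I) (edges I) (of_rat (stretch I)) F"

definition yes_instance :: "inst \<Rightarrow> bool" where
  "yes_instance I \<longleftrightarrow> (\<exists>F. solution I F)"

definition numer :: "rat \<Rightarrow> nat" where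
  "numer a = nat (fst (quotient_of a))"

definition denom :: "rat \<Rightarrow> nat" where
  "denom a = nat (snd (quotient_of a))"

definition bits :: "nat \<Rightarrow> nat" where
  "bits k = max 1 (floorlog 2 k)"

definition encoding_length :: "inst \<Rightarrow> nat" where
  "encoding_length I = bits (nverts I) + (\<Sum>(u, v)\<leftarrow>elist I. bits u + bits v) +
     bits (numer (stretch I)) + bits (denom (stretch I)) + bits (removals I)"


section \<open>Random access machine\<close>

text \<open>
  Uniform-cost RAM programs in structured form. The memory consists of named unbounded arrays of
  natural numbers; a program mentions only finitely many of them, so they can be interleaved in a
  single memory with constant overhead. Scalars are stored at index 0. The only arithmetic
  operations are addition and truncated subtraction: unit-cost multiplication would make the model
  unreasonably powerful, as it produces numbers of exponential bit length.
\<close>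

type_synonym state = "string \<Rightarrow> nat \<Rightarrow> nat"

datatype aexp = Const nat | Read string aexp | Plus aexp aexp | Minus aexp aexp

datatype bexp = Less aexp aexp | Equal aexp aexp | Neg bexp | Conj bexp bexp

datatype com =
    Skip
  | Write string aexp aexp
  | Seq com com
  | Cond bexp com com
  | Loop bexp com

fun aval :: "aexp \<Rightarrow> state \<Rightarrow> nat" where
  "aval (Const k) s = k"
| "aval (Read x a) s = s x (aval a s)"
| "aval (Plus a b) s = aval a s + aval b s"
| "aval (Minus a b) s = aval a s - aval b s"

fun acost :: "aexp \<Rightarrow> nat" where
  "acost (Const k) = 1"
| "acost (Read x a) = 1 + acost a"
| "acost (Plus a b) = 1 + acost a + acost b"
| "acost (Minus a b) = 1 + acost a + acost b"

fun bval :: "bexp \<Rightarrow> state \<Rightarrow> bool" where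
  "bval (Less a b) s \<longleftrightarrow> aval a s < aval b s"
| "bval (Equal a b) s \<longleftrightarrow> aval a s = aval b s"
| "bval (Neg p) s \<longleftrightarrow> \<not> bval p s"
| "bval (Conj p q) s \<longleftrightarrow> bval p s \<and> bval q s"

fun bcost :: "bexp \<Rightarrow> nat" where
  "bcost (Less a b) = 1 + acost a + acost b"
| "bcost (Equal a b) = 1 + acost a + acost b"
| "bcost (Neg p) = 1 + bcost p"
| "bcost (Conj p q) = 1 + bcost p + bcost q"

text \<open>\<open>exec c s t s'\<close>: started in \<open>s\<close>, program \<open>c\<close> halts in \<open>s'\<close> after \<open>t\<close> steps.\<close>

inductive exec :: "com \<Rightarrow> state \<Rightarrow> nat \<Rightarrow> state \<Rightarrow> bool" where
  Skip: "exec Skip s 1 s"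
| Write: "exec (Write x a b) s (1 + acost a + acost b)
            (s(x := (s x)(aval a s := aval b s)))"
| Seq: "exec c s t s' \<Longrightarrow> exec d s' t' s'' \<Longrightarrow> exec (Seq c d) s (t + t') s''"
| Cond_True: "bval b s \<Longrightarrow> exec c s t s' \<Longrightarrow> exec (Cond b c d) s (1 + bcost b + t) s'"
| Cond_False: "\<not> bval b s \<Longrightarrow> exec d s t s' \<Longrightarrow> exec (Cond b c d) s (1 + bcost b + t) s'"
| Loop_True: "bval b s \<Longrightarrow> exec c s t s' \<Longrightarrow> exec (Loop b c) s' t' s'' \<Longrightarrow>
    exec (Loop b c) s (1 + bcost b + t + t') s''"
| Loop_False: "\<not> bval b s \<Longrightarrow> exec (Loop b c) s (1 + bcost b) s"


section \<open>Input and output conventions\<close>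

text \<open>The prefix \<open>p\<close> of the array names separates the input from the kernel.\<close>

definition holds_inst :: "string \<Rightarrow> inst \<Rightarrow> state \<Rightarrow> bool" where
  "holds_inst p I s \<longleftrightarrow>
     s (p @ ''n'') 0 = nverts I \<and>
     s (p @ ''m'') 0 = nedges I \<and>
     (\<forall>i<nedges I. (s (p @ ''u'') i, s (p @ ''v'') i) = elist I ! i) \<and>
     s (p @ ''numer'') 0 = numer (stretch I) \<and>
     s (p @ ''denom'') 0 = denom (stretch I) \<and>
     s (p @ ''rho'') 0 = removals I"

definition params_state :: "nat \<Rightarrow> rat \<Rightarrow> state" where
  "params_state \<rho> \<alpha> = (\<lambda>_ _. 0)
     (''in_numer'' := (\<lambda>_. 0)(0 := numer \<alpha>),
      ''in_denom'' := (\<lambda>_. 0)(0 := denom \<alpha>),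
      ''in_rho'' := (\<lambda>_. 0)(0 := \<rho>))"

definition input_state :: "inst \<Rightarrow> state" where
  "input_state I = (params_state (removals I) (stretch I))
     (''in_n'' := (\<lambda>_. 0)(0 := nverts I),
      ''in_m'' := (\<lambda>_. 0)(0 := nedges I),
      ''in_u'' := (\<lambda>i. if i < nedges I then fst (elist I ! i) else 0),
      ''in_v'' := (\<lambda>i. if i < nedges I then snd (elist I ! i) else 0))"

text \<open>The answer is 1 or 0; a witness is returned by marking the edges it keeps.\<close>

definition answered :: "string \<Rightarrow> inst \<Rightarrow> state \<Rightarrow> bool" where
  "answered p I s \<longleftrightarrow>
     s (p @ ''answer'') 0 = (if yes_instance I then 1 else 0) \<and>
     (yes_instance I \<longrightarrow> solution I (edge I ` {i. i < nedges I \<and> s (p @ ''keep'') i = 1}))"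

lemma holds_inst_input_state: "holds_inst ''in_'' I (input_state I)"
  by (simp add: holds_inst_def input_state_def params_state_def)


section \<open>Kernelizations and FPT algorithms for the parameter (rho, alpha)\<close>

definition solves_within :: "com \<Rightarrow> (inst \<Rightarrow> real) \<Rightarrow> bool" where
  "solves_within A T \<longleftrightarrow>
     (\<forall>I. basic_instance I \<longrightarrow>
        (\<exists>t s. exec A (input_state I) t s \<and> answered ''in_'' I s \<and> real t \<le> T I))"

definition kernelization :: "com \<Rightarrow> bool" where
  "kernelization K \<longleftrightarrow>
     (\<exists>(g :: nat \<Rightarrow> rat \<Rightarrow> nat) (c :: nat) (k :: nat). \<forall>I. basic_instance I \<longrightarrow>
        (\<exists>t s J. exec K (input_state I) t s \<and> t \<le> c * encoding_length I ^ k \<and>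
           holds_inst ''ker_'' J s \<and> basic_instance J \<and>
           (yes_instance J \<longleftrightarrow> yes_instance I) \<and>
           encoding_length J \<le> g (removals I) (stretch I)))"

text \<open>\<open>S\<close> solves the kernel left by \<open>K\<close>, in time bounded by a function of the parameters only.\<close>

definition kernel_solver :: "com \<Rightarrow> com \<Rightarrow> bool" where
  "kernel_solver K S \<longleftrightarrow>
     (\<exists>h :: nat \<Rightarrow> rat \<Rightarrow> nat. \<forall>I J t s. basic_instance I \<longrightarrow>
        exec K (input_state I) t s \<longrightarrow> basic_instance J \<longrightarrow> holds_inst ''ker_'' J s \<longrightarrow>
        (\<exists>t' s'. exec S s t' s' \<and> answered ''ker_'' J s' \<and> t' \<le> h (removals I) (stretch I)))"

text \<open>\<open>L\<close> turns the solution of the kernel into one of the original instance.\<close>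

definition kernelization_based :: "com \<Rightarrow> bool" where
  "kernelization_based A \<longleftrightarrow>
     (\<exists>K S L. A = Seq K (Seq S L) \<and> kernelization K \<and> kernel_solver K S)"

definition computable :: "(nat \<Rightarrow> rat \<Rightarrow> nat) \<Rightarrow> bool" where
  "computable f \<longleftrightarrow>
     (\<exists>c. \<forall>\<rho> \<alpha>. \<alpha> \<ge> 1 \<longrightarrow> (\<exists>t s. exec c (params_state \<rho> \<alpha>) t s \<and> s ''value'' 0 = f \<rho> \<alpha>))"

definition fpt_algorithm :: "com \<Rightarrow> bool" where
  "fpt_algorithm A \<longleftrightarrow>
     (\<exists>f (c :: nat) (k :: nat). computable f \<and>
        solves_within A
          (\<lambda>I. real (c * (f (removals I) (stretch I) * encoding_length I ^ k))))"

end

theory Submission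
  imports Defs
begin

text \<open>
  Let \<open>k\<close> be the integer part of \<open>\<alpha>\<close>. A set \<open>R\<close> of edges can be removed iff the ends of every edge
  of \<open>R\<close> are joined by a walk of at most \<open>k\<close> edges in \<open>G - R\<close>. If there are at least
  \<open>\<rho> (2 k + 1)\<close> nontrivial edges, then \<open>\<rho>\<close> of them can be removed: fix for every nontrivial edge a
  short walk that avoids it; the digraph of the edges used by these walks has outdegree at most
  \<open>k\<close>, hence a greedily chosen independent set of size \<open>\<rho>\<close>. So it suffices to look for \<open>R\<close> inside a
  set \<open>N\<close> of at most \<open>\<rho> (2 k + 1)\<close> nontrivial edges.

  The nontrivial edges are found by a breadth-first search from every vertex \<open>s\<close>, where every
  vertex is labelled with the first edge of its path from \<open>s\<close>: an edge at \<open>s\<close> lies on a short cycle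
  iff some edge joins its branch to a different branch at small total depth. This takes time
  \<open>O(n m)\<close>. The distances in \<open>G - N\<close> between the ends of edges of \<open>N\<close> determine which \<open>R\<close> can be
  removed; they are computed once, and every \<open>\<rho>\<close>-tuple of edges of \<open>N\<close> is then checked by
  \<open>k\<close> rounds of the Bellman-Ford algorithm on the compressed graph.

  The kernel is obtained by running this enumeration for at most \<open>n\<close> tuples. If it terminates, an
  instance of constant size is emitted; otherwise \<open>n \<le> |N|\<^sup>\<rho>\<close>, so the instance itself is already
  bounded by the parameters.
\<close>

section \<open>Reasoning about RAM programs\<close>

text \<open>The numbers \<alpha> and \<rho> may be exponential in the encoding length, and the
  machine only adds and subtracts. This forces caps: \<open>k\<close> is cut at \<open>n\<close>,
  which is harmless because a shortest path has fewer than \<open>n\<close> edges, and |N| never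
  exceeds \<open>m\<close>. If |N| < \<rho>, the answer is no at once; hence \<rho> \<le> |N| while
  tuples are enumerated, and checking one tuple takes polynomial time. The number
  \<open>2 k + 1\<close> counts a chosen edge, the at most \<open>k\<close> edges of its walk and at
  most \<open>k\<close> edges whose walks use it. The solver does not start afresh: the tuple
  counter and the compressed graph stay in memory, so the enumeration resumes where the
  kernelization cut it off. As for the exponents, there are at most
  \<open>(3 \<rho> \<alpha>)^\<rho>\<close> tuples, and a check costs
  \<open>O(\<rho> k |N|^2)\<close>, which is \<open>O(\<rho>^3 \<alpha>^3)\<close>. Since
  \<open>3^\<rho> \<le> 27 \<rho>^\<rho>\<close>, the constant 3 in the base is paid by a second
  factor \<open>\<rho>^\<rho>\<close>.\<close>

lemma exec_deterministic:
  "exec c s t s' \<Longrightarrow> exec c s t' s'' \<Longrightarrow> t' = t \<and> s'' = s'"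
proof (induction arbitrary: t' s'' rule: exec.induct)
  case (Skip s) then show ?case by (auto elim: exec.cases)
next
  case (Write x a b s) then show ?case by (auto elim: exec.cases)
next
  case (Seq c s t s' d t2 s2)
  from Seq.prems obtain p q r where "exec c s p r" "exec d r q s''" "t' = p + q"
    by (cases rule: exec.cases) auto
  with Seq.IH show ?case by blast
next
  case (Cond_True b s c t s' d)
  from Cond_True.prems Cond_True.hyps obtain p where "exec c s p s''" "t' = 1 + bcost b + p"
    by (cases rule: exec.cases) auto
  with Cond_True.IH show ?case by blast
next
  case (Cond_False b s d t s' c)
  from Cond_False.prems Cond_False.hyps obtain p where "exec d s p s''" "t' = 1 + bcost b + p"
    by (cases rule: exec.cases) auto
  with Cond_False.IH show ?case by blast
next
  case (Loop_True b s c t s' t2 s2)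
  from Loop_True.prems Loop_True.hyps obtain p q r
    where "exec c s p r" "exec (Loop b c) r q s''" "t' = 1 + bcost b + p + q"
    by (cases rule: exec.cases) auto
  with Loop_True.IH show ?case by blast
next
  case (Loop_False b s c)
  from Loop_False.prems Loop_False.hyps show ?case by (cases rule: exec.cases) auto
qed

fun writes :: "com \<Rightarrow> string set" where
  "writes Skip = {}"
| "writes (Write x a b) = {x}"
| "writes (Seq c d) = writes c \<union> writes d"
| "writes (Cond b c d) = writes c \<union> writes d"
| "writes (Loop b c) = writes c"

lemma exec_frame: "exec c s t s' \<Longrightarrow> x \<notin> writes c \<Longrightarrow> s' x = s x"
  by (induction rule: exec.induct) auto

abbreviation unchanged :: "string set \<Rightarrow> state \<Rightarrow> state \<Rightarrow> bool" where
  "unchanged A s' s \<equiv> \<forall>x. x \<notin> A \<longrightarrow> s' x = s x"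

text \<open>A total-correctness triple with a time bound, for one fixed start state instead of a
  precondition; postconditions can then refer to initial values directly.\<close>

definition runs :: "com \<Rightarrow> state \<Rightarrow> nat \<Rightarrow> (state \<Rightarrow> bool) \<Rightarrow> bool" where
  "runs c s T Q \<longleftrightarrow> (\<exists>t s'. exec c s t s' \<and> t \<le> T \<and> Q s')"

text \<open>Besides weakening, the rule supplies the frame: arrays that the program does not write
  keep their values. Postconditions therefore mention only what changes.\<close>

lemma runs_conseq:
  assumes "runs c s T Q" "T \<le> T'" "\<And>s'. unchanged (writes c) s' s \<Longrightarrow> Q s' \<Longrightarrow> Q' s'"
  shows "runs c s T' Q'"
proof -
  obtain t s' where "exec c s t s'" "t \<le> T" "Q s'" using assms(1) by (auto simp: runs_def)
  moreover have "unchanged (writes c) s' s" using exec_frame[OF \<open>exec c s t s'\<close>] by auto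
  ultimately show ?thesis using assms(2,3) unfolding runs_def by (meson le_trans)
qed

lemma runs_Seq:
  assumes "runs c s T Q" "\<And>s'. unchanged (writes c) s' s \<Longrightarrow> Q s' \<Longrightarrow> runs d s' T' Q'"
  shows "runs (Seq c d) s (T + T') Q'"
proof -
  obtain t s' where *: "exec c s t s'" "t \<le> T" "Q s'" using assms(1) by (auto simp: runs_def)
  have "unchanged (writes c) s' s" using exec_frame[OF *(1)] by auto
  with assms(2) * obtain t' s'' where "exec d s' t' s''" "t' \<le> T'" "Q' s''"
    unfolding runs_def by blast
  with * show ?thesis unfolding runs_def by (meson exec.Seq add_mono)
qed

lemma runs_Cond:
  assumes "bval b s \<Longrightarrow> runs c s T Q" "\<not> bval b s \<Longrightarrow> runs d s T Q"
  shows "runs (Cond b c d) s (1 + bcost b + T) Q"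
proof (cases "bval b s")
  case True
  with assms obtain t s' where "exec c s t s'" "t \<le> T" "Q s'" by (auto simp: runs_def)
  with True show ?thesis unfolding runs_def by (meson exec.Cond_True add_left_mono)
next
  case False
  with assms obtain t s' where "exec d s t s'" "t \<le> T" "Q s'" by (auto simp: runs_def)
  with False show ?thesis unfolding runs_def by (meson exec.Cond_False add_left_mono)
qed

section \<open>Loop-free programs and their evaluation\<close>

fun loop_free :: "com \<Rightarrow> bool" where
  "loop_free (Seq c d) \<longleftrightarrow> loop_free c \<and> loop_free d"
| "loop_free (Cond b c d) \<longleftrightarrow> loop_free c \<and> loop_free d"
| "loop_free (Loop b c) \<longleftrightarrow> False"
| "loop_free _ \<longleftrightarrow> True"

fun run :: "com \<Rightarrow> state \<Rightarrow> state" where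
  "run (Write x a b) s = s(x := (s x)(aval a s := aval b s))"
| "run (Seq c d) s = run d (run c s)"
| "run (Cond b c d) s = (if bval b s then run c s else run d s)"
| "run _ s = s"

text \<open>Both branches of a conditional are added rather than maximised: the bound only has to be
  independent of the state, and constants are rounded up everywhere.\<close>

fun max_cost :: "com \<Rightarrow> nat" where
  "max_cost (Write x a b) = 1 + acost a + acost b"
| "max_cost (Seq c d) = max_cost c + max_cost d"
| "max_cost (Cond b c d) = 1 + bcost b + (max_cost c + max_cost d)"
| "max_cost _ = 1"

lemma exec_run: "loop_free c \<Longrightarrow> \<exists>t \<le> max_cost c. exec c s t (run c s)"
proof (induction c arbitrary: s)
  case (Seq c d)
  then obtain t t' where "t \<le> max_cost c" "exec c s t (run c s)"
    "t' \<le> max_cost d" "exec d (run c s) t' (run d (run c s))"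
    by (meson loop_free.simps(1))
  then show ?case by (auto intro!: exI[of _ "t + t'"] exec.Seq)
next
  case (Cond b c d)
  obtain t where t: "t \<le> max_cost c" "exec c s t (run c s)" using Cond by auto
  obtain t' where t': "t' \<le> max_cost d" "exec d s t' (run d s)" using Cond by auto
  show ?case
  proof (cases "bval b s")
    case True
    with exec.Cond_True[OF True t(2), of d] t(1) show ?thesis
      by (intro exI[of _ "1 + bcost b + t"]) auto
  next
    case False
    with exec.Cond_False[OF False t'(2), of c] t'(1) show ?thesis
      by (intro exI[of _ "1 + bcost b + t'"]) auto
  qed
qed (use exec.Skip exec.Write in \<open>auto simp del: One_nat_def\<close>)

lemma runs_loop_free:
  assumes "loop_free c" "Q (run c s)" "max_cost c \<le> T"
  shows "runs c s T Q"
  using exec_run[OF assms(1), of s] assms(2,3) unfolding runs_def by (meson le_trans)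

text \<open>Each round lowers the measure, so there are at most \<open>\<mu> s\<close> rounds; the
  extra 1 pays for the last, failing test.\<close>

lemma runs_Loop_measure:
  fixes \<mu> :: "state \<Rightarrow> nat"
  assumes "Inv s"
    and body: "\<And>s. Inv s \<Longrightarrow> bval b s \<Longrightarrow> runs c s B (\<lambda>s'. Inv s' \<and> \<mu> s' < \<mu> s)"
  shows "runs (Loop b c) s ((\<mu> s + 1) * (1 + bcost b + B)) (\<lambda>s'. Inv s' \<and> \<not> bval b s')"
  using assms(1)
proof (induction "\<mu> s" arbitrary: s rule: less_induct)
  case less
  show ?case
  proof (cases "bval b s")
    case False
    then show ?thesis using exec.Loop_False[OF False] less.prems unfolding runs_def
      by (intro exI[of _ "1 + bcost b"]) auto
  next
    case True
    from body[OF less.prems True] obtain t s1 where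
      1: "exec c s t s1" "t \<le> B" "Inv s1" "\<mu> s1 < \<mu> s" unfolding runs_def by blast
    from less.hyps[OF 1(4,3)] obtain t' s2 where
      2: "exec (Loop b c) s1 t' s2" "t' \<le> (\<mu> s1 + 1) * (1 + bcost b + B)" "Inv s2" "\<not> bval b s2"
      unfolding runs_def by blast
    have "(\<mu> s1 + 1) * (1 + bcost b + B) \<le> \<mu> s * (1 + bcost b + B)"
      using 1(4) by (intro mult_right_mono) auto
    then have "1 + bcost b + t + t' \<le> (\<mu> s + 1) * (1 + bcost b + B)"
      using 1(2) 2(2) by (simp add: algebra_simps)
    then show ?thesis using exec.Loop_True[OF True 1(1) 2(1)] 2(3,4) unfolding runs_def by blast
  qed
qed

text \<open>The invariant is strengthened by the frame of the whole loop, so that \<open>Inv\<close>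
  can be confined to the arrays that the body writes.\<close>

lemma runs_Loop:
  fixes \<mu> :: "state \<Rightarrow> nat"
  assumes "Inv s"
    and "\<And>s'. unchanged (writes c) s' s \<Longrightarrow> Inv s' \<Longrightarrow> bval b s' \<Longrightarrow>
          runs c s' B (\<lambda>s''. Inv s'' \<and> \<mu> s'' < \<mu> s')"
    and "\<And>s'. unchanged (writes c) s' s \<Longrightarrow> Inv s' \<Longrightarrow> \<not> bval b s' \<Longrightarrow> Q s'"
    and "(\<mu> s + 1) * (1 + bcost b + B) \<le> T"
  shows "runs (Loop b c) s T Q"
proof -
  let ?I = "\<lambda>s'. Inv s' \<and> unchanged (writes c) s' s"
  have "runs (Loop b c) s ((\<mu> s + 1) * (1 + bcost b + B)) (\<lambda>s'. ?I s' \<and> \<not> bval b s')"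
  proof (rule runs_Loop_measure)
    show "?I s" using assms(1) by simp
    fix s' assume *: "?I s'" "bval b s'"
    show "runs c s' B (\<lambda>s''. ?I s'' \<and> \<mu> s'' < \<mu> s')"
      by (rule runs_conseq[OF assms(2)]) (use * in auto)
  qed
  then show ?thesis by (rule runs_conseq) (use assms(3,4) in auto)
qed

section \<open>Counting loops\<close>

abbreviation Sc :: "string \<Rightarrow> aexp" where "Sc x \<equiv> Read x (Const 0)"
abbreviation Set :: "string \<Rightarrow> aexp \<Rightarrow> com" where "Set x a \<equiv> Write x (Const 0) a"

text \<open>The bound \<open>a\<close> is evaluated anew in every test; the rule below therefore
  asks that its value be stable under the body.\<close>

definition For :: "string \<Rightarrow> aexp \<Rightarrow> com \<Rightarrow> com" where
  "For x a c = Seq (Set x (Const 0)) (Loop (Less (Sc x) a) (Seq c (Set x (Plus (Sc x) (Const 1)))))"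

lemma writes_For [simp]: "writes (For x a c) = insert x (writes c)"
  by (auto simp: For_def)

definition put :: "string \<Rightarrow> nat \<Rightarrow> state \<Rightarrow> state" where
  "put x i s = s(x := (s x)(0 := i))"

lemma put_same [simp]: "put x i s x = (s x)(0 := i)"
  and put_other [simp]: "y \<noteq> x \<Longrightarrow> put x i s y = s y"
  by (auto simp: put_def)

text \<open>\<open>P i\<close> is demanded of the state whose counter already reads
  \<open>i\<close>; the body has to establish it for the state after the increment that the loop
  appends. In the time bound, \<open>acost a\<close> stands for the repeated evaluation of the
  bound, and 20 absorbs initialisation, test and increment.\<close>

lemma runs_For:
  assumes init: "P 0 (put x 0 s)"
    and bound: "\<And>s'. unchanged (insert x (writes c)) s' s \<Longrightarrow> aval a s' = h"
    and x: "x \<notin> writes c"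
    and body: "\<And>i s'. i < h \<Longrightarrow> s' x 0 = i \<Longrightarrow> unchanged (insert x (writes c)) s' s \<Longrightarrow>
          P i s' \<Longrightarrow> runs c s' B (\<lambda>s''. P (Suc i) (put x (Suc i) s''))"
    and post: "\<And>s'. unchanged (insert x (writes c)) s' s \<Longrightarrow> P h s' \<Longrightarrow> s' x 0 = h \<Longrightarrow> Q s'"
    and T: "(h + 1) * (B + acost a + 20) \<le> T"
  shows "runs (For x a c) s T Q"
proof -
  let ?fr = "\<lambda>s'. unchanged (insert x (writes c)) s' s"
  let ?I = "\<lambda>s'. s' x 0 \<le> h \<and> P (s' x 0) s' \<and> ?fr s'"
  let ?b = "Less (Sc x) a"
  have loop: "runs (Loop ?b (Seq c (Set x (Plus (Sc x) (Const 1))))) (put x 0 s)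
      ((h + 1) * (1 + bcost ?b + (B + 6))) Q"
  proof (rule runs_Loop[where Inv = ?I and \<mu> = "\<lambda>s. h - s x 0"])
    show "?I (put x 0 s)" using init by (auto simp: put_def)
  next
    fix s' assume *: "?I s'" "bval ?b s'"
    then have lt: "s' x 0 < h" using bound[of s'] by auto
    have 1: "runs c s' B (\<lambda>s''. P (Suc (s' x 0)) (put x (Suc (s' x 0)) s''))"
      using * lt by (intro body) auto
    show "runs (Seq c (Set x (Plus (Sc x) (Const 1)))) s' (B + 6) (\<lambda>s''. ?I s'' \<and> h - s'' x 0 < h - s' x 0)"
    proof (rule runs_Seq[OF 1])
      fix s1 assume f: "unchanged (writes c) s1 s'"
        and P: "P (Suc (s' x 0)) (put x (Suc (s' x 0)) s1)"
      then have e: "run (Set x (Plus (Sc x) (Const 1))) s1 = put x (Suc (s' x 0)) s1"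
        using x by (simp add: put_def)
      show "runs (Set x (Plus (Sc x) (Const 1))) s1 6 (\<lambda>s''. ?I s'' \<and> h - s'' x 0 < h - s' x 0)"
      proof (rule runs_loop_free, unfold e)
        show "?I (put x (Suc (s' x 0)) s1) \<and> h - put x (Suc (s' x 0)) s1 x 0 < h - s' x 0"
          using P lt f * by (auto simp: put_def)
      qed auto
    qed
  next
    fix s' assume *: "?I s'" "\<not> bval ?b s'"
    then have "s' x 0 = h" using bound[of s'] by auto
    with * show "Q s'" by (intro post) auto
  qed (simp_all add: put_def)
  have "runs (For x a c) s (4 + (h + 1) * (1 + bcost ?b + (B + 6))) Q"
    unfolding For_def
  proof (rule runs_Seq[where Q = "\<lambda>s'. s' = put x 0 s"])
    show "runs (Set x (Const 0)) s 4 (\<lambda>s'. s' = put x 0 s)"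
      by (rule runs_loop_free) (auto simp: put_def)
  qed (use loop in simp)
  moreover have "4 + (h + 1) * (1 + bcost ?b + (B + 6)) \<le> T"
    using T by (auto simp: algebra_simps)
  ultimately show ?thesis using runs_conseq by blast
qed

section \<open>Walks and sets of removable edges\<close>

lemma length_path_edges: "length (path_edges P) = length P - 1"
  by (induction P rule: path_edges.induct) auto

lemma path_length_unit: "path_length unit_length P = real (length P - 1)"
proof -
  have "map unit_length xs = replicate (length xs) 1" for xs
    by (induction xs) (auto simp: unit_length_def)
  then show ?thesis by (simp add: path_length_def length_path_edges sum_list_replicate)
qed

lemma path_edges_append1: "P \<noteq> [] \<Longrightarrow> path_edges (P @ [y]) = path_edges P @ [{last P, y}]"
  by (induction P rule: path_edges.induct) auto

lemma path_edges_prefix: "set (path_edges P) \<subseteq> set (path_edges (P @ Q))"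
  by (induction P rule: path_edges.induct) (auto simp: neq_Nil_conv)

text \<open>Read \<open>f e\<close> as the successors of \<open>e\<close>. Indegrees and outdegrees
  have the same sum, so some \<open>e\<close> has indegree at most \<open>k\<close>. Discarding
  \<open>e\<close>, its successors and its predecessors costs at most \<open>2 * k + 1\<close>
  elements, and none of the remaining ones conflicts with \<open>e\<close> in either
  direction.\<close>

lemma independent_subset:
  assumes "finite S" and "\<And>e. e \<in> S \<Longrightarrow> finite (f e) \<and> card (f e) \<le> k \<and> e \<notin> f e"
    and "r * (2 * k + 1) \<le> card S"
  shows "\<exists>R \<subseteq> S. card R = r \<and> (\<forall>e\<in>R. f e \<inter> R = {})"
  using assms
proof (induction r arbitrary: S)
  case 0 then show ?case by (intro exI[of _ "{}"]) auto
next
  case (Suc r)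
  have "\<exists>e\<in>S. card {e' \<in> S. e \<in> f e'} \<le> k"
  proof (rule ccontr)
    assume "\<not> ?thesis"
    then have "(\<Sum>e\<in>S. k + 1) \<le> (\<Sum>e\<in>S. card {e' \<in> S. e \<in> f e'})"
      by (intro sum_mono) (auto simp: not_le Suc_le_eq)
    also have "\<dots> = (\<Sum>e\<in>S. \<Sum>e'\<in>S. of_bool (e \<in> f e'))"
      using Suc.prems(1) by (simp add: Int_def)
    also have "\<dots> = (\<Sum>e'\<in>S. \<Sum>e\<in>S. of_bool (e \<in> f e'))" by (rule sum.swap)
    also have "\<dots> = (\<Sum>e'\<in>S. card {e \<in> S. e \<in> f e'})"
      using Suc.prems(1) by (simp add: Int_def)
    also have "\<dots> \<le> (\<Sum>e'\<in>S. k)"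
    proof (rule sum_mono)
      fix e' assume "e' \<in> S"
      then have "card {e \<in> S. e \<in> f e'} \<le> card (f e')" using Suc.prems(2) by (intro card_mono) auto
      then show "card {e \<in> S. e \<in> f e'} \<le> k" using Suc.prems(2)[OF \<open>e' \<in> S\<close>] by simp
    qed
    finally have "card S = 0" by simp
    then show False using Suc.prems(3) by simp
  qed
  then obtain e where e: "e \<in> S" "card {e' \<in> S. e \<in> f e'} \<le> k" by blast
  define D where "D = insert e (f e \<union> {e' \<in> S. e \<in> f e'})"
  have "card D \<le> Suc (card (f e \<union> {e' \<in> S. e \<in> f e'}))" unfolding D_def by (rule card_insert_le_m1) auto
  also have "\<dots> \<le> Suc (card (f e) + card {e' \<in> S. e \<in> f e'})" using card_Un_le by simp
  also have "\<dots> \<le> 2 * k + 1" using e Suc.prems(2) by fastforce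
  finally have "card D \<le> 2 * k + 1" .
  moreover have "finite D" unfolding D_def using Suc.prems(1,2) e by auto
  ultimately have "r * (2 * k + 1) \<le> card (S - D)"
    using Suc.prems(3) diff_card_le_card_Diff[of D S] by (simp add: algebra_simps)
  then obtain R where R: "R \<subseteq> S - D" "card R = r" "\<forall>e\<in>R. f e \<inter> R = {}"
    using Suc.IH[of "S - D"] Suc.prems(1,2) by auto
  have "finite R" using R(1) Suc.prems(1) finite_subset by blast
  moreover have "e \<notin> R" using R(1) by (auto simp: D_def)
  ultimately have "card (insert e R) = Suc r" using R(2) by simp
  moreover have "f e' \<inter> insert e R = {}" if "e' \<in> insert e R" for e'
    using that R e Suc.prems(2)[OF e(1)] by (auto simp: D_def)
  ultimately show ?case using R e by (intro exI[of _ "insert e R"]) blast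
qed

section \<open>Walks in a graph with deleted edges, where edges are addressed by their index as in
  the input arrays\<close>

locale graph =
  fixes n m :: nat and u v :: "nat \<Rightarrow> nat"
  assumes ends: "i < m \<Longrightarrow> u i < n \<and> v i < n \<and> u i \<noteq> v i"
    and inj: "i < m \<Longrightarrow> j < m \<Longrightarrow> {u i, v i} = {u j, v j} \<Longrightarrow> i = j"
    and n_pos: "0 < n"
begin

text \<open>\<open>X\<close> is the set of deleted edge indices. Walks are relational powers of
  \<open>adj X\<close>, which concatenate freely; simple paths occur only at the interface to the
  definitions of spanner and trivial edge.\<close>

definition adj :: "nat set \<Rightarrow> nat \<Rightarrow> nat \<Rightarrow> bool" where
  "adj X x y \<longleftrightarrow> (\<exists>i<m. i \<notin> X \<and> {u i, v i} = {x, y})"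

definition good :: "nat \<Rightarrow> nat set \<Rightarrow> bool" where
  "good k R \<longleftrightarrow> R \<subseteq> {..<m} \<and> (\<forall>e\<in>R. \<exists>L\<le>k. (adj R ^^ L) (u e) (v e))"

definition nontriv :: "nat \<Rightarrow> nat \<Rightarrow> bool" where
  "nontriv k e \<longleftrightarrow> e < m \<and> (\<exists>L\<le>k. (adj {e} ^^ L) (u e) (v e))"

definition rest :: "nat set \<Rightarrow> nat set set" where
  "rest X = (\<lambda>i. {u i, v i}) ` ({..<m} - X)"

lemma adj_rest: "adj X x y \<longleftrightarrow> {x, y} \<in> rest X"
  by (auto simp: adj_def rest_def)

lemma adj_commute: "adj X x y \<longleftrightarrow> adj X y x"
  by (simp add: adj_def insert_commute)

lemma adj_less: "adj X x y \<Longrightarrow> x < n \<and> y < n"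
  using ends by (auto simp: adj_def doubleton_eq_iff)

lemma walk_mono: "(adj X ^^ L) x y \<Longrightarrow> Y \<subseteq> X \<Longrightarrow> (adj Y ^^ L) x y"
  by (rule relpowp_mono[of "adj X"]) (auto simp: adj_def)

lemma walk_append: "(adj X ^^ L) x y \<Longrightarrow> (adj X ^^ L') y z \<Longrightarrow> (adj X ^^ (L + L')) x z"
  by (auto simp: relpowp_add)

lemma walk_sym: "(adj X ^^ L) x y \<Longrightarrow> (adj X ^^ L) y x"
proof (induction L arbitrary: y)
  case (Suc L)
  then obtain z where "(adj X ^^ L) x z" "adj X z y" by auto
  with Suc.IH show ?case using adj_commute by (metis relpowp_Suc_I2)
qed auto

lemma simple_path_walk:
  "simple_path {..<n} (rest X) x P y \<Longrightarrow> (adj X ^^ (length P - 1)) x y"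
proof (induction P arbitrary: x rule: path_edges.induct)
  case (1 a b zs)
  have "simple_path {..<n} (rest X) b (b # zs) y" "{x, b} \<in> rest X"
    using 1(2) by (auto simp: simple_path_def)
  then have "adj X x b" "(adj X ^^ length zs) b y" using 1(1)[of b] by (simp add: adj_rest, simp)
  then show ?case using relpowp_Suc_I2[of "adj X" x b "length zs" y] by simp
qed (auto simp: simple_path_def)

text \<open>Whenever the walk returns to a vertex of the path built so far, the path is cut at that
  vertex; so it never gets longer than the walk.\<close>

lemma walk_simple_path:
  "(adj X ^^ L) x y \<Longrightarrow> x < n \<Longrightarrow> \<exists>P. simple_path {..<n} (rest X) x P y \<and> length P \<le> L + 1"
proof (induction L arbitrary: y)
  case 0 then show ?case by (intro exI[of _ "[x]"]) (auto simp: simple_path_def)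
next
  case (Suc L)
  then obtain z where z: "(adj X ^^ L) x z" "adj X z y" by auto
  from Suc.IH[OF z(1) Suc.prems(2)] obtain P
    where P: "simple_path {..<n} (rest X) x P z" "length P \<le> L + 1" by blast
  show ?case
  proof (cases "y \<in> set P")
    case True
    then obtain P1 P2 where P12: "P = (P1 @ [y]) @ P2" by (metis split_list append_Cons append_Nil append_assoc)
    have "simple_path {..<n} (rest X) x (P1 @ [y]) y"
      using P(1) path_edges_prefix[of "P1 @ [y]" P2] unfolding P12 simple_path_def
      by (auto simp: hd_append split: if_splits)
    then show ?thesis using P(2) P12 by (intro exI[of _ "P1 @ [y]"]) auto
  next
    case False
    have "simple_path {..<n} (rest X) x (P @ [y]) y"
      using P(1) False z(2) adj_less[OF z(2)] unfolding simple_path_def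
      by (auto simp: path_edges_append1 adj_rest)
    then show ?thesis using P(2) by (intro exI[of _ "P @ [y]"]) auto
  qed
qed

lemma length_simple_path:
  assumes "simple_path {..<n} F x P y" shows "1 \<le> length P" "length P \<le> n"
proof -
  have "distinct P" "set P \<subseteq> {..<n}" "P \<noteq> []" using assms by (auto simp: simple_path_def)
  then show "1 \<le> length P" "length P \<le> n"
    using card_mono[of "{..<n}" "set P"] by (auto simp: distinct_card Suc_le_eq)
qed

text \<open>\<open>S\<close> collects the edges of the walk. The walk is remembered only through the
  fact that deleting edges outside \<open>S\<close> preserves it, length included.\<close>

lemma walk_edges:
  "(adj X ^^ L) x y \<Longrightarrow>
     \<exists>S. finite S \<and> card S \<le> L \<and> S \<inter> X = {} \<and> (\<forall>R. S \<inter> R = {} \<longrightarrow> (adj R ^^ L) x y)"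
proof (induction L arbitrary: y)
  case (Suc L)
  then obtain z where z: "(adj X ^^ L) x z" "adj X z y" by auto
  from Suc.IH[OF z(1)] obtain S where
    S: "finite S" "card S \<le> L" "S \<inter> X = {}" "\<forall>R. S \<inter> R = {} \<longrightarrow> (adj R ^^ L) x z" by blast
  from z(2) obtain i where i: "i < m" "i \<notin> X" "{u i, v i} = {z, y}" by (auto simp: adj_def)
  have "card (insert i S) \<le> Suc L" using S(2) by (metis card_insert_le_m1 diff_Suc_1 zero_less_Suc)
  moreover have "\<forall>R. insert i S \<inter> R = {} \<longrightarrow> (adj R ^^ Suc L) x y"
  proof (intro allI impI)
    fix R assume R: "insert i S \<inter> R = {}"
    then have "adj R z y" using i by (auto simp: adj_def)
    then show "(adj R ^^ Suc L) x y" using S(4) R by auto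
  qed
  ultimately show ?case using S i by (intro exI[of _ "insert i S"]) auto
qed (auto intro!: exI[of _ "{}"])

text \<open>Fewer deletions leave more walks. This turns at least \<rho> removals into exactly
  \<rho>.\<close>

lemma good_subset: "good k R \<Longrightarrow> R' \<subseteq> R \<Longrightarrow> good k R'"
  unfolding good_def using walk_mono[where X = R and Y = R'] by blast

lemma good_nontriv: "good k R \<Longrightarrow> e \<in> R \<Longrightarrow> nontriv k e"
  using walk_mono[where X = R and Y = "{e}"] unfolding good_def nontriv_def by (metis empty_subsetI insert_subset lessThan_iff subsetD)

text \<open>\<open>f e\<close> consists of the edges of a walk chosen for \<open>e\<close>. If
  \<open>R\<close> meets none of the sets \<open>f e\<close> with \<open>e\<close> in
  \<open>R\<close>, then all the chosen walks survive the deletion of \<open>R\<close>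
  simultaneously.\<close>

lemma many_nontriv_good:
  assumes "\<forall>e\<in>S. nontriv k e" "r * (2 * k + 1) \<le> card S"
  shows "\<exists>R \<subseteq> S. good k R \<and> card R = r"
proof -
  have "\<forall>e\<in>S. \<exists>T. finite T \<and> card T \<le> k \<and> e \<notin> T \<and>
      (\<forall>R. T \<inter> R = {} \<longrightarrow> (\<exists>L\<le>k. (adj R ^^ L) (u e) (v e)))"
  proof
    fix e assume "e \<in> S"
    then obtain L where L: "L \<le> k" "(adj {e} ^^ L) (u e) (v e)" using assms(1) by (auto simp: nontriv_def)
    from walk_edges[OF L(2)] L(1) show "\<exists>T. finite T \<and> card T \<le> k \<and> e \<notin> T \<and>
      (\<forall>R. T \<inter> R = {} \<longrightarrow> (\<exists>L\<le>k. (adj R ^^ L) (u e) (v e)))" by (metis disjoint_insert(1) le_trans)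
  qed
  then have "\<exists>f. \<forall>e\<in>S. finite (f e) \<and> card (f e) \<le> k \<and> e \<notin> f e \<and>
      (\<forall>R. f e \<inter> R = {} \<longrightarrow> (\<exists>L\<le>k. (adj R ^^ L) (u e) (v e)))"
    by (rule bchoice)
  then obtain f where f: "\<forall>e\<in>S. finite (f e) \<and> card (f e) \<le> k \<and> e \<notin> f e \<and>
      (\<forall>R. f e \<inter> R = {} \<longrightarrow> (\<exists>L\<le>k. (adj R ^^ L) (u e) (v e)))"
    by blast
  have S: "S \<subseteq> {..<m}" using assms(1) by (auto simp: nontriv_def)
  then have "finite S" using finite_subset by blast
  then obtain R where R: "R \<subseteq> S" "card R = r" "\<forall>e\<in>R. f e \<inter> R = {}"
    using independent_subset[of S f k r] f assms(2) by blast
  have "R \<subseteq> {..<m}" using R(1) S by blast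
  moreover have "\<exists>L\<le>k. (adj R ^^ L) (u e) (v e)" if "e \<in> R" for e
    using f R(1,3) that by (meson subsetD)
  ultimately have "good k R" unfolding good_def by blast
  with R show ?thesis by blast
qed

end

section \<open>Basic instances\<close>

lemma sp_length_le: "simple_path V F x P y \<Longrightarrow> sp_length l V F x y \<le> path_length l P"
  unfolding sp_length_def by (rule INF_lower) simp

lemma sp_length_attained:
  assumes "simple_path V F x P0 y"
  shows "\<exists>P. simple_path V F x P y \<and> sp_length unit_length V F x y = path_length unit_length P"
proof -
  obtain P where P: "simple_path V F x P y" "\<forall>P'. simple_path V F x P' y \<longrightarrow> length P \<le> length P'"
    using assms ex_has_least_nat[of "\<lambda>P. simple_path V F x P y" P0 length] by blast
  have "ereal (path_length unit_length P) \<le> sp_length unit_length V F x y"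
    unfolding sp_length_def
    by (rule INF_greatest) (use P in \<open>auto simp: path_length_unit diff_le_mono\<close>)
  with P sp_length_le show ?thesis by (metis antisym)
qed

lemma sp_length_edge:
  assumes "x \<noteq> y" "x \<in> V" "y \<in> V" "{x, y} \<in> F"
  shows "sp_length unit_length V F x y = 1"
proof (rule antisym)
  have "simple_path V F x [x, y] y" using assms by (auto simp: simple_path_def)
  from sp_length_le[OF this, of unit_length] show "sp_length unit_length V F x y \<le> 1"
    by (simp add: path_length_unit one_ereal_def)
  show "1 \<le> sp_length unit_length V F x y" unfolding sp_length_def
  proof (rule INF_greatest)
    fix P assume "P \<in> {P. simple_path V F x P y}"
    then have "2 \<le> length P" using assms(1) unfolding simple_path_def
      by (cases P; cases "tl P") auto
    then show "1 \<le> ereal (path_length unit_length P)" by (simp add: path_length_unit)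
  qed
qed

locale basic_inst =
  fixes I :: inst
  assumes basic: "basic_instance I"
begin

sublocale graph "nverts I" "nedges I" "\<lambda>i. fst (elist I ! i)" "\<lambda>i. snd (elist I ! i)"
proof
  fix i assume i: "i < nedges I"
  then have "edge I i \<subseteq> verts I" "card (edge I i) = 2" using basic by (auto simp: basic_instance_def)
  then show "fst (elist I ! i) < nverts I \<and> snd (elist I ! i) < nverts I \<and> fst (elist I ! i) \<noteq> snd (elist I ! i)"
    by (auto simp: edge_def verts_def)
next
  fix i j assume "i < nedges I" "j < nedges I"
    "{fst (elist I ! i), snd (elist I ! i)} = {fst (elist I ! j), snd (elist I ! j)}"
  then show "i = j" using basic by (auto simp: basic_instance_def edge_def inj_on_def)
next
  show "0 < nverts I" using basic by (auto simp: basic_instance_def connected_graph_def verts_def)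
qed

abbreviation "src \<equiv> \<lambda>i. fst (elist I ! i)"
abbreviation "tgt \<equiv> \<lambda>i. snd (elist I ! i)"

text \<open>The integer part of \<alpha>, capped at the number of vertices. The cap loses nothing,
  as a simple path has fewer than \<open>n\<close> edges, and it keeps both the computation of
  \<open>kk\<close> and the number of Bellman-Ford rounds polynomial for huge \<alpha>.\<close>

definition kk :: nat where
  "kk = min (nverts I) (numer (stretch I) div denom (stretch I))"

abbreviation \<alpha> :: real where "\<alpha> \<equiv> real_of_rat (stretch I)"

lemma denom_pos: "0 < denom (stretch I)"
  using quotient_of_denom_pos'[of "stretch I"] by (simp add: denom_def)

lemma stretch_ge1: "1 \<le> \<alpha>"
  using basic by (simp add: basic_instance_def)

lemma stretch_eq: "\<alpha> = real (numer (stretch I)) / real (denom (stretch I))"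
proof -
  obtain p q where pq: "quotient_of (stretch I) = (p, q)" by fastforce
  have "q > 0" using quotient_of_denom_pos[OF pq] .
  moreover have s: "stretch I = rat_of_int p / rat_of_int q" using quotient_of_div[OF pq] .
  moreover have "0 \<le> stretch I" using basic by (simp add: basic_instance_def)
  ultimately have "p \<ge> 0" by (simp add: zero_le_divide_iff)
  with s \<open>q > 0\<close> pq show ?thesis by (simp add: numer_def denom_def of_rat_divide)
qed

lemma denom_le_numer: "denom (stretch I) \<le> numer (stretch I)"
  using stretch_ge1 denom_pos unfolding stretch_eq by simp

lemma le_stretch_iff: "real L \<le> \<alpha> \<longleftrightarrow> L \<le> numer (stretch I) div denom (stretch I)"
proof -
  have "real L \<le> \<alpha> \<longleftrightarrow> real (L * denom (stretch I)) \<le> real (numer (stretch I))"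
    using denom_pos unfolding stretch_eq by (simp add: field_simps)
  also have "\<dots> \<longleftrightarrow> L * denom (stretch I) \<le> numer (stretch I)" by (rule of_nat_le_iff)
  also have "\<dots> \<longleftrightarrow> L \<le> numer (stretch I) div denom (stretch I)"
    using denom_pos by (simp add: less_eq_div_iff_mult_less_eq)
  finally show ?thesis .
qed

lemma kk_le: "L \<le> kk \<Longrightarrow> real L \<le> \<alpha>"
  by (simp add: le_stretch_iff kk_def)

text \<open>The premise \<open>L < nverts I\<close> pays for the cap in \<open>kk\<close>; lengths
  of simple paths satisfy it.\<close>

lemma le_kk: "L < nverts I \<Longrightarrow> real L \<le> \<alpha> \<Longrightarrow> L \<le> kk"
  by (simp add: le_stretch_iff kk_def)

lemma kk_pos: "1 \<le> kk"
  using le_kk[of 1] le_kk[of 0] stretch_ge1 n_pos le_stretch_iff[of 1] by (auto simp: kk_def)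

lemma edges_eq: "edges I = rest {}"
  by (simp add: edges_def rest_def edge_def[abs_def])

lemma edge_eq: "edge I i = {src i, tgt i}"
  by (simp add: edge_def)

lemma verts_eq: "verts I = {..<nverts I}"
  by (simp add: verts_def)

lemma inj_edge: "inj_on (edge I) {..<nedges I}"
  using basic by (simp add: basic_instance_def)

lemma rest_diff: "R \<subseteq> {..<nedges I} \<Longrightarrow> edges I - edge I ` R = rest R"
  using inj_on_image_set_diff[OF inj_edge, of "{..<nedges I}" R]
  by (simp add: edges_def rest_def edge_eq)

lemma connected: "x < nverts I \<Longrightarrow> y < nverts I \<Longrightarrow> \<exists>P. simple_path {..<nverts I} (rest {}) x P y"
  using basic by (auto simp: basic_instance_def connected_graph_def edges_eq verts_eq)

lemma connected_walk: "x < nverts I \<Longrightarrow> y < nverts I \<Longrightarrow> \<exists>L. (adj {} ^^ L) x y"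
  using connected simple_path_walk by blast

text \<open>Each deleted edge of the walk is replaced by its detour of at most \<open>kk\<close>
  edges. A kept edge counts 1, which is covered because \<open>kk\<close> is positive.\<close>

lemma good_stretch:
  assumes "good kk R" shows "(adj {} ^^ L) x y \<Longrightarrow> \<exists>L' \<le> kk * L. (adj R ^^ L') x y"
proof (induction L arbitrary: y)
  case (Suc L)
  then obtain z where z: "(adj {} ^^ L) x z" "adj {} z y" by auto
  from Suc.IH[OF z(1)] obtain L1 where L1: "L1 \<le> kk * L" "(adj R ^^ L1) x z" by blast
  from z(2) obtain i where i: "i < nedges I" "{src i, tgt i} = {z, y}" by (auto simp: adj_def)
  have "\<exists>L2 \<le> kk. (adj R ^^ L2) z y"
  proof (cases "i \<in> R")
    case False
    with i have "adj R z y" by (auto simp: adj_def)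
    then show ?thesis using kk_pos by (intro exI[of _ 1]) auto
  next
    case True
    then obtain L2 where "L2 \<le> kk" "(adj R ^^ L2) (src i) (tgt i)" using assms by (auto simp: good_def)
    then show ?thesis using i(2) walk_sym by (auto simp: doubleton_eq_iff)
  qed
  then obtain L2 where "L2 \<le> kk" "(adj R ^^ L2) z y" by blast
  then have "(adj R ^^ (L1 + L2)) x y" "L1 + L2 \<le> kk * Suc L" using L1 walk_append by auto
  then show ?case by blast
qed auto

text \<open>The walk contains a simple path with no more edges that still avoids \<open>e\<close>.
  As the ends of \<open>e\<close> are at distance 1, this path refutes triviality.\<close>

lemma nontrivial_if_walk:
  assumes "e < nedges I" "L \<le> kk" "(adj {e} ^^ L) (src e) (tgt e)"
  shows "edge I e \<in> nontrivial_edges unit_length (verts I) (edges I) \<alpha>"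
proof -
  have ends_e: "src e < nverts I" "tgt e < nverts I" "src e \<noteq> tgt e" using ends[OF assms(1)] by auto
  from walk_simple_path[OF assms(3) ends_e(1)] obtain P
    where P: "simple_path {..<nverts I} (rest {e}) (src e) P (tgt e)" "length P \<le> L + 1" by blast
  have eE: "edge I e \<in> edges I" using assms(1) by (auto simp: edges_def)
  have "rest {e} = edges I - {edge I e}" using rest_diff[of "{e}"] assms(1) by simp
  then have "simple_path (verts I) (edges I) (src e) P (tgt e)" "edge I e \<notin> set (path_edges P)"
    using P(1) by (auto simp: simple_path_def verts_eq)
  moreover have "sp_length unit_length (verts I) (edges I) (src e) (tgt e) = 1"
    using ends_e eE by (intro sp_length_edge) (auto simp: verts_eq edge_eq)
  moreover have "real (length P - 1) \<le> \<alpha>" using P(2) assms(2) by (intro kk_le) simp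
  ultimately have "\<not> trivial_edge unit_length (verts I) (edges I) \<alpha> (edge I e)"
    unfolding trivial_edge_def using edge_eq[of e] by (force simp: path_length_unit)
  with eE show ?thesis by (simp add: nontrivial_edges_def)
qed

lemma good_solution:
  assumes R: "good kk R" "removals I \<le> card R"
  shows "solution I (edge I ` ({..<nedges I} - R))"
proof -
  have Rm: "R \<subseteq> {..<nedges I}" using R(1) by (simp add: good_def)
  have F: "edge I ` ({..<nedges I} - R) = rest R"
    by (simp add: rest_def edge_def[abs_def])
  have "edge I ` R \<subseteq> nontrivial_edges unit_length (verts I) (edges I) \<alpha>"
    using good_nontriv[OF R(1)] nontrivial_if_walk by (auto simp: nontriv_def)
  moreover have "card (edge I ` R) = card R"
    using inj_edge Rm by (meson card_image inj_on_subset)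
  moreover have "spanner unit_length (verts I) (edges I) \<alpha> (rest R)"
    unfolding spanner_def verts_eq edges_eq
  proof (intro conjI ballI)
    show "rest R \<subseteq> rest {}" by (auto simp: rest_def)
    fix x y assume "x \<in> {..<nverts I}" "y \<in> {..<nverts I}"
    then have xy: "x < nverts I" "y < nverts I" by auto
    obtain P where P: "simple_path {..<nverts I} (rest {}) x P y"
      "sp_length unit_length {..<nverts I} (rest {}) x y = path_length unit_length P"
      using sp_length_attained connected[OF xy] by meson
    obtain L where L: "L \<le> kk * (length P - 1)" "(adj R ^^ L) x y"
      using good_stretch[OF R(1) simple_path_walk[OF P(1)]] by blast
    obtain Q where Q: "simple_path {..<nverts I} (rest R) x Q y" "length Q \<le> L + 1"
      using walk_simple_path[OF L(2) xy(1)] by blast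
    have "path_length unit_length Q \<le> real kk * real (length P - 1)"
      using Q(2) L(1) by (simp add: path_length_unit flip: of_nat_mult)
    also have "\<dots> \<le> \<alpha> * path_length unit_length P"
      using kk_le[of kk] unfolding path_length_unit by (intro mult_right_mono) auto
    finally show "sp_length unit_length {..<nverts I} (rest R) x y
        \<le> ereal \<alpha> * sp_length unit_length {..<nverts I} (rest {}) x y"
      unfolding P(2) using order_trans[OF sp_length_le[OF Q(1)]] by simp
  qed
  ultimately show ?thesis unfolding solution_def F using rest_diff[OF Rm] R(2)
    by (intro conjI exI[of _ "edge I ` R"]) auto
qed

lemma yes_good:
  assumes "yes_instance I" shows "\<exists>R. good kk R \<and> card R = removals I"
proof -
  obtain R0 where R0: "R0 \<subseteq> nontrivial_edges unit_length (verts I) (edges I) \<alpha>"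
    "removals I \<le> card R0" "spanner unit_length (verts I) (edges I) \<alpha> (edges I - R0)"
    using assms by (auto simp: yes_instance_def solution_def)
  define R where "R = {i. i < nedges I \<and> edge I i \<in> R0}"
  have Rm: "R \<subseteq> {..<nedges I}" by (auto simp: R_def)
  have R0_eq: "R0 = edge I ` R"
    using R0(1) by (auto simp: R_def nontrivial_edges_def edges_def)
  then have card: "card R = card R0" using inj_edge Rm by (metis card_image inj_on_subset)
  have F: "edges I - R0 = rest R" using R0_eq rest_diff[OF Rm] by simp
  have "good kk R" unfolding good_def
  proof (intro conjI ballI Rm)
    fix e assume "e \<in> R"
    then have e: "e < nedges I" by (simp add: R_def)
    then have ends_e: "src e < nverts I" "tgt e < nverts I" "src e \<noteq> tgt e" using ends by auto
    have "sp_length unit_length (verts I) (edges I) (src e) (tgt e) = 1"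
      using ends_e e by (intro sp_length_edge) (auto simp: verts_eq edge_eq edges_def)
    then have le: "sp_length unit_length (verts I) (rest R) (src e) (tgt e) \<le> ereal \<alpha>"
      using R0(3) ends_e unfolding spanner_def F by (force simp: verts_eq)
    \<comment> \<open>Without any path the infimum would range over the empty set and be infinite,
      contradicting the finite bound \<alpha>.\<close>
    have "\<exists>P. simple_path (verts I) (rest R) (src e) P (tgt e)"
    proof (rule ccontr)
      assume "\<not> ?thesis"
      then have "sp_length unit_length (verts I) (rest R) (src e) (tgt e) = \<infinity>"
        unfolding sp_length_def by (simp add: top_ereal_def)
      with le show False by simp
    qed
    then obtain P where P: "simple_path {..<nverts I} (rest R) (src e) P (tgt e)"
      "sp_length unit_length (verts I) (rest R) (src e) (tgt e) = path_length unit_length P"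
      using sp_length_attained unfolding verts_eq by meson
    have "length P - 1 \<le> kk"
      using length_simple_path[OF P(1)] le P(2) by (intro le_kk) (auto simp: path_length_unit)
    then show "\<exists>L\<le>kk. (adj R ^^ L) (src e) (tgt e)" using simple_path_walk[OF P(1)] by blast
  qed
  \<comment> \<open>The solution may remove more than \<rho> edges; it is thinned out to exactly
    \<rho>.\<close>
  moreover obtain R' where "R' \<subseteq> R" "card R' = removals I"
    using R0(2) card obtain_subset_with_card_n by metis
  ultimately show ?thesis using good_subset by blast
qed

text \<open>If \<open>N\<close> misses some nontrivial edge, then it is so large that both sides
  hold.\<close>

lemma yes_iff_good:
  assumes N: "\<forall>e\<in>N. nontriv kk e" "N = {e. nontriv kk e} \<or> removals I * (2 * kk + 1) \<le> card N"
  shows "yes_instance I \<longleftrightarrow> (\<exists>R \<subseteq> N. good kk R \<and> card R = removals I)"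
proof
  assume yes: "yes_instance I"
  from N(2) show "\<exists>R \<subseteq> N. good kk R \<and> card R = removals I"
  proof
    assume "N = {e. nontriv kk e}"
    then show ?thesis using yes_good[OF yes] good_nontriv by blast
  next
    assume "removals I * (2 * kk + 1) \<le> card N"
    with many_nontriv_good[OF N(1)] show ?thesis by blast
  qed
next
  assume "\<exists>R \<subseteq> N. good kk R \<and> card R = removals I"
  then show "yes_instance I" using good_solution unfolding yes_instance_def by (metis order_refl)
qed

text \<open>Every vertex other than 0 is assigned the last edge of a shortest walk from 0. The other
  end of that edge is strictly closer to 0, so two vertices sharing their edge would each be closer
  than the other.\<close>

lemma nedges_ge: "nverts I \<le> nedges I + 1"
proof -
  define d where "d x = (LEAST L. (adj {} ^^ L) 0 x)" for x
  have d: "(adj {} ^^ d x) 0 x" if "x < nverts I" for x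
    unfolding d_def using connected_walk[OF n_pos that] by (rule LeastI_ex)
  have "\<exists>i z. i < nedges I \<and> {src i, tgt i} = {z, x} \<and> d z < d x" if x: "x \<in> {1..<nverts I}" for x
  proof -
    have "d x \<noteq> 0" using d[of x] x by (auto elim: relpowp_E)
    then obtain L where L: "d x = Suc L" using not0_implies_Suc by blast
    with d[of x] x obtain z where z: "(adj {} ^^ L) 0 z" "adj {} z x" by auto
    have "d z \<le> L" unfolding d_def by (rule Least_le) (rule z)
    then show ?thesis using z(2) L by (auto simp: adj_def intro: le_imp_less_Suc)
  qed
  then obtain i z where iz: "\<And>x. x \<in> {1..<nverts I} \<Longrightarrow>
      i x < nedges I \<and> {src (i x), tgt (i x)} = {z x, x} \<and> d (z x) < d x" by metis
  have "inj_on i {1..<nverts I}"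
  proof (rule inj_onI)
    fix x y assume xy: "x \<in> {1..<nverts I}" "y \<in> {1..<nverts I}" "i x = i y"
    then have "{z x, x} = {z y, y}" using iz by metis
    then show "x = y" using iz[OF xy(1)] iz[OF xy(2)] by (auto simp: doubleton_eq_iff)
  qed
  then have "card {1..<nverts I} \<le> card {..<nedges I}"
    using iz by (intro card_inj_on_le) auto
  then show ?thesis by simp
qed

lemma nedges_le: "nedges I \<le> nverts I * nverts I"
proof -
  have "inj_on (\<lambda>i. (src i, tgt i)) {..<nedges I}" using inj by (auto simp: inj_on_def)
  moreover have "(\<lambda>i. (src i, tgt i)) ` {..<nedges I} \<subseteq> {..<nverts I} \<times> {..<nverts I}"
    using ends by (auto simp del: split_paired_All) (metis fst_conv snd_conv)+
  ultimately have "card {..<nedges I} \<le> card ({..<nverts I} \<times> {..<nverts I})"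
    by (meson card_inj_on_le finite_SigmaI finite_lessThan)
  then show ?thesis by (simp add: card_cartesian_product)
qed

end

section \<open>Breadth-first search\<close>

context graph begin

text \<open>Edge \<open>i\<close> yields the arcs \<open>i\<close> and \<open>m + i\<close>, one per
  direction; \<open>aeid\<close> leads back from an arc to its edge.\<close>

definition asrc :: "nat \<Rightarrow> nat" where "asrc j = (if j < m then u j else v (j - m))"
definition atgt :: "nat \<Rightarrow> nat" where "atgt j = (if j < m then v j else u (j - m))"
definition aeid :: "nat \<Rightarrow> nat" where "aeid j = (if j < m then j else j - m)"

text \<open>A pointer is an arc number plus one, and 0 ends a list; \<open>lastarc x b\<close> points to the last
  arc below \<open>b\<close> that leaves \<open>x\<close>.\<close>

fun lastarc :: "nat \<Rightarrow> nat \<Rightarrow> nat" where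
  "lastarc x 0 = 0"
| "lastarc x (Suc b) = (if asrc b = x then Suc b else lastarc x b)"

lemma lastarc_le: "lastarc x b \<le> b"
  by (induction b) auto

lemma lastarc_greater: "j < b \<Longrightarrow> asrc j = x \<Longrightarrow> j < lastarc x b"
  by (induction b) (auto simp: less_Suc_eq)

lemma asrc_lastarc: "lastarc x b \<noteq> 0 \<Longrightarrow> asrc (lastarc x b - 1) = x"
  by (induction b) auto

lemma arc_less: "j < m + m \<Longrightarrow> asrc j < n \<and> atgt j < n \<and> aeid j < m \<and>
    {u (aeid j), v (aeid j)} = {asrc j, atgt j} \<and> asrc j \<noteq> atgt j"
  using ends[of j] ends[of "j - m"]
  by (cases "j < m") (simp_all add: asrc_def atgt_def aeid_def insert_commute eq_commute)

lemma adj_arc: "adj X x y \<longleftrightarrow> (\<exists>j<m + m. asrc j = x \<and> atgt j = y \<and> aeid j \<notin> X)"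
proof
  assume "adj X x y"
  then obtain i where i: "i < m" "i \<notin> X" "{u i, v i} = {x, y}" by (auto simp: adj_def)
  then have *: "aeid i = i" "aeid (m + i) = i" by (auto simp: aeid_def)
  from i have "asrc i = x \<and> atgt i = y \<or> asrc (m + i) = x \<and> atgt (m + i) = y"
    by (auto simp: asrc_def atgt_def doubleton_eq_iff)
  then show "\<exists>j<m + m. asrc j = x \<and> atgt j = y \<and> aeid j \<notin> X"
  proof
    assume "asrc i = x \<and> atgt i = y" with i * show ?thesis by (intro exI[of _ i]) simp
  next
    assume "asrc (m + i) = x \<and> atgt (m + i) = y" with i * show ?thesis by (intro exI[of _ "m + i"]) simp
  qed
next
  assume "\<exists>j<m + m. asrc j = x \<and> atgt j = y \<and> aeid j \<notin> X"
  then obtain j where "j < m + m" "asrc j = x" "atgt j = y" "aeid j \<notin> X" by blast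
  then show "adj X x y" using arc_less[of j] unfolding adj_def by blast
qed

text \<open>A walk of \<open>d\<close> edges from \<open>S\<close> to \<open>x\<close> that starts
  with the edge \<open>b\<close> and afterwards uses no edge at \<open>S\<close>. The last condition
  is what makes the walk avoid every edge at \<open>S\<close> other than \<open>b\<close>, so that
  walks from two branches can be glued into a detour around one of the two first edges.\<close>

definition branch :: "nat set \<Rightarrow> nat \<Rightarrow> nat \<Rightarrow> nat \<Rightarrow> nat \<Rightarrow> bool" where
  "branch X S b x d \<longleftrightarrow> (\<exists>w L. b < m \<and> b \<notin> X \<and> {u b, v b} = {S, w} \<and> w \<noteq> S \<and> d = Suc L \<and>
     (adj (X \<union> {i. S \<in> {u i, v i}}) ^^ L) w x)"

lemma branchE:
  assumes "branch X S b x d"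
  obtains w L where "b < m" "b \<notin> X" "{u b, v b} = {S, w}" "w \<noteq> S" "d = Suc L"
    "(adj (X \<union> {i. S \<in> {u i, v i}}) ^^ L) w x"
  using assms unfolding branch_def by (elim exE conjE) (rule that)

text \<open>\<open>qh\<close> vertices have been taken from the queue, the last of them being
  \<open>y\<close>, whose arc list is being scanned. Lists run from high to low arc numbers and a
  pointer is an arc number plus one; hence an arc \<open>j\<close> counts as scanned if its tail has
  been taken and, in case the tail is \<open>y\<close>, if \<open>p \<le> j\<close>. Depths increase
  along the queue and exceed that of \<open>y\<close> by at most 1, which is the property behind
  shortest paths.\<close>

definition bfs_inv :: "nat set \<Rightarrow> nat \<Rightarrow> (nat \<Rightarrow> nat) \<Rightarrow> nat \<Rightarrow> nat \<Rightarrow> nat \<Rightarrow> nat \<Rightarrow>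
    (nat \<Rightarrow> nat) \<Rightarrow> (nat \<Rightarrow> nat) \<Rightarrow> (nat \<Rightarrow> nat) \<Rightarrow> bool" where
  "bfs_inv X S q qh qt p y sn ds br \<longleftrightarrow>
     qh \<le> qt \<and> 1 \<le> qt \<and> inj_on q {..<qt} \<and> q ` {..<qt} \<subseteq> {..<n} \<and> q 0 = S \<and> ds S = 0 \<and>
     (\<forall>x<n. sn x = (if x \<in> q ` {..<qt} then 1 else 0)) \<and>
     (\<forall>i j. i \<le> j \<longrightarrow> j < qt \<longrightarrow> ds (q i) \<le> ds (q j)) \<and>
     (if qh = 0 then p = 0 \<and> qt = 1 else y = q (qh - 1) \<and> (\<forall>i<qt. ds (q i) \<le> ds y + 1)) \<and>
     p \<le> m + m \<and> (p \<noteq> 0 \<longrightarrow> asrc (p - 1) = y) \<and>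
     (\<forall>j<m + m. asrc j \<in> q ` {..<qh} \<longrightarrow> (asrc j = y \<longrightarrow> p \<le> j) \<longrightarrow> aeid j \<notin> X \<longrightarrow>
        atgt j \<in> q ` {..<qt} \<and> ds (atgt j) \<le> ds (asrc j) + 1) \<and>
     (\<forall>x\<in>q ` {..<qt}. (adj X ^^ ds x) S x \<and> (x \<noteq> S \<longrightarrow> branch X S (br x) x (ds x)))"

lemma bfs_invD:
  assumes "bfs_inv X S q qh qt p y sn ds br"
  shows "qh \<le> qt" "1 \<le> qt" "inj_on q {..<qt}" "q ` {..<qt} \<subseteq> {..<n}" "q 0 = S" "ds S = 0"
    "\<forall>x<n. sn x = (if x \<in> q ` {..<qt} then 1 else 0)"
    "\<forall>i j. i \<le> j \<longrightarrow> j < qt \<longrightarrow> ds (q i) \<le> ds (q j)"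
    "if qh = 0 then p = 0 \<and> qt = 1 else y = q (qh - 1) \<and> (\<forall>i<qt. ds (q i) \<le> ds y + 1)"
    "p \<le> m + m" "p \<noteq> 0 \<longrightarrow> asrc (p - 1) = y"
    "\<forall>j<m + m. asrc j \<in> q ` {..<qh} \<longrightarrow> (asrc j = y \<longrightarrow> p \<le> j) \<longrightarrow> aeid j \<notin> X \<longrightarrow>
        atgt j \<in> q ` {..<qt} \<and> ds (atgt j) \<le> ds (asrc j) + 1"
    "\<forall>x\<in>q ` {..<qt}. (adj X ^^ ds x) S x \<and> (x \<noteq> S \<longrightarrow> branch X S (br x) x (ds x))"
  using assms unfolding bfs_inv_def by blast+

lemma bfs_invI:
  assumes "qh \<le> qt" "1 \<le> qt" "inj_on q {..<qt}" "q ` {..<qt} \<subseteq> {..<n}" "q 0 = S" "ds S = 0"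
    "\<forall>x<n. sn x = (if x \<in> q ` {..<qt} then 1 else 0)"
    "\<forall>i j. i \<le> j \<longrightarrow> j < qt \<longrightarrow> ds (q i) \<le> ds (q j)"
    "if qh = 0 then p = 0 \<and> qt = 1 else y = q (qh - 1) \<and> (\<forall>i<qt. ds (q i) \<le> ds y + 1)"
    "p \<le> m + m" "p \<noteq> 0 \<longrightarrow> asrc (p - 1) = y"
    "\<forall>j<m + m. asrc j \<in> q ` {..<qh} \<longrightarrow> (asrc j = y \<longrightarrow> p \<le> j) \<longrightarrow> aeid j \<notin> X \<longrightarrow>
        atgt j \<in> q ` {..<qt} \<and> ds (atgt j) \<le> ds (asrc j) + 1"
    "\<forall>x\<in>q ` {..<qt}. (adj X ^^ ds x) S x \<and> (x \<noteq> S \<longrightarrow> branch X S (br x) x (ds x))"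
  shows "bfs_inv X S q qh qt p y sn ds br"
  unfolding bfs_inv_def by (intro conjI assms)

lemma bfs_inv_arcD:
  assumes "bfs_inv X S q qh qt p y sn ds br" "p \<noteq> 0"
  shows "asrc (p - 1) = y" "p - 1 < m + m" "y \<in> q ` {..<qh}" "\<forall>i<qt. ds (q i) \<le> ds y + 1"
    "y = q (qh - 1)" "qh \<noteq> 0" "p \<le> m + m"
proof -
  have "if qh = 0 then p = 0 \<and> qt = 1 else y = q (qh - 1) \<and> (\<forall>i<qt. ds (q i) \<le> ds y + 1)"
    using assms(1) unfolding bfs_inv_def by blast
  then show *: "\<forall>i<qt. ds (q i) \<le> ds y + 1" "y = q (qh - 1)" "qh \<noteq> 0"
    using assms(2) by (auto split: if_splits)
  show "asrc (p - 1) = y" "p \<le> m + m" using assms unfolding bfs_inv_def by blast+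
  then show "p - 1 < m + m" using assms(2) by linarith
  show "y \<in> q ` {..<qh}" using * by (intro image_eqI[of _ _ "qh - 1"]) auto
qed

text \<open>Unscanned arcs plus vertices not yet taken from the queue. Taking a vertex lowers the
  second summand, following an arc the first.\<close>

definition bfs_measure :: "(nat \<Rightarrow> nat) \<Rightarrow> nat \<Rightarrow> nat \<Rightarrow> nat \<Rightarrow> nat" where
  "bfs_measure q qh p y =
     card {j. j < m + m \<and> \<not> (asrc j \<in> q ` {..<qh} \<and> (asrc j = y \<longrightarrow> p \<le> j))} + (n - qh)"

lemma bfs_measure_le: "bfs_measure q qh p y \<le> m + m + n"
proof -
  have "card {j. j < m + m \<and> \<not> (asrc j \<in> q ` {..<qh} \<and> (asrc j = y \<longrightarrow> p \<le> j))} \<le> card {..<m + m}"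
    by (rule card_mono) auto
  then show ?thesis unfolding bfs_measure_def by simp
qed

lemma bfs_inv_init:
  "S < n \<Longrightarrow> q 0 = S \<Longrightarrow> ds S = 0 \<Longrightarrow> \<forall>x<n. sn x = (if x = S then 1 else 0) \<Longrightarrow>
     bfs_inv X S q 0 1 0 y sn ds br"
  unfolding bfs_inv_def by (auto simp: lessThan_Suc)

lemma bfs_inv_qt_le: "bfs_inv X S q qh qt p y sn ds br \<Longrightarrow> qt \<le> n"
  using card_inj_on_le[of q "{..<qt}" "{..<n}"] by (auto simp: bfs_inv_def)

lemma bfs_inv_pop:
  assumes inv: "bfs_inv X S q qh qt 0 y sn ds br" and "qh < qt"
  shows "bfs_inv X S q (Suc qh) qt (lastarc (q qh) (m + m)) (q qh) sn ds br"
    and "bfs_measure q (Suc qh) (lastarc (q qh) (m + m)) (q qh) < bfs_measure q qh 0 y"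
proof -
  let ?p = "lastarc (q qh) (m + m)"
  note D = bfs_invD[OF inv]
  have new: "q qh \<notin> q ` {..<qh}" using D(3) assms(2) by (force simp: inj_on_def)
  \<comment> \<open>The queue is sorted by depth, so the new head is at least as deep as the old one
    and inherits its spread bound. For the very first head the queue is a singleton.\<close>
  have bound: "\<forall>i<qt. ds (q i) \<le> ds (q qh) + 1"
  proof (cases "qh = 0")
    case True then show ?thesis using D(9) by auto
  next
    case False
    then have *: "\<forall>i<qt. ds (q i) \<le> ds (q (qh - 1)) + 1" using D(9) by auto
    have "ds (q (qh - 1)) \<le> ds (q qh)" using D(8) assms(2) by simp
    with * show ?thesis by (meson add_le_mono1 le_trans)
  qed
  \<comment> \<open>All arcs of the new head lie below its initial pointer, so none of them counts
    as scanned yet.\<close>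
  have popped: "\<forall>j<m + m. asrc j \<in> q ` {..<Suc qh} \<longrightarrow> (asrc j = q qh \<longrightarrow> ?p \<le> j) \<longrightarrow>
      asrc j \<in> q ` {..<qh}"
    using lastarc_greater[of _ "m + m" "q qh"] by (auto simp: lessThan_Suc not_le[symmetric])
  have "\<forall>j<m + m. asrc j \<in> q ` {..<Suc qh} \<longrightarrow> (asrc j = q qh \<longrightarrow> ?p \<le> j) \<longrightarrow> aeid j \<notin> X \<longrightarrow>
        atgt j \<in> q ` {..<qt} \<and> ds (atgt j) \<le> ds (asrc j) + 1"
    using popped D(12) by blast
  have "if Suc qh = 0 then ?p = 0 \<and> qt = 1
      else q qh = q (Suc qh - 1) \<and> (\<forall>i<qt. ds (q i) \<le> ds (q qh) + 1)"
    using bound by simp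
  have "?p \<noteq> 0 \<longrightarrow> asrc (?p - 1) = q qh" using asrc_lastarc by blast
  have "Suc qh \<le> qt" using assms(2) by simp
  have "?p \<le> m + m" by (rule lastarc_le)
  show "bfs_inv X S q (Suc qh) qt ?p (q qh) sn ds br"
    by (intro bfs_invI; fact)
  have "{j. j < m + m \<and> \<not> (asrc j \<in> q ` {..<Suc qh} \<and> (asrc j = q qh \<longrightarrow> ?p \<le> j))}
     \<subseteq> {j. j < m + m \<and> \<not> (asrc j \<in> q ` {..<qh} \<and> (asrc j = y \<longrightarrow> 0 \<le> j))}"
    using new by (auto simp: lessThan_Suc intro: rev_image_eqI)
  then have "card {j. j < m + m \<and> \<not> (asrc j \<in> q ` {..<Suc qh} \<and> (asrc j = q qh \<longrightarrow> ?p \<le> j))}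
     \<le> card {j. j < m + m \<and> \<not> (asrc j \<in> q ` {..<qh} \<and> (asrc j = y \<longrightarrow> 0 \<le> j))}"
    by (rule card_mono[rotated]) auto
  moreover have "qh < n" using bfs_inv_qt_le[OF inv] assms(2) by simp
  ultimately show "bfs_measure q (Suc qh) ?p (q qh) < bfs_measure q qh 0 y"
    unfolding bfs_measure_def by linarith
qed

text \<open>\<open>q'\<close> has to agree with \<open>q\<close> only on the part already taken;
  this covers both skipping an arc and appending its head to the queue.\<close>

lemma bfs_measure_arc:
  assumes inv: "bfs_inv X S q qh qt p y sn ds br" and p: "p \<noteq> 0"
    and q': "\<And>i. i < qh \<Longrightarrow> q' i = q i"
  shows "bfs_measure q' qh (lastarc y (p - 1)) y < bfs_measure q qh p y"
proof -
  have im: "q' ` {..<qh} = q ` {..<qh}" using q' by auto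
  note y = bfs_inv_arcD[OF inv p]
  have "{j. j < m + m \<and> \<not> (asrc j \<in> q ` {..<qh} \<and> (asrc j = y \<longrightarrow> lastarc y (p - 1) \<le> j))}
     \<subset> {j. j < m + m \<and> \<not> (asrc j \<in> q ` {..<qh} \<and> (asrc j = y \<longrightarrow> p \<le> j))}"
  proof (rule psubsetI)
    have "p - 1 \<in> {j. j < m + m \<and> \<not> (asrc j \<in> q ` {..<qh} \<and> (asrc j = y \<longrightarrow> p \<le> j))}"
      using y p by auto
    moreover have "p - 1 \<notin> {j. j < m + m \<and> \<not> (asrc j \<in> q ` {..<qh} \<and> (asrc j = y \<longrightarrow> lastarc y (p - 1) \<le> j))}"
      using y lastarc_le by auto
    ultimately show "{j. j < m + m \<and> \<not> (asrc j \<in> q ` {..<qh} \<and> (asrc j = y \<longrightarrow> lastarc y (p - 1) \<le> j))}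
     \<noteq> {j. j < m + m \<and> \<not> (asrc j \<in> q ` {..<qh} \<and> (asrc j = y \<longrightarrow> p \<le> j))}" by metis
  qed (use lastarc_le[of y "p - 1"] in auto)
  then show ?thesis unfolding bfs_measure_def im
    by (intro add_less_le_mono psubset_card_mono) auto
qed

lemma bfs_inv_skip:
  assumes inv: "bfs_inv X S q qh qt p y sn ds br" and p: "p \<noteq> 0"
    and skip: "aeid (p - 1) \<in> X \<or> sn (atgt (p - 1)) \<noteq> 0"
  shows "bfs_inv X S q qh qt (lastarc y (p - 1)) y sn ds br"
proof -
  note y = bfs_inv_arcD[OF inv p]
  note D = bfs_invD[OF inv]
  have "sn (atgt (p - 1)) \<noteq> 0 \<longrightarrow> atgt (p - 1) \<in> q ` {..<qt}"
    using D(7) arc_less[OF y(2)] by simp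
  then have 1: "aeid (p - 1) \<notin> X \<longrightarrow> atgt (p - 1) \<in> q ` {..<qt} \<and> ds (atgt (p - 1)) \<le> ds (asrc (p - 1)) + 1"
    using skip y(1,4) by auto
  \<comment> \<open>Between two consecutive entries of the list of \<open>y\<close> there is no arc
    with tail \<open>y\<close>, so moving the pointer makes exactly the arc \<open>p - 1\<close>
    newly scanned.\<close>
  have "j = p - 1 \<or> p \<le> j" if "j < m + m" "asrc j = y" "lastarc y (p - 1) \<le> j" for j
    using that lastarc_greater[of j "p - 1" y] by fastforce
  with D(12) have "\<forall>j<m + m. asrc j \<in> q ` {..<qh} \<longrightarrow> (asrc j = y \<longrightarrow> lastarc y (p - 1) \<le> j) \<longrightarrow> aeid j \<notin> X \<longrightarrow>
        atgt j \<in> q ` {..<qt} \<and> ds (atgt j) \<le> ds (asrc j) + 1"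
    using 1 by blast
  have "if qh = 0 then lastarc y (p - 1) = 0 \<and> qt = 1
      else y = q (qh - 1) \<and> (\<forall>i<qt. ds (q i) \<le> ds y + 1)"
    using y by simp
  have "lastarc y (p - 1) \<le> m + m" using lastarc_le[of y "p - 1"] y(7) by linarith
  have "lastarc y (p - 1) \<noteq> 0 \<longrightarrow> asrc (lastarc y (p - 1) - 1) = y" using asrc_lastarc by blast
  show ?thesis by (intro bfs_invI; fact)
qed

lemma bfs_inv_new:
  assumes inv: "bfs_inv X S q qh qt p y sn ds br" and p: "p \<noteq> 0"
    and new: "aeid (p - 1) \<notin> X" "sn (atgt (p - 1)) = 0"
    and z: "z = atgt (p - 1)"
  shows "bfs_inv X S (q(qt := z)) qh (Suc qt) (lastarc y (p - 1)) y (sn(z := 1))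
     (ds(z := Suc (ds y))) (br(z := (if y = S then aeid (p - 1) else br y)))"
proof -
  let ?q = "q(qt := z)" and ?ds = "ds(z := Suc (ds y))"
    and ?br = "br(z := (if y = S then aeid (p - 1) else br y))"
  note y = bfs_inv_arcD[OF inv p]
  note D = bfs_invD[OF inv]
  note q = D(1,3,4,5,2,6) and sn = D(7)
  have mono: "\<And>i j. i \<le> j \<Longrightarrow> j < qt \<Longrightarrow> ds (q i) \<le> ds (q j)" using D(8) by blast
  have arc: "z < n" "aeid (p - 1) < m" "{u (aeid (p - 1)), v (aeid (p - 1))} = {y, z}" "y \<noteq> z"
    using arc_less[OF y(2)] unfolding y(1) z by blast+
  have zn: "z \<notin> q ` {..<qt}" using sn arc(1) new(2) z by (metis zero_neq_one)
  have im: "?q ` {..<Suc qt} = insert z (q ` {..<qt})" by (auto simp: lessThan_Suc)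
  have imh: "?q ` {..<qh} = q ` {..<qh}" using q(1) by (intro image_cong) auto
  have "S \<in> q ` {..<qt}" using q(4,5) by (intro image_eqI[of _ _ 0]) auto
  have "y \<in> q ` {..<qt}" using y(3) q(1) by auto
  have zS: "z \<noteq> S" using zn \<open>S \<in> q ` {..<qt}\<close> by auto
  have q_ne: "\<And>i. i < qt \<Longrightarrow> q i \<noteq> z" using zn by auto
  have "inj_on ?q {..<Suc qt}"
    using q(2) q_ne by (fastforce simp: inj_on_def less_Suc_eq)
  \<comment> \<open>The appended depth is one more than that of \<open>y\<close>; by the spread
    bound no depth in the queue exceeds it, so the queue stays sorted.\<close>
  have "\<forall>i j. i \<le> j \<longrightarrow> j < Suc qt \<longrightarrow> ?ds (?q i) \<le> ?ds (?q j)"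
    using mono y(4) q_ne by (auto simp: less_Suc_eq le_eq_less_or_eq)
  have "\<forall>i<Suc qt. ?ds (?q i) \<le> ?ds y + 1"
    using y(4) q_ne arc(4) by (auto simp: less_Suc_eq)
  have "\<forall>j<m + m. asrc j \<in> ?q ` {..<qh} \<longrightarrow> (asrc j = y \<longrightarrow> lastarc y (p - 1) \<le> j) \<longrightarrow> aeid j \<notin> X \<longrightarrow>
        atgt j \<in> ?q ` {..<Suc qt} \<and> ?ds (atgt j) \<le> ?ds (asrc j) + 1"
  proof (intro allI impI)
    fix j assume j: "j < m + m" "asrc j \<in> ?q ` {..<qh}" "asrc j = y \<longrightarrow> lastarc y (p - 1) \<le> j" "aeid j \<notin> X"
    show "atgt j \<in> ?q ` {..<Suc qt} \<and> ?ds (atgt j) \<le> ?ds (asrc j) + 1"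
    proof (cases "j = p - 1")
      case True
      then show ?thesis using y(1) z arc(4) im by simp
    next
      case False
      then have "asrc j = y \<longrightarrow> p \<le> j"
        using j lastarc_greater[of j "p - 1" y] by fastforce
      then have *: "atgt j \<in> q ` {..<qt} \<and> ds (atgt j) \<le> ds (asrc j) + 1"
        using D(12) j(1,2,4) unfolding imh by blast
      moreover have "asrc j \<noteq> z" using j(2) q(1) zn unfolding imh by auto
      moreover have "atgt j \<noteq> z" using * zn by blast
      ultimately show ?thesis unfolding im by simp
    qed
  qed
  have "\<forall>x\<in>?q ` {..<Suc qt}. (adj X ^^ ?ds x) S x \<and> (x \<noteq> S \<longrightarrow> branch X S (?br x) x (?ds x))"
  proof
    fix x assume x: "x \<in> ?q ` {..<Suc qt}"
    note old = D(13)
    show "(adj X ^^ ?ds x) S x \<and> (x \<noteq> S \<longrightarrow> branch X S (?br x) x (?ds x))"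
    proof (cases "x = z")
      case False
      then show ?thesis using x im old by auto
    next
      case True
      have yz: "adj X y z" using arc new(1) by (auto simp: adj_def)
      have yq: "(adj X ^^ ds y) S y" "y \<noteq> S \<longrightarrow> branch X S (br y) y (ds y)"
        using old \<open>y \<in> q ` {..<qt}\<close> by auto
      have "branch X S (?br z) z (Suc (ds y))"
      proof (cases "y = S")
        case True
        then show ?thesis unfolding branch_def using arc new(1) zS q(6) by (intro exI[of _ z] exI[of _ 0]) auto
      next
        case False
        with yq(2) have "branch X S (br y) y (ds y)" by (rule mp)
        then obtain w L where wL: "br y < m" "br y \<notin> X" "{u (br y), v (br y)} = {S, w}" "w \<noteq> S"
          "ds y = Suc L" "(adj (X \<union> {i. S \<in> {u i, v i}}) ^^ L) w y" by (rule branchE)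
        \<comment> \<open>Neither end of the followed edge is the root, so the walk behind the label
          of \<open>y\<close> extends to the new vertex without touching \<open>S\<close>
          again.\<close>
        have "S \<notin> {u (aeid (p - 1)), v (aeid (p - 1))}" unfolding arc(3) using False zS by simp
        then have "aeid (p - 1) \<notin> X \<union> {i. S \<in> {u i, v i}}" using new(1) by simp
        then have "adj (X \<union> {i. S \<in> {u i, v i}}) y z"
          unfolding adj_def by (intro exI[of _ "aeid (p - 1)"] conjI arc(2,3))
        with wL(6) have "(adj (X \<union> {i. S \<in> {u i, v i}}) ^^ Suc L) w z" by auto
        then show ?thesis unfolding branch_def using wL False by (intro exI[of _ w] exI[of _ "Suc L"]) auto
      qed
      moreover have "(adj X ^^ Suc (ds y)) S z" using yq(1) yz by auto
      ultimately show ?thesis using True by simp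
    qed
  qed
  have "\<forall>x<n. (sn(z := 1)) x = (if x \<in> ?q ` {..<Suc qt} then 1 else 0)"
    using sn unfolding im by auto
  have "lastarc y (p - 1) \<le> m + m" using lastarc_le[of y "p - 1"] y(7) by linarith
  have "lastarc y (p - 1) \<noteq> 0 \<longrightarrow> asrc (lastarc y (p - 1) - 1) = y" using asrc_lastarc by simp
  have "?ds S = 0" using q(6) zS by simp
  have "if qh = 0 then lastarc y (p - 1) = 0 \<and> Suc qt = 1
      else y = ?q (qh - 1) \<and> (\<forall>i<Suc qt. ?ds (?q i) \<le> ?ds y + 1)"
  proof -
    have "qh - 1 \<noteq> qt" using y(6) q(1) by linarith
    then have "y = ?q (qh - 1)" using y(5) by (metis fun_upd_apply)
    then show ?thesis using y(6) \<open>\<forall>i<Suc qt. ?ds (?q i) \<le> ?ds y + 1\<close> by (metis (lifting))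
  qed
  have "?q 0 = S" "qh \<le> Suc qt" "1 \<le> Suc qt" using q(1,4,5) by auto
  have "?q ` {..<Suc qt} \<subseteq> {..<n}" unfolding im using q(3) arc(1) by auto
  show ?thesis by (intro bfs_invI; fact)
qed

definition bfs_post :: "nat set \<Rightarrow> nat \<Rightarrow> (nat \<Rightarrow> nat) \<Rightarrow> (nat \<Rightarrow> nat) \<Rightarrow> (nat \<Rightarrow> nat) \<Rightarrow> bool" where
  "bfs_post X S sn ds br \<longleftrightarrow> (\<forall>x<n. (sn x = 1 \<longleftrightarrow> (\<exists>L. (adj X ^^ L) S x)) \<and>
     (sn x = 1 \<longrightarrow> (adj X ^^ ds x) S x \<and> (\<forall>L. (adj X ^^ L) S x \<longrightarrow> ds x \<le> L) \<and>
        (x \<noteq> S \<longrightarrow> branch X S (br x) x (ds x))))"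

text \<open>With an empty queue and an exhausted list, every arc out of a seen vertex has been
  scanned. Induction along an arbitrary walk then shows that its end is seen at a depth not
  exceeding the length of the walk.\<close>

lemma bfs_inv_final:
  assumes inv: "bfs_inv X S q qh qh 0 y sn ds br"
  shows "bfs_post X S sn ds br"
proof -
  note D = bfs_invD[OF inv]
  have S: "S \<in> q ` {..<qh}" using D(2,5) by (intro image_eqI[of _ _ 0]) auto
  have step: "\<forall>j<m + m. asrc j \<in> q ` {..<qh} \<longrightarrow> aeid j \<notin> X \<longrightarrow>
        atgt j \<in> q ` {..<qh} \<and> ds (atgt j) \<le> ds (asrc j) + 1"
    using D(12) by simp
  have complete: "(adj X ^^ L) S x \<Longrightarrow> x \<in> q ` {..<qh} \<and> ds x \<le> L" for L x
  proof (induction L arbitrary: x)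
    case 0 then show ?case using S D(6) by auto
  next
    case (Suc L)
    then obtain z where z: "(adj X ^^ L) S z" "adj X z x" by auto
    with Suc.IH have "z \<in> q ` {..<qh}" "ds z \<le> L" by auto
    with step z(2) show ?case unfolding adj_arc by fastforce
  qed
  have seen: "sn x = 1 \<longleftrightarrow> x \<in> q ` {..<qh}" if "x < n" for x using D(7) that by auto
  show ?thesis unfolding bfs_post_def
  proof (intro allI impI)
    fix x assume "x < n"
    show "(sn x = 1 \<longleftrightarrow> (\<exists>L. (adj X ^^ L) S x)) \<and>
     (sn x = 1 \<longrightarrow> (adj X ^^ ds x) S x \<and> (\<forall>L. (adj X ^^ L) S x \<longrightarrow> ds x \<le> L) \<and>
        (x \<noteq> S \<longrightarrow> branch X S (br x) x (ds x)))"
      unfolding seen[OF \<open>x < n\<close>] using D(13) complete by blast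
  qed
qed

end

section \<open>Breadth-first search as a RAM program\<close>

notation Seq (infixr ";;" 60)

text \<open>\<open>sn\<close> marks the vertices seen from \<open>s\<close>, \<open>ds\<close> is their depth, \<open>br\<close> the first edge of their
  path; the queue is \<open>q\<close> from \<open>qh\<close> to \<open>qt\<close>, and \<open>p\<close> points to the next arc of the scanned vertex \<open>y\<close>.
  Edges marked in \<open>ban\<close> are skipped.\<close>

definition bfs_step :: com where
  "bfs_step = Cond (Equal (Sc ''p'') (Const 0))
     (Set ''y'' (Read ''q'' (Sc ''qh'')) ;; Set ''qh'' (Plus (Sc ''qh'') (Const 1)) ;;
      Set ''p'' (Read ''hd'' (Sc ''y'')))
     (Set ''j'' (Minus (Sc ''p'') (Const 1)) ;; Set ''z'' (Read ''at'' (Sc ''j'')) ;;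
      Cond (Conj (Neg (Equal (Read ''ban'' (Read ''ae'' (Sc ''j''))) (Const 1)))
                 (Equal (Read ''sn'' (Sc ''z'')) (Const 0)))
        (Write ''sn'' (Sc ''z'') (Const 1) ;;
         Write ''ds'' (Sc ''z'') (Plus (Read ''ds'' (Sc ''y'')) (Const 1)) ;;
         Cond (Equal (Sc ''y'') (Sc ''s''))
           (Write ''br'' (Sc ''z'') (Read ''ae'' (Sc ''j'')))
           (Write ''br'' (Sc ''z'') (Read ''br'' (Sc ''y''))) ;;
         Write ''q'' (Sc ''qt'') (Sc ''z'') ;; Set ''qt'' (Plus (Sc ''qt'') (Const 1)))
        Skip ;;
      Set ''p'' (Read ''nx'' (Sc ''j'')))"

definition bfs :: com where
  "bfs = For ''x'' (Sc ''in_n'') (Write ''sn'' (Sc ''x'') (Const 0)) ;;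
     (Write ''sn'' (Sc ''s'') (Const 1) ;; Write ''ds'' (Sc ''s'') (Const 0) ;;
      Set ''q'' (Sc ''s'') ;; Set ''qh'' (Const 0) ;; Set ''qt'' (Const 1) ;; Set ''p'' (Const 0)) ;;
     Loop (Neg (Conj (Equal (Sc ''p'') (Const 0)) (Equal (Sc ''qh'') (Sc ''qt'')))) bfs_step"

context graph begin

definition holds_graph :: "state \<Rightarrow> bool" where
  "holds_graph s \<longleftrightarrow> s ''in_n'' 0 = n \<and> s ''in_m'' 0 = m \<and>
     (\<forall>i<m. s ''in_u'' i = u i \<and> s ''in_v'' i = v i)"

definition holds_arcs :: "state \<Rightarrow> bool" where
  "holds_arcs s \<longleftrightarrow> holds_graph s \<and>
     (\<forall>j<m + m. s ''at'' j = atgt j \<and> s ''ae'' j = aeid j \<and> s ''nx'' j = lastarc (asrc j) j) \<and>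
     (\<forall>x<n. s ''hd'' x = lastarc x (m + m))"

definition state_inv :: "nat set \<Rightarrow> state \<Rightarrow> bool" where
  "state_inv X s \<longleftrightarrow> bfs_inv X (s ''s'' 0) (s ''q'') (s ''qh'' 0) (s ''qt'' 0) (s ''p'' 0) (s ''y'' 0)
     (s ''sn'') (s ''ds'') (s ''br'')"

definition state_measure :: "state \<Rightarrow> nat" where
  "state_measure s = bfs_measure (s ''q'') (s ''qh'' 0) (s ''p'' 0) (s ''y'' 0)"

lemma runs_bfs_step:
  assumes "holds_arcs s" "\<forall>i<m. s ''ban'' i = 1 \<longleftrightarrow> i \<in> X" "state_inv X s"
    "\<not> (s ''p'' 0 = 0 \<and> s ''qh'' 0 = s ''qt'' 0)"
  shows "runs bfs_step s 200 (\<lambda>s'. state_inv X s' \<and> state_measure s' < state_measure s)"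
proof (cases "s ''p'' 0 = 0")
  case True
  have inv: "bfs_inv X (s ''s'' 0) (s ''q'') (s ''qh'' 0) (s ''qt'' 0) 0 (s ''y'' 0)
     (s ''sn'') (s ''ds'') (s ''br'')" using assms(3) True by (simp add: state_inv_def)
  have lt: "s ''qh'' 0 < s ''qt'' 0" using bfs_invD(1)[OF inv] assms(4) True by simp
  have "s ''q'' (s ''qh'' 0) < n" using bfs_invD(4)[OF inv] lt by blast
  then have hd: "s ''hd'' (s ''q'' (s ''qh'' 0)) = lastarc (s ''q'' (s ''qh'' 0)) (m + m)"
    using assms(1) by (simp add: holds_arcs_def)
  show ?thesis
  proof (rule runs_loop_free)
    show "state_inv X (run bfs_step s) \<and> state_measure (run bfs_step s) < state_measure s"
      using bfs_inv_pop[OF inv lt] True hd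
      by (simp add: state_inv_def state_measure_def bfs_step_def)
  qed (simp_all add: bfs_step_def)
next
  case False
  have inv: "bfs_inv X (s ''s'' 0) (s ''q'') (s ''qh'' 0) (s ''qt'' 0) (s ''p'' 0) (s ''y'' 0)
     (s ''sn'') (s ''ds'') (s ''br'')" using assms(3) by (simp add: state_inv_def)
  define j where "j = s ''p'' 0 - 1"
  have j: "s ''p'' 0 - Suc 0 = j" by (simp add: j_def)
  note y = bfs_inv_arcD[OF inv False, folded j_def]
  have st: "s ''at'' j = atgt j" "s ''ae'' j = aeid j" "s ''nx'' j = lastarc (s ''y'' 0) j"
    using assms(1) y(1,2) by (auto simp: holds_arcs_def)
  have ban: "s ''ban'' (aeid j) = 1 \<longleftrightarrow> aeid j \<in> X" using assms(2) arc_less[OF y(2)] by blast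
  have qh: "s ''qh'' 0 \<le> s ''qt'' 0" using bfs_invD(1)[OF inv] .
  show ?thesis
  proof (rule runs_loop_free)
    show "state_inv X (run bfs_step s) \<and> state_measure (run bfs_step s) < state_measure s"
    proof (cases "aeid j \<in> X \<or> s ''sn'' (atgt j) \<noteq> 0")
      case True
      then have c: "\<not> (s ''ban'' (aeid j) \<noteq> Suc 0 \<and> s ''sn'' (atgt j) = 0)" using ban by auto
      have "bfs_measure (s ''q'') (s ''qh'' 0) (lastarc (s ''y'' 0) j) (s ''y'' 0)
          < bfs_measure (s ''q'') (s ''qh'' 0) (s ''p'' 0) (s ''y'' 0)"
        using bfs_measure_arc[OF inv False refl] by (simp add: j_def)
      with bfs_inv_skip[OF inv False, folded j_def, OF True] False c show ?thesis
        by (cases "s ''ban'' (aeid j) = Suc 0")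
          (simp_all add: state_inv_def state_measure_def bfs_step_def j st)
    next
      case 2: False
      then have 3: "aeid j \<notin> X" "s ''sn'' (atgt j) = 0" by auto
      then have c: "s ''ban'' (aeid j) \<noteq> Suc 0" using ban by auto
      have "bfs_measure ((s ''q'')(s ''qt'' 0 := atgt j)) (s ''qh'' 0) (lastarc (s ''y'' 0) j) (s ''y'' 0)
          < bfs_measure (s ''q'') (s ''qh'' 0) (s ''p'' 0) (s ''y'' 0)"
        unfolding j_def by (rule bfs_measure_arc[OF inv False]) (use qh in simp)
      with bfs_inv_new[OF inv False, folded j_def, OF 3 refl] False c 3(2) show ?thesis
        by (cases "s ''y'' 0 = s ''s'' 0")
          (simp_all add: state_inv_def state_measure_def bfs_step_def j st)
    qed
  qed (simp_all add: bfs_step_def)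
qed

text \<open>Between two searches only \<open>sn\<close> is reset. Old values in \<open>ds\<close>
  and \<open>br\<close> are harmless, because these arrays are consulted for seen vertices
  only.\<close>

lemma runs_clear:
  assumes "s ''in_n'' 0 = n"
  shows "runs (For ''x'' (Sc ''in_n'') (Write ''sn'' (Sc ''x'') (Const 0))) s ((n + 1) * 30)
       (\<lambda>s'. \<forall>x<n. s' ''sn'' x = 0)"
proof (rule runs_For[where P = "\<lambda>i s'. \<forall>x<i. s' ''sn'' x = 0" and h = n and B = 6])
  fix i and s' :: state assume *: "s' ''x'' 0 = i" "\<forall>x<i. s' ''sn'' x = 0"
  show "runs (Write ''sn'' (Sc ''x'') (Const 0)) s' 6
      (\<lambda>s''. \<forall>x<Suc i. put ''x'' (Suc i) s'' ''sn'' x = 0)"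
    by (rule runs_loop_free) (use * in \<open>auto simp: less_Suc_eq\<close>)
qed (use assms in auto)

text \<open>The measure starts at no more than \<open>m + m + n\<close>, and every step of the loop
  has constant cost.\<close>

lemma runs_bfs:
  assumes "holds_arcs s" "\<forall>i<m. s ''ban'' i = 1 \<longleftrightarrow> i \<in> X" "s ''s'' 0 < n"
  shows "runs bfs s (1000 * (n + m + 1)) (\<lambda>s'. bfs_post X (s ''s'' 0) (s' ''sn'') (s' ''ds'') (s' ''br''))"
proof -
  let ?loop = "Loop (Neg (Conj (Equal (Sc ''p'') (Const 0)) (Equal (Sc ''qh'') (Sc ''qt'')))) bfs_step"
  let ?init = "Write ''sn'' (Sc ''s'') (Const 1) ;; Write ''ds'' (Sc ''s'') (Const 0) ;;
      Set ''q'' (Sc ''s'') ;; Set ''qh'' (Const 0) ;; Set ''qt'' (Const 1) ;; Set ''p'' (Const 0)"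
  have "runs bfs s ((n + 1) * 30 + (100 + (m + m + n + 1) * 250))
     (\<lambda>s'. bfs_post X (s ''s'' 0) (s' ''sn'') (s' ''ds'') (s' ''br''))"
    unfolding bfs_def
  proof (rule runs_Seq)
    show "runs (For ''x'' (Sc ''in_n'') (Write ''sn'' (Sc ''x'') (Const 0))) s ((n + 1) * 30)
       (\<lambda>s'. \<forall>x<n. s' ''sn'' x = 0)"
      using assms(1) by (intro runs_clear) (auto simp: holds_arcs_def holds_graph_def)
  next
    fix s1 assume f: "unchanged (writes (For ''x'' (Sc ''in_n'') (Write ''sn'' (Sc ''x'') (Const 0)))) s1 s"
      and sn: "\<forall>x<n. s1 ''sn'' x = 0"
    have arcs1: "holds_arcs s1" using assms(1) f by (simp add: holds_arcs_def holds_graph_def)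
    show "runs (?init ;; ?loop) s1 (100 + (m + m + n + 1) * 250)
       (\<lambda>s'. bfs_post X (s ''s'' 0) (s' ''sn'') (s' ''ds'') (s' ''br''))"
    proof (rule runs_Seq)
      show "runs ?init s1 100 (state_inv X)"
      proof (rule runs_loop_free)
        have "bfs_inv X (s ''s'' 0) ((s1 ''q'')(0 := s ''s'' 0)) 0 1 0 (s1 ''y'' 0)
            ((s1 ''sn'')(s ''s'' 0 := 1)) ((s1 ''ds'')(s ''s'' 0 := 0)) (s1 ''br'')"
          using sn assms(3) by (intro bfs_inv_init) auto
        then show "state_inv X (run ?init s1)" using f by (simp add: state_inv_def)
      qed simp_all
    next
      fix s2 assume f2: "unchanged (writes ?init) s2 s1" and inv: "state_inv X s2"
      have frame: "holds_arcs s' \<and> (\<forall>i<m. s' ''ban'' i = 1 \<longleftrightarrow> i \<in> X) \<and> s' ''s'' 0 = s ''s'' 0"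
        if "unchanged (writes bfs_step) s' s2" for s'
        using that f f2 assms(1,2) by (simp add: bfs_step_def holds_arcs_def holds_graph_def)
      show "runs ?loop s2 ((m + m + n + 1) * 250)
         (\<lambda>s'. bfs_post X (s ''s'' 0) (s' ''sn'') (s' ''ds'') (s' ''br''))"
      proof (rule runs_Loop[where Inv = "state_inv X" and \<mu> = state_measure and B = 200])
        fix s' assume *: "unchanged (writes bfs_step) s' s2" "state_inv X s'"
          "bval (Neg (Conj (Equal (Sc ''p'') (Const 0)) (Equal (Sc ''qh'') (Sc ''qt'')))) s'"
        then show "runs bfs_step s' 200 (\<lambda>s''. state_inv X s'' \<and> state_measure s'' < state_measure s')"
          using frame[OF *(1)] by (intro runs_bfs_step) auto
      next
        fix s' assume *: "unchanged (writes bfs_step) s' s2" "state_inv X s'"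
          "\<not> bval (Neg (Conj (Equal (Sc ''p'') (Const 0)) (Equal (Sc ''qh'') (Sc ''qt'')))) s'"
        then have "s' ''p'' 0 = 0" "s' ''qh'' 0 = s' ''qt'' 0" by auto
        with *(2) have "bfs_inv X (s ''s'' 0) (s' ''q'') (s' ''qt'' 0) (s' ''qt'' 0) 0 (s' ''y'' 0)
            (s' ''sn'') (s' ''ds'') (s' ''br'')"
          using frame[OF *(1)] by (simp add: state_inv_def)
        then show "bfs_post X (s ''s'' 0) (s' ''sn'') (s' ''ds'') (s' ''br'')" by (rule bfs_inv_final)
      next
        have "(state_measure s2 + 1) * 250 \<le> (m + m + n + 1) * 250"
          using bfs_measure_le by (intro mult_right_mono) (auto simp: state_measure_def)
        then show "(state_measure s2 + 1) * (1 + bcost (Neg (Conj (Equal (Sc ''p'') (Const 0)) (Equal (Sc ''qh'') (Sc ''qt'')))) + 200)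
            \<le> (m + m + n + 1) * 250" by simp
      qed (rule inv)
    qed
  qed
  then show ?thesis by (rule runs_conseq) auto
qed

end

section \<open>Detecting nontrivial edges\<close>

text \<open>Division by repeated addition: \<open>ac\<close> holds \<open>kk + 1\<close> times the
  denominator. Stopping at \<open>n\<close> implements the cap and bounds the number of
  rounds.\<close>

definition compute_k :: com where
  "compute_k = (Set ''kk'' (Const 0) ;; Set ''ac'' (Sc ''in_denom'')) ;;
     Loop (Conj (Less (Sc ''kk'') (Sc ''in_n'')) (Neg (Less (Sc ''in_numer'') (Sc ''ac''))))
       (Set ''ac'' (Plus (Sc ''ac'') (Sc ''in_denom'')) ;; Set ''kk'' (Plus (Sc ''kk'') (Const 1)))"

lemma runs_compute_k:
  assumes D: "0 < s ''in_denom'' 0" "s ''in_denom'' 0 \<le> s ''in_numer'' 0"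
  shows "runs compute_k s (100 * (s ''in_n'' 0 + 1))
    (\<lambda>s'. s' ''kk'' 0 = min (s ''in_n'' 0) (s ''in_numer'' 0 div s ''in_denom'' 0))"
proof -
  let ?n = "s ''in_n'' 0" and ?N = "s ''in_numer'' 0" and ?D = "s ''in_denom'' 0"
  let ?b = "Conj (Less (Sc ''kk'') (Sc ''in_n'')) (Neg (Less (Sc ''in_numer'') (Sc ''ac'')))"
  let ?c = "Set ''ac'' (Plus (Sc ''ac'') (Sc ''in_denom'')) ;; Set ''kk'' (Plus (Sc ''kk'') (Const 1))"
  let ?I = "\<lambda>s'::state. s' ''ac'' 0 = (s' ''kk'' 0 + 1) * ?D \<and> s' ''kk'' 0 * ?D \<le> ?N \<and> s' ''kk'' 0 \<le> ?n"
  have "runs compute_k s (20 + (?n + 1) * 50)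
      (\<lambda>s'. s' ''kk'' 0 = min (s ''in_n'' 0) (s ''in_numer'' 0 div s ''in_denom'' 0))"
    unfolding compute_k_def
  proof (rule runs_Seq[where Q = "\<lambda>s'. ?I s' \<and> s' ''kk'' 0 = 0"])
    show "runs (Set ''kk'' (Const 0) ;; Set ''ac'' (Sc ''in_denom'')) s 20 (\<lambda>s'. ?I s' \<and> s' ''kk'' 0 = 0)"
      by (rule runs_loop_free) simp_all
  next
    fix s1 assume f: "unchanged (writes (Set ''kk'' (Const 0) ;; Set ''ac'' (Sc ''in_denom''))) s1 s"
      and I: "?I s1 \<and> s1 ''kk'' 0 = 0"
    have f1: "s1 ''in_n'' = s ''in_n''" "s1 ''in_numer'' = s ''in_numer''" "s1 ''in_denom'' = s ''in_denom''"
      using f by simp_all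
    show "runs (Loop ?b ?c) s1 ((?n + 1) * 50)
      (\<lambda>s'. s' ''kk'' 0 = min (s ''in_n'' 0) (s ''in_numer'' 0 div s ''in_denom'' 0))"
    proof (rule runs_Loop[where Inv = ?I and \<mu> = "\<lambda>s'. ?n - s' ''kk'' 0" and B = 20])
      fix s' assume f': "unchanged (writes ?c) s' s1" and I: "?I s'" and b: "bval ?b s'"
      have f2: "s' ''in_n'' 0 = ?n" "s' ''in_numer'' 0 = ?N" "s' ''in_denom'' 0 = ?D"
        using f' f1 by simp_all
      have b': "s' ''kk'' 0 < ?n" "(s' ''kk'' 0 + 1) * ?D \<le> ?N" using b I f2 by auto
      have "?I (run ?c s') \<and> ?n - run ?c s' ''kk'' 0 < ?n - s' ''kk'' 0"
        using I b' f2 by simp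
      then show "runs ?c s' 20 (\<lambda>s''. ?I s'' \<and> ?n - s'' ''kk'' 0 < ?n - s' ''kk'' 0)"
        by (intro runs_loop_free) simp_all
    next
      fix s' assume f': "unchanged (writes ?c) s' s1" and I: "?I s'" and b: "\<not> bval ?b s'"
      have f2: "s' ''in_n'' 0 = ?n" "s' ''in_numer'' 0 = ?N" "s' ''in_denom'' 0 = ?D"
        using f' f1 by simp_all
      have "s' ''kk'' 0 \<le> ?N div ?D" using I D(1) by (simp add: less_eq_div_iff_mult_less_eq)
      moreover have "s' ''kk'' 0 = ?n \<or> ?N div ?D \<le> s' ''kk'' 0"
      proof (cases "s' ''kk'' 0 = ?n")
        case False
        then have "?N < (s' ''kk'' 0 + 1) * ?D" using I b f2 by auto
        then show ?thesis using D(1) by (simp add: div_less_iff_less_mult less_Suc_eq_le[symmetric])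
      qed simp
      ultimately show "s' ''kk'' 0 = min ?n (?N div ?D)" using I by auto
    next
      show "(?n - s1 ''kk'' 0 + 1) * (1 + bcost ?b + 20) \<le> (?n + 1) * 50"
        by (intro mult_mono) auto
    qed (use I in simp)
  qed
  then show ?thesis by (rule runs_conseq) auto
qed

text \<open>Arcs are put in front of the list of their tail in increasing order. So
  \<open>hd\<close> always points to the last arc so far, which is \<open>lastarc\<close>, and an
  untouched \<open>hd\<close> is the empty list.\<close>

definition build_arcs :: com where
  "build_arcs =
     For ''i'' (Sc ''in_m'')
       (Write ''as'' (Sc ''i'') (Read ''in_u'' (Sc ''i'')) ;;
        Write ''at'' (Sc ''i'') (Read ''in_v'' (Sc ''i'')) ;;
        Write ''ae'' (Sc ''i'') (Sc ''i'') ;;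
        Write ''as'' (Plus (Sc ''in_m'') (Sc ''i'')) (Read ''in_v'' (Sc ''i'')) ;;
        Write ''at'' (Plus (Sc ''in_m'') (Sc ''i'')) (Read ''in_u'' (Sc ''i'')) ;;
        Write ''ae'' (Plus (Sc ''in_m'') (Sc ''i'')) (Sc ''i'')) ;;
     For ''j'' (Plus (Sc ''in_m'') (Sc ''in_m''))
       (Write ''nx'' (Sc ''j'') (Read ''hd'' (Read ''as'' (Sc ''j''))) ;;
        Write ''hd'' (Read ''as'' (Sc ''j'')) (Plus (Sc ''j'') (Const 1)))"

text \<open>An edge between two branches closes a cycle through \<open>s\<close> with
  \<open>ds + ds + 1\<close> edges. The detour around one of its edges has one edge less, so the sum
  of the depths itself is compared with \<open>kk\<close>. Both first edges lie on the cycle and are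
  marked.\<close>

definition mark_pair :: com where
  "mark_pair =
     Cond (Conj (Neg (Equal (Read ''in_u'' (Sc ''i'')) (Sc ''s'')))
          (Conj (Neg (Equal (Read ''in_v'' (Sc ''i'')) (Sc ''s'')))
          (Conj (Neg (Equal (Read ''br'' (Read ''in_u'' (Sc ''i''))) (Read ''br'' (Read ''in_v'' (Sc ''i'')))))
                (Neg (Less (Sc ''kk'') (Plus (Read ''ds'' (Read ''in_u'' (Sc ''i'')))
                                            (Read ''ds'' (Read ''in_v'' (Sc ''i'')))))))))
       (Write ''nt'' (Read ''br'' (Read ''in_u'' (Sc ''i''))) (Const 1) ;;
        Write ''nt'' (Read ''br'' (Read ''in_v'' (Sc ''i''))) (Const 1))
       Skip"

definition mark_nontriv :: com where
  "mark_nontriv = For ''s'' (Sc ''in_n'') (bfs ;; For ''i'' (Sc ''in_m'') mark_pair)"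

lemma writes_bfs: "writes bfs = {''sn'', ''ds'', ''br'', ''q'', ''qh'', ''qt'', ''p'', ''y'', ''j'', ''z'', ''x''}"
  by (auto simp: bfs_def bfs_step_def)

context graph begin

lemma runs_build_arcs:
  assumes G: "holds_graph s" and hd: "\<forall>x. s ''hd'' x = 0"
  shows "runs build_arcs s (500 * (m + 1)) holds_arcs"
proof -
  let ?a = "Write ''as'' (Sc ''i'') (Read ''in_u'' (Sc ''i'')) ;;
        Write ''at'' (Sc ''i'') (Read ''in_v'' (Sc ''i'')) ;;
        Write ''ae'' (Sc ''i'') (Sc ''i'') ;;
        Write ''as'' (Plus (Sc ''in_m'') (Sc ''i'')) (Read ''in_v'' (Sc ''i'')) ;;
        Write ''at'' (Plus (Sc ''in_m'') (Sc ''i'')) (Read ''in_u'' (Sc ''i'')) ;;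
        Write ''ae'' (Plus (Sc ''in_m'') (Sc ''i'')) (Sc ''i'')"
  let ?P = "\<lambda>i s'::state. \<forall>l<i. s' ''as'' l = u l \<and> s' ''at'' l = v l \<and> s' ''ae'' l = l \<and>
     s' ''as'' (m + l) = v l \<and> s' ''at'' (m + l) = u l \<and> s' ''ae'' (m + l) = l"
  let ?Q = "\<lambda>i s'::state. (\<forall>l<i. s' ''nx'' l = lastarc (asrc l) l) \<and> (\<forall>x. s' ''hd'' x = lastarc x i)"
  have "runs build_arcs s ((m + 1) * 100 + (m + m + 1) * 100) holds_arcs"
    unfolding build_arcs_def
  proof (rule runs_Seq, rule runs_For[where P = ?P and h = m and B = 60])
    fix i and s' :: state
    assume i: "i < m" "s' ''i'' 0 = i" and P: "?P i s'"
      and f: "unchanged (insert ''i'' (writes ?a)) s' s"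
    have f': "s' ''in_m'' 0 = m" "s' ''in_u'' i = u i" "s' ''in_v'' i = v i"
      using f G i by (simp_all add: holds_graph_def)
    show "runs ?a s' 60 (\<lambda>s''. ?P (Suc i) (put ''i'' (Suc i) s''))"
      by (rule runs_loop_free) (use P i f' in \<open>auto simp: less_Suc_eq\<close>)
  next
    fix s1 assume f: "unchanged (writes (For ''i'' (Sc ''in_m'') ?a)) s1 s" and P: "?P m s1"
    let ?c = "Write ''nx'' (Sc ''j'') (Read ''hd'' (Read ''as'' (Sc ''j''))) ;;
        Write ''hd'' (Read ''as'' (Sc ''j'')) (Plus (Sc ''j'') (Const 1))"
    have G1: "holds_graph s1" "\<forall>x. s1 ''hd'' x = 0" using f G hd by (simp_all add: holds_graph_def)
    have A: "s1 ''as'' l = asrc l" "s1 ''at'' l = atgt l" "s1 ''ae'' l = aeid l" if lt: "l < m + m" for l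
    proof (atomize(full), cases "l < m")
      case True
      then show "s1 ''as'' l = asrc l \<and> s1 ''at'' l = atgt l \<and> s1 ''ae'' l = aeid l"
        using P by (simp add: asrc_def atgt_def aeid_def)
    next
      case False
      then obtain l' where "l = m + l'" "l' < m" 
        using that[of "l - m"] lt by auto
      then show "s1 ''as'' l = asrc l \<and> s1 ''at'' l = atgt l \<and> s1 ''ae'' l = aeid l"
        using P by (simp add: asrc_def atgt_def aeid_def)
    qed
    show "runs (For ''j'' (Plus (Sc ''in_m'') (Sc ''in_m'')) ?c) s1 ((m + m + 1) * 100) holds_arcs"
    proof (rule runs_For[where P = ?Q and h = "m + m" and B = 20])
      fix i and s' :: state
      assume i: "i < m + m" "s' ''j'' 0 = i" and Q: "?Q i s'"
        and f': "unchanged (insert ''j'' (writes ?c)) s' s1"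
      have as: "s' ''as'' i = asrc i" using f' A i by simp
      show "runs ?c s' 20 (\<lambda>s''. ?Q (Suc i) (put ''j'' (Suc i) s''))"
        by (rule runs_loop_free) (use Q i as in \<open>auto simp: less_Suc_eq\<close>)
    next
      fix s' assume f': "unchanged (insert ''j'' (writes ?c)) s' s1" and Q: "?Q (m + m) s'"
      show "holds_arcs s'" using Q f' A G1 by (simp add: holds_arcs_def holds_graph_def)
    qed (use G1 in \<open>simp_all add: holds_graph_def\<close>)
  qed (use G in \<open>simp_all add: holds_graph_def\<close>)
  then show ?thesis by (rule runs_conseq) auto
qed

section \<open>Short cycles and the labels of the search\<close>

lemma walk1: "adj X x y \<Longrightarrow> (adj X ^^ 1) x y"
  by auto

text \<open>The detour around \<open>b\<close> runs from \<open>S\<close> over \<open>bx\<close>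
  down one branch to \<open>x\<close>, across to \<open>y\<close>, and up the other branch to the
  far end of \<open>b\<close>. It avoids \<open>b\<close>: the two branches use no edges at
  \<open>S\<close> after their first ones, the crossing edge is not at \<open>S\<close>, and
  \<open>bx \<noteq> b\<close>. Dropping \<open>b\<close> and counting \<open>bx\<close> and the
  crossing edge, its length is \<open>dx + dy\<close>.\<close>

lemma branch_pair_nontriv:
  assumes x: "x \<noteq> S" "branch {} S bx x dx" and y: "y \<noteq> S" "branch {} S b y dy"
    and "adj {} x y" "bx \<noteq> b" "dx + dy \<le> k"
  shows "nontriv k b"
proof -
  obtain w L where w: "bx < m" "bx \<notin> {}" "{u bx, v bx} = {S, w}" "w \<noteq> S" "dx = Suc L"
    "(adj ({} \<union> {i. S \<in> {u i, v i}}) ^^ L) w x" by (rule branchE[OF x(2)])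
  obtain w' L' where w': "b < m" "b \<notin> {}" "{u b, v b} = {S, w'}" "w' \<noteq> S" "dy = Suc L'"
    "(adj ({} \<union> {i. S \<in> {u i, v i}}) ^^ L') w' y" by (rule branchE[OF y(2)])
  obtain i where i: "i < m" "{u i, v i} = {x, y}" using assms(5) unfolding adj_def by blast
  have b: "S \<in> {u b, v b}" unfolding w'(3) by simp
  then have sub: "{b} \<subseteq> {} \<union> {i. S \<in> {u i, v i}}" by simp
  have "S \<notin> {u i, v i}" unfolding i(2) using x(1) y(1) by simp
  with b have "i \<notin> {b}" by (intro notI) simp
  with i have xy: "adj {b} x y" unfolding adj_def by blast
  have "adj {b} S w" unfolding adj_def using w(1,3) assms(6) by (intro exI[of _ bx]) simp
  then have 1: "(adj {b} ^^ (1 + L)) S x" by (rule walk_append[OF walk1 walk_mono[OF w(6) sub]])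
  have 2: "(adj {b} ^^ (1 + L')) x w'"
    by (rule walk_append[OF walk1[OF xy] walk_sym[OF walk_mono[OF w'(6) sub]]])
  have W: "(adj {b} ^^ ((1 + L) + (1 + L'))) S w'" by (rule walk_append[OF 1 2])
  have "\<exists>l\<le>k. (adj {b} ^^ l) S w'"
    using W assms(7) w(5) w'(5) by (intro exI[of _ "(1 + L) + (1 + L')"] conjI) simp_all
  moreover have "u b = S \<and> v b = w' \<or> u b = w' \<and> v b = S"
    using w'(3) unfolding doubleton_eq_iff .
  ultimately show ?thesis unfolding nontriv_def using w'(1) walk_sym by blast
qed

text \<open>A discrete intermediate value principle: a walk that starts outside \<open>f\<close> and
  ends inside must enter \<open>f\<close> along some edge, and it is cut there.\<close>

lemma walk_crossing:
  "(adj X ^^ L) x y \<Longrightarrow> \<not> f x \<Longrightarrow> f y \<Longrightarrow>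
     \<exists>a b z z'. a + 1 + b = L \<and> (adj X ^^ a) x z \<and> adj X z z' \<and> (adj X ^^ b) z' y \<and> \<not> f z \<and> f z'"
proof (induction L arbitrary: y)
  case (Suc L)
  then obtain z where z: "(adj X ^^ L) x z" "adj X z y" by auto
  show ?case
  proof (cases "f z")
    case True
    with Suc.IH[OF z(1)] Suc.prems obtain a b z1 z2 where "a + 1 + b = L" "(adj X ^^ a) x z1"
      "adj X z1 z2" "(adj X ^^ b) z2 z" "\<not> f z1" "f z2" by blast
    moreover have "(adj X ^^ Suc b) z2 y" using calculation(4) z(2) by auto
    ultimately show ?thesis by (intro exI[of _ a] exI[of _ "Suc b"] exI[of _ z1] exI[of _ z2]) simp
  next
    case False
    then show ?thesis using z Suc.prems by (intro exI[of _ L] exI[of _ 0] exI[of _ z] exI[of _ y]) simp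
  qed
qed auto

text \<open>Converse of the gluing. The detour around \<open>e\<close> starts at \<open>S\<close>,
  which is outside the branch labelled \<open>e\<close>, and ends at the other end of
  \<open>e\<close>, which is inside. The edge where it enters the branch is the required pair, for
  any tie-breaking in the search.\<close>

lemma nontriv_pair:
  assumes nt: "nontriv k e" and S: "u e = S" and B: "bfs_post {} S sn ds br"
  shows "\<exists>i<m. u i \<noteq> S \<and> v i \<noteq> S \<and> br (u i) \<noteq> br (v i) \<and> ds (u i) + ds (v i) \<le> k \<and>
     (br (u i) = e \<or> br (v i) = e)"
proof -
  obtain L where L: "L \<le> k" "(adj {e} ^^ L) S (v e)" and e: "e < m" using nt S by (auto simp: nontriv_def)
  have reach: "sn x = 1" if "(adj {} ^^ l) S x" "x < n" for l x using B that unfolding bfs_post_def by blast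
  have short: "ds x \<le> l" if "(adj {} ^^ l) S x" "x < n" for l x
    using B reach[OF that] that unfolding bfs_post_def by blast
  have br: "branch {} S (br x) x (ds x)" if "(adj {} ^^ l) S x" "x < n" "x \<noteq> S" for l x
    using B reach[OF that(1,2)] that unfolding bfs_post_def by blast
  \<comment> \<open>Labels depend on the order of the search in general, but not at neighbours of
    the root: these have depth 1, so the label must be the connecting edge, which is unique in a
    simple graph.\<close>
  have nbr: "br x = i" if i: "i < m" "{u i, v i} = {S, x}" "x \<noteq> S" "x < n" for i x
  proof -
    have "adj {} S x" using i by (auto simp: adj_def)
    then have w: "(adj {} ^^ 1) S x" by (rule walk1)
    obtain w1 L1 where b: "br x < m" "br x \<notin> {}" "{u (br x), v (br x)} = {S, w1}" "w1 \<noteq> S"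
      "ds x = Suc L1" "(adj ({} \<union> {i. S \<in> {u i, v i}}) ^^ L1) w1 x" by (rule branchE[OF br[OF w i(4,3)]])
    have "L1 = 0" using short[OF w i(4)] b(5) by simp
    with b(6) have "w1 = x" by simp
    then show ?thesis using inj[OF b(1) i(1)] b(3) i(2) by simp
  qed
  have ve: "v e < n" "v e \<noteq> S" "S < n" using ends[OF e] S by auto
  have "br (v e) = e" using nbr[OF e _ ve(2,1)] S by simp
  then obtain a b z z' where z: "a + 1 + b = L" "(adj {e} ^^ a) S z" "adj {e} z z'"
    "(adj {e} ^^ b) z' (v e)" "\<not> (z \<noteq> S \<and> br z = e)" "z' \<noteq> S" "br z' = e"
    using walk_crossing[OF L(2), of "\<lambda>x. x \<noteq> S \<and> br x = e"] ve(2) by blast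
  obtain i where i: "i < m" "i \<noteq> e" "{u i, v i} = {z, z'}" using z(3) unfolding adj_def by blast
  have zn: "z < n" "z' < n" using adj_less[OF z(3)] by auto
  \<comment> \<open>If the branch were entered directly from the root, its vertex would carry the
    label of the entering edge, which differs from \<open>e\<close>.\<close>
  have "z \<noteq> S"
  proof
    assume "z = S"
    then have "br z' = i" using nbr[OF i(1) _ z(6) zn(2)] i(3) by simp
    with z(7) i(2) show False by simp
  qed
  have "ds z \<le> a" using short[OF walk_mono[OF z(2)] zn(1)] by simp
  \<comment> \<open>The entered vertex is reached over \<open>e\<close> itself and then backwards
    along the rest of the detour, so the two depths sum up to at most
    \<open>a + 1 + b\<close>.\<close>
  moreover have "(adj {} ^^ (1 + b)) S z'"
  proof (rule walk_append)
    show "(adj {} ^^ 1) S (v e)" by (rule walk1) (use e S in \<open>auto simp: adj_def\<close>)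
    show "(adj {} ^^ b) (v e) z'" using walk_sym[OF walk_mono[OF z(4)]] by simp
  qed
  then have "ds z' \<le> 1 + b" using short zn(2) by blast
  ultimately have "ds z + ds z' \<le> k" using z(1) L(1) by simp
  moreover have "u i = z \<and> v i = z' \<or> u i = z' \<and> v i = z" using i(3) unfolding doubleton_eq_iff .
  moreover have "br z \<noteq> e" using z(5) \<open>z \<noteq> S\<close> by simp
  ultimately show ?thesis using i(1) \<open>z \<noteq> S\<close> z(6,7) by (intro exI[of _ i]) (elim disjE, simp_all)
qed

text \<open>Connectedness guarantees that every vertex is seen in each search; this is why the
  marking may read \<open>ds\<close> and \<open>br\<close> without consulting
  \<open>sn\<close>.\<close>

lemma runs_mark_nontriv:
  assumes A: "holds_arcs s" and zero: "\<forall>i. s ''ban'' i = 0" "\<forall>i. s ''nt'' i = 0"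
    and conn: "\<And>x y. x < n \<Longrightarrow> y < n \<Longrightarrow> \<exists>L. (adj {} ^^ L) x y"
  shows "runs mark_nontriv s (4000 * (n + 1) * (n + m + 1))
     (\<lambda>s'. \<forall>e<m. s' ''nt'' e = 1 \<longleftrightarrow> nontriv (s ''kk'' 0) e)"
proof -
  let ?k = "s ''kk'' 0"
  \<comment> \<open>Marks are sound at any time; completeness for \<open>e\<close> is due as soon as
    the search from \<open>u e\<close> is finished.\<close>
  let ?P = "\<lambda>i s'::state. (\<forall>e. s' ''nt'' e = 1 \<longrightarrow> nontriv ?k e) \<and>
     (\<forall>e. u e < i \<longrightarrow> nontriv ?k e \<longrightarrow> s' ''nt'' e = 1)"
  show ?thesis unfolding mark_nontriv_def
  proof (rule runs_For[where P = ?P and h = n and B = "1000 * (n + m + 1) + (m + 1) * 200"])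
    fix S and s' :: state
    assume S: "S < n" "s' ''s'' 0 = S" and P: "?P S s'"
      and f: "unchanged (insert ''s'' (writes (bfs ;; For ''i'' (Sc ''in_m'') mark_pair))) s' s"
    have A': "holds_arcs s'" "\<forall>i<m. s' ''ban'' i = 1 \<longleftrightarrow> i \<in> {}" "s' ''kk'' 0 = ?k"
      using A zero f by (simp_all add: holds_arcs_def holds_graph_def writes_bfs mark_pair_def)
    show "runs (bfs ;; For ''i'' (Sc ''in_m'') mark_pair) s' (1000 * (n + m + 1) + (m + 1) * 200)
       (\<lambda>s''. ?P (Suc S) (put ''s'' (Suc S) s''))"
    proof (rule runs_Seq[OF runs_bfs[OF A'(1,2)]])
      fix s1 assume f1: "unchanged (writes bfs) s1 s'"
        and B: "bfs_post {} (s' ''s'' 0) (s1 ''sn'') (s1 ''ds'') (s1 ''br'')"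
      let ?R = "\<lambda>i s''::state. (\<forall>e. s'' ''nt'' e = 1 \<longrightarrow> nontriv ?k e) \<and>
         (\<forall>e. u e < S \<longrightarrow> nontriv ?k e \<longrightarrow> s'' ''nt'' e = 1) \<and>
         (\<forall>l<i. u l \<noteq> S \<longrightarrow> v l \<noteq> S \<longrightarrow> s1 ''br'' (u l) \<noteq> s1 ''br'' (v l) \<longrightarrow>
            s1 ''ds'' (u l) + s1 ''ds'' (v l) \<le> ?k \<longrightarrow>
            s'' ''nt'' (s1 ''br'' (u l)) = 1 \<and> s'' ''nt'' (s1 ''br'' (v l)) = 1)"
      have B': "bfs_post {} S (s1 ''sn'') (s1 ''ds'') (s1 ''br'')" using B S(2) by simp
      have br: "branch {} S (s1 ''br'' x) x (s1 ''ds'' x)" if "x < n" "x \<noteq> S" for x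
        using B' conn[OF S(1) that(1)] that unfolding bfs_post_def by blast
      have G1: "holds_graph s1" "s1 ''kk'' 0 = ?k" "s1 ''s'' 0 = S" "s1 ''nt'' = s' ''nt''"
        using f1 A' S by (simp_all add: holds_arcs_def holds_graph_def writes_bfs)
      show "runs (For ''i'' (Sc ''in_m'') mark_pair) s1 ((m + 1) * 200)
         (\<lambda>s''. ?P (Suc S) (put ''s'' (Suc S) s''))"
      proof (rule runs_For[where P = ?R and h = m and B = 150])
        fix i and s2 :: state
        assume i: "i < m" "s2 ''i'' 0 = i" and R: "?R i s2"
          and f2: "unchanged (insert ''i'' (writes mark_pair)) s2 s1"
        have f2': "s2 ''br'' = s1 ''br''" "s2 ''ds'' = s1 ''ds''" "s2 ''kk'' 0 = ?k" "s2 ''s'' 0 = S"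
          "s2 ''in_u'' i = u i" "s2 ''in_v'' i = v i"
          using f2 G1 i by (simp_all add: mark_pair_def holds_graph_def)
        show "runs mark_pair s2 150 (\<lambda>s''. ?R (Suc i) (put ''i'' (Suc i) s''))"
        proof (rule runs_loop_free)
          show "?R (Suc i) (put ''i'' (Suc i) (run mark_pair s2))"
          proof (cases "u i \<noteq> S \<and> v i \<noteq> S \<and> s1 ''br'' (u i) \<noteq> s1 ''br'' (v i) \<and>
              s1 ''ds'' (u i) + s1 ''ds'' (v i) \<le> ?k")
            case True
            have xy: "adj {} (u i) (v i)" using i(1) by (auto simp: adj_def)
            have bu: "branch {} S (s1 ''br'' (u i)) (u i) (s1 ''ds'' (u i))"
              and bv: "branch {} S (s1 ''br'' (v i)) (v i) (s1 ''ds'' (v i))"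
              using br ends[OF i(1)] True by auto
            have nt1: "nontriv ?k (s1 ''br'' (v i))"
              using branch_pair_nontriv[OF _ bu _ bv xy] True by blast
            have nt2: "nontriv ?k (s1 ''br'' (u i))"
              using branch_pair_nontriv[OF _ bv _ bu adj_commute[THEN iffD1, OF xy]] True
              by (metis add.commute)
            have "run mark_pair s2 ''nt'' = (s2 ''nt'')(s1 ''br'' (u i) := 1, s1 ''br'' (v i) := 1)"
              using True by (simp add: mark_pair_def f2' i)
            then show ?thesis using R nt1 nt2 by (simp add: less_Suc_eq)
          next
            case False
            then have "run mark_pair s2 ''nt'' = s2 ''nt''"
              by (auto simp add: mark_pair_def f2' i)
            then show ?thesis using R False by (auto simp add: less_Suc_eq)
          qed
        qed (simp_all add: mark_pair_def)
      next
        fix s2 assume f2: "unchanged (insert ''i'' (writes mark_pair)) s2 s1" and R: "?R m s2"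
        have "s2 ''nt'' e = 1" if e: "u e = S" "nontriv ?k e" for e
        proof -
          from nontriv_pair[OF e(2,1) B'] obtain i where "i < m" "u i \<noteq> S" "v i \<noteq> S"
            "s1 ''br'' (u i) \<noteq> s1 ''br'' (v i)" "s1 ''ds'' (u i) + s1 ''ds'' (v i) \<le> ?k"
            "s1 ''br'' (u i) = e \<or> s1 ''br'' (v i) = e" by blast
          then show ?thesis using R by metis
        qed
        then show "?P (Suc S) (put ''s'' (Suc S) s2)" using R by (simp add: less_Suc_eq)
      qed (use G1 P in \<open>simp_all add: holds_graph_def mark_pair_def\<close>)
    qed (use S in simp)
  next
    fix s' assume "?P n s'"
    then show "\<forall>e<m. s' ''nt'' e = 1 \<longleftrightarrow> nontriv ?k e" using ends by blast
  qed (use A zero in \<open>simp_all add: holds_arcs_def holds_graph_def writes_bfs mark_pair_def algebra_simps\<close>)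
qed

end

section \<open>The compressed graph\<close>

text \<open>The product is formed by repeated addition. Each summand is positive and the loop stops
  once the sum reaches \<open>m\<close>, so there are at most \<open>m\<close> rounds however large
  \<rho> is; a larger bound would not restrict the choice of \<open>N\<close> any further.\<close>

definition compute_bound :: com where
  "compute_bound = (Set ''bd'' (Const 0) ;; Set ''c'' (Const 0)) ;;
     Loop (Conj (Less (Sc ''c'') (Sc ''in_rho'')) (Less (Sc ''bd'') (Sc ''in_m'')))
       (Set ''bd'' (Plus (Sc ''bd'') (Plus (Sc ''kk'') (Plus (Sc ''kk'') (Const 1)))) ;;
        Set ''c'' (Plus (Sc ''c'') (Const 1)))"

lemma runs_compute_bound:
  "runs compute_bound s (100 * (s ''in_m'' 0 + 1))
    (\<lambda>s'. s' ''bd'' 0 \<le> s ''in_rho'' 0 * (2 * s ''kk'' 0 + 1) \<and>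
      (s' ''bd'' 0 = s ''in_rho'' 0 * (2 * s ''kk'' 0 + 1) \<or> s ''in_m'' 0 \<le> s' ''bd'' 0))"
proof -
  let ?r = "s ''in_rho'' 0" and ?k = "s ''kk'' 0" and ?m = "s ''in_m'' 0"
  let ?b = "Conj (Less (Sc ''c'') (Sc ''in_rho'')) (Less (Sc ''bd'') (Sc ''in_m''))"
  let ?i = "Set ''bd'' (Const 0) ;; Set ''c'' (Const 0)"
  let ?c = "Set ''bd'' (Plus (Sc ''bd'') (Plus (Sc ''kk'') (Plus (Sc ''kk'') (Const 1)))) ;;
        Set ''c'' (Plus (Sc ''c'') (Const 1))"
  let ?I = "\<lambda>s'::state. s' ''bd'' 0 = s' ''c'' 0 * (2 * ?k + 1) \<and> s' ''c'' 0 \<le> ?r"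
  let ?Q = "\<lambda>s'::state. s' ''bd'' 0 \<le> ?r * (2 * ?k + 1) \<and>
      (s' ''bd'' 0 = ?r * (2 * ?k + 1) \<or> ?m \<le> s' ''bd'' 0)"
  have "runs compute_bound s (20 + (?m + 1) * 60) ?Q"
    unfolding compute_bound_def
  proof (rule runs_Seq[where Q = ?I])
    show "runs ?i s 20 ?I" by (rule runs_loop_free) simp_all
  next
    fix s1 assume f: "unchanged (writes ?i) s1 s" and I: "?I s1"
    have f1: "s1 ''in_rho'' 0 = ?r" "s1 ''kk'' 0 = ?k" "s1 ''in_m'' 0 = ?m" using f by simp_all
    show "runs (Loop ?b ?c) s1 ((?m + 1) * 60) ?Q"
    proof (rule runs_Loop[where Inv = ?I and \<mu> = "\<lambda>s'. ?m - s' ''bd'' 0" and B = 30])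
      fix s' assume f': "unchanged (writes ?c) s' s1" and I: "?I s'" and b: "bval ?b s'"
      have f2: "s' ''in_rho'' 0 = ?r" "s' ''kk'' 0 = ?k" "s' ''in_m'' 0 = ?m" using f' f1 by simp_all
      have b': "s' ''c'' 0 < ?r" "s' ''bd'' 0 < ?m" using b f2 by auto
      have "?I (run ?c s')" using I b' f2 by (simp add: algebra_simps)
      moreover have "?m - run ?c s' ''bd'' 0 < ?m - s' ''bd'' 0" using b'(2) by simp
      ultimately have *: "?I (run ?c s') \<and> ?m - run ?c s' ''bd'' 0 < ?m - s' ''bd'' 0" by blast
      show "runs ?c s' 30 (\<lambda>s''. ?I s'' \<and> ?m - s'' ''bd'' 0 < ?m - s' ''bd'' 0)"
        by (rule runs_loop_free, simp, rule *, simp)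
    next
      fix s' assume f': "unchanged (writes ?c) s' s1" and I: "?I s'" and b: "\<not> bval ?b s'"
      have f2: "s' ''in_rho'' 0 = ?r" "s' ''in_m'' 0 = ?m" using f' f1 by simp_all
      have "\<not> (s' ''c'' 0 < ?r \<and> s' ''bd'' 0 < ?m)" using b unfolding bval.simps aval.simps f2 .
      then have "s' ''c'' 0 = ?r \<or> ?m \<le> s' ''bd'' 0" using I by linarith
      moreover have "s' ''bd'' 0 \<le> ?r * (2 * ?k + 1)" 
        by (rule ord_eq_le_trans[OF conjunct1[OF I] mult_le_mono1[OF conjunct2[OF I]]])
      ultimately show "?Q s'" using conjunct1[OF I] by (elim disjE) simp_all
    next
      show "(?m - s1 ''bd'' 0 + 1) * (1 + bcost ?b + 30) \<le> (?m + 1) * 60"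
        by (intro mult_mono) auto
    qed (use I in simp)
  qed
  then show ?thesis by (rule runs_conseq) auto
qed

definition collect_step :: com where
  "collect_step =
     Cond (Conj (Equal (Read ''nt'' (Sc ''i'')) (Const 1)) (Less (Sc ''cn'') (Sc ''bd'')))
       (Write ''li'' (Sc ''cn'') (Sc ''i'') ;;
        Write ''wv'' (Plus (Sc ''cn'') (Sc ''cn'')) (Read ''in_u'' (Sc ''i'')) ;;
        Write ''wv'' (Plus (Plus (Sc ''cn'') (Sc ''cn'')) (Const 1)) (Read ''in_v'' (Sc ''i'')) ;;
        Write ''ban'' (Sc ''i'') (Const 1) ;; Set ''cn'' (Plus (Sc ''cn'') (Const 1)))
       Skip"

definition collect :: com where
  "collect = Set ''cn'' (Const 0) ;; For ''i'' (Sc ''in_m'') collect_step"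

definition cand :: "state \<Rightarrow> nat set" where
  "cand s = s ''li'' ` {..<s ''cn'' 0}"

definition wset :: "state \<Rightarrow> nat set" where
  "wset s = s ''wv'' ` {..<s ''cn'' 0 + s ''cn'' 0}"

definition arcset :: "state \<Rightarrow> (nat \<times> nat \<times> nat \<times> nat) set" where
  "arcset s = (\<lambda>j. (s ''fA'' j, s ''fB'' j, s ''fW'' j, s ''fT'' j)) ` {..<s ''na'' 0}"

lemma image_upd_lessThan: "(f(k := x)) ` {..<Suc k} = insert x (f ` {..<k})"
  by (auto simp: lessThan_Suc)

lemma image_upd2_lessThan: "(f(k := x, Suc k := y)) ` {..<Suc (Suc k)} = insert y (insert x (f ` {..<k}))"
  by (auto simp: lessThan_Suc)

lemma image_upd4_lessThan:
  "(\<lambda>j. ((f(k := a)) j, (g(k := b)) j, (h(k := c)) j, (l(k := d)) j)) ` {..<Suc k} =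
     insert (a, b, c, d) ((\<lambda>j. (f j, g j, h j, l j)) ` {..<k :: nat})"
  by (auto simp: lessThan_Suc image_iff)

text \<open>An arc of the compressed graph leads from \<open>fA\<close> to \<open>fB\<close> and has length \<open>fW\<close>. Its tag \<open>fT\<close> is
  the edge of \<open>N\<close> for which it stands, or \<open>m\<close> if it stands for a path in \<open>G - N\<close>.\<close>

definition push_arc :: "aexp \<Rightarrow> aexp \<Rightarrow> aexp \<Rightarrow> aexp \<Rightarrow> com" where
  "push_arc a b w t = Write ''fA'' (Sc ''na'') a ;; Write ''fB'' (Sc ''na'') b ;;
     Write ''fW'' (Sc ''na'') w ;; Write ''fT'' (Sc ''na'') t ;; Set ''na'' (Plus (Sc ''na'') (Const 1))"

definition push_pair :: com where
  "push_pair = Cond (Equal (Read ''sn'' (Read ''wv'' (Sc ''b''))) (Const 1))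
     (push_arc (Sc ''s'') (Read ''wv'' (Sc ''b'')) (Read ''ds'' (Read ''wv'' (Sc ''b''))) (Sc ''in_m''))
     Skip"

definition push_edge :: com where
  "push_edge = Set ''e'' (Read ''li'' (Sc ''a'')) ;;
     push_arc (Read ''in_u'' (Sc ''e'')) (Read ''in_v'' (Sc ''e'')) (Const 1) (Sc ''e'') ;;
     push_arc (Read ''in_v'' (Sc ''e'')) (Read ''in_u'' (Sc ''e'')) (Const 1) (Sc ''e'')"

text \<open>At this point \<open>ban\<close> marks the edges of \<open>N\<close>, so the same search
  program now measures distances in the graph without \<open>N\<close>.\<close>

definition compress :: com where
  "compress = Set ''na'' (Const 0) ;;
     For ''a'' (Plus (Sc ''cn'') (Sc ''cn''))
       (Set ''s'' (Read ''wv'' (Sc ''a'')) ;; bfs ;; For ''b'' (Plus (Sc ''cn'') (Sc ''cn'')) push_pair) ;;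
     For ''a'' (Sc ''cn'') push_edge"

context graph begin

definition collected :: "nat \<Rightarrow> nat \<Rightarrow> state \<Rightarrow> bool" where
  "collected k r s \<longleftrightarrow> inj_on (s ''li'') {..<s ''cn'' 0} \<and> (\<forall>e\<in>cand s. nontriv k e) \<and>
     (cand s = {e. nontriv k e} \<or> s ''cn'' 0 = r * (2 * k + 1)) \<and> s ''cn'' 0 \<le> r * (2 * k + 1) \<and>
     (\<forall>i<m. s ''ban'' i = 1 \<longleftrightarrow> i \<in> cand s) \<and> wset s = u ` cand s \<union> v ` cand s"

lemma runs_collect:
  assumes G: "holds_graph s" and ban: "\<forall>i. s ''ban'' i = 0"
    and nt: "\<forall>e<m. s ''nt'' e = 1 \<longleftrightarrow> nontriv k e"
    and bd: "s ''bd'' 0 \<le> r * (2 * k + 1)" "s ''bd'' 0 = r * (2 * k + 1) \<or> m \<le> s ''bd'' 0"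
  shows "runs collect s (200 * (m + 1)) (collected k r)"
proof -
  let ?B = "s ''bd'' 0"
  let ?P = "\<lambda>i s'::state. s' ''cn'' 0 \<le> ?B \<and> inj_on (s' ''li'') {..<s' ''cn'' 0} \<and>
    cand s' \<subseteq> {e. e < i \<and> nontriv k e} \<and> (s' ''cn'' 0 < ?B \<longrightarrow> cand s' = {e. e < i \<and> nontriv k e}) \<and>
    (\<forall>e. s' ''ban'' e = 1 \<longleftrightarrow> e \<in> cand s') \<and> wset s' = u ` cand s' \<union> v ` cand s'"
  have "runs collect s (10 + (m + 1) * 150) (collected k r)" unfolding collect_def
  proof (rule runs_Seq[where Q = "\<lambda>s'. s' ''cn'' 0 = 0"])
    show "runs (Set ''cn'' (Const 0)) s 10 (\<lambda>s'. s' ''cn'' 0 = 0)" by (rule runs_loop_free) simp_all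
  next
    fix s1 assume f: "unchanged (writes (Set ''cn'' (Const 0))) s1 s" and cn: "s1 ''cn'' 0 = 0"
    have G1: "holds_graph s1" using f G by (simp add: holds_graph_def)
    show "runs (For ''i'' (Sc ''in_m'') collect_step) s1 ((m + 1) * 150) (collected k r)"
    proof (rule runs_For[where P = ?P and h = m and B = 100])
      fix i and s' :: state
      assume i: "i < m" "s' ''i'' 0 = i" and P: "?P i s'"
        and f': "unchanged (insert ''i'' (writes collect_step)) s' s1"
      have st: "s' ''nt'' i = 1 \<longleftrightarrow> nontriv k i" "s' ''bd'' 0 = ?B" "s' ''in_u'' i = u i" "s' ''in_v'' i = v i"
        using f' f G1 i nt by (simp_all add: collect_step_def holds_graph_def)
      show "runs collect_step s' 100 (\<lambda>s''. ?P (Suc i) (put ''i'' (Suc i) s''))"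
      proof (rule runs_loop_free)
        let ?s = "put ''i'' (Suc i) (run collect_step s')"
        show "?P (Suc i) ?s"
        proof (cases "nontriv k i \<and> s' ''cn'' 0 < ?B")
          case True
          have c: "s' ''nt'' i = Suc 0" using True st(1) by simp
          have r: "?s ''cn'' 0 = Suc (s' ''cn'' 0)" "?s ''li'' = (s' ''li'')(s' ''cn'' 0 := i)"
            "?s ''ban'' = (s' ''ban'')(i := 1)"
            "?s ''wv'' = (s' ''wv'')(s' ''cn'' 0 + s' ''cn'' 0 := u i, Suc (s' ''cn'' 0 + s' ''cn'' 0) := v i)"
            using True c i st(2-4) by (simp_all add: collect_step_def fun_eq_iff)
          have ca: "cand ?s = insert i (cand s')" unfolding cand_def r by (rule image_upd_lessThan)
          have wa: "wset ?s = insert (v i) (insert (u i) (wset s'))"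
            unfolding wset_def r add_Suc add_Suc_right by (rule image_upd2_lessThan)
          have "i \<notin> cand s'" using P by auto
          then have "inj_on (?s ''li'') {..<?s ''cn'' 0}"
            using P unfolding r cand_def by (auto simp: inj_on_def less_Suc_eq)
          moreover have "{e. e < Suc i \<and> nontriv k e} = insert i {e. e < i \<and> nontriv k e}"
            using True by (auto simp: less_Suc_eq)
          ultimately show ?thesis using P True unfolding ca wa r(1,3) by auto
        next
          case False
          have "run collect_step s' = s'" using False st(1,2) i(2) by (auto simp: collect_step_def)
          then have e: "?s ''cn'' = s' ''cn''" "?s ''li'' = s' ''li''" "?s ''ban'' = s' ''ban''" "?s ''wv'' = s' ''wv''"
            by simp_all
          have ca: "cand ?s = cand s'" "wset ?s = wset s'" unfolding cand_def wset_def e by simp_all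
          have "s' ''cn'' 0 < ?B \<longrightarrow> {e. e < Suc i \<and> nontriv k e} = {e. e < i \<and> nontriv k e}"
            using False by (auto simp: less_Suc_eq)
          moreover have "cand s' \<subseteq> {e. e < Suc i \<and> nontriv k e}" using P by auto
          ultimately show ?thesis using P unfolding ca e by simp
        qed
      qed (simp_all add: collect_step_def)
    next
      fix s' assume P: "?P m s'"
      have all: "{e. e < m \<and> nontriv k e} = {e. nontriv k e}" by (auto simp: nontriv_def)
      have card: "card (cand s') = s' ''cn'' 0" using P by (simp add: cand_def card_image)
      have "cand s' = {e. nontriv k e} \<or> s' ''cn'' 0 = r * (2 * k + 1)"
      proof (cases "s' ''cn'' 0 < ?B")
        case True
        then show ?thesis using P all by simp
      next
        case False
        then have eq: "s' ''cn'' 0 = ?B" using P by simp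
        show ?thesis
        proof (cases "?B = r * (2 * k + 1)")
          case False
          \<comment> \<open>The bound was cut off, so a list of that length already contains all
            edges.\<close>
          then have "m \<le> ?B" using bd(2) by simp
          then have "cand s' = {..<m}" using P card eq by (intro card_seteq) auto
          then show ?thesis using P all by auto
        qed (use eq in simp)
      qed
      then show "collected k r s'" unfolding collected_def using P bd(1) all by auto
    qed (use G1 cn f ban in \<open>simp_all add: holds_graph_def collect_step_def cand_def wset_def\<close>)
  qed
  then show ?thesis by (rule runs_conseq) auto
qed

definition sound_arc :: "nat set \<Rightarrow> nat set \<Rightarrow> nat \<times> nat \<times> nat \<times> nat \<Rightarrow> bool" where
  "sound_arc N W = (\<lambda>(x, y, w, t). x \<in> W \<and> y \<in> W \<and>
     (t = m \<and> (adj N ^^ w) x y \<or> t \<in> N \<and> w = 1 \<and> {u t, v t} = {x, y}))"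

text \<open>Completeness asks for an arc not longer than any given walk, since only shortest walks
  are recorded. The number of arcs is quadratic in |N|: one per ordered pair of positions in
  \<open>wv\<close>, plus two per candidate.\<close>

definition compressed :: "state \<Rightarrow> bool" where
  "compressed s \<longleftrightarrow> (\<forall>a\<in>arcset s. sound_arc (cand s) (wset s) a) \<and>
     (\<forall>x\<in>wset s. \<forall>y\<in>wset s. \<forall>L. (adj (cand s) ^^ L) x y \<longrightarrow> (\<exists>w\<le>L. (x, y, w, m) \<in> arcset s)) \<and>
     (\<forall>e\<in>cand s. (u e, v e, 1, e) \<in> arcset s \<and> (v e, u e, 1, e) \<in> arcset s) \<and>
     s ''na'' 0 \<le> 4 * (s ''cn'' 0 + 1) * (s ''cn'' 0 + 1)"

lemma runs_compress:
  assumes A: "holds_arcs s" and C: "collected k r s"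
  shows "runs compress s (4000 * (s ''cn'' 0 + 1) * (n + m + s ''cn'' 0 + 1)) compressed"
proof -
  let ?c = "s ''cn'' 0"
  let ?N = "cand s" and ?W = "wset s"
  let ?body = "Set ''s'' (Read ''wv'' (Sc ''a'')) ;; bfs ;; For ''b'' (Plus (Sc ''cn'') (Sc ''cn'')) push_pair"
  let ?snd = "\<lambda>s'::state. \<forall>a\<in>arcset s'. sound_arc ?N ?W a"
  let ?cmp = "\<lambda>(X::nat set) (Y::nat set) s'::state. \<forall>x\<in>X. \<forall>y\<in>Y. \<forall>L. (adj ?N ^^ L) x y \<longrightarrow> (\<exists>w\<le>L. (x, y, w, m) \<in> arcset s')"
  let ?P = "\<lambda>i s'::state. ?snd s' \<and> s' ''na'' 0 \<le> i * (?c + ?c) \<and> ?cmp (s ''wv'' ` {..<i}) ?W s'"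
  let ?Q = "\<lambda>s'::state. ?snd s' \<and> s' ''na'' 0 \<le> (?c + ?c) * (?c + ?c) \<and> ?cmp ?W ?W s'"
  have N: "\<forall>e\<in>?N. e < m" using C by (auto simp: collected_def nontriv_def)
  have Weq: "?W = u ` ?N \<union> v ` ?N" using C unfolding collected_def by blast
  have Wn: "\<forall>x\<in>?W. x < n" using N ends unfolding Weq by blast
  have ban: "\<forall>i<m. s ''ban'' i = 1 \<longleftrightarrow> i \<in> ?N" using C unfolding collected_def by blast
  have "runs compress s (10 + ((?c + ?c + 1) * (1000 * (n + m + 1) + 200 + (?c + ?c + 1) * 100) + (?c + 1) * 200)) compressed"
    unfolding compress_def
  proof (rule runs_Seq[where Q = "\<lambda>s'. s' ''na'' 0 = 0"])
    show "runs (Set ''na'' (Const 0)) s 10 (\<lambda>s'. s' ''na'' 0 = 0)" by (rule runs_loop_free) simp_all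
  next
    fix s1 assume f1: "unchanged (writes (Set ''na'' (Const 0))) s1 s" and na: "s1 ''na'' 0 = 0"
    show "runs (For ''a'' (Plus (Sc ''cn'') (Sc ''cn'')) ?body ;; For ''a'' (Sc ''cn'') push_edge) s1
      ((?c + ?c + 1) * (1000 * (n + m + 1) + 200 + (?c + ?c + 1) * 100) + (?c + 1) * 200) compressed"
    proof (rule runs_Seq[where Q = ?Q],
        rule runs_For[where P = ?P and h = "?c + ?c" and B = "10 + (1000 * (n + m + 1) + (?c + ?c + 1) * 100)"])
      fix i and s2 :: state
      assume i: "i < ?c + ?c" "s2 ''a'' 0 = i" and P: "?P i s2"
        and f2: "unchanged (insert ''a'' (writes ?body)) s2 s1"
      let ?S = "s ''wv'' i"
      have S: "?S \<in> ?W" using i(1) unfolding wset_def by blast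
      show "runs ?body s2 (10 + (1000 * (n + m + 1) + (?c + ?c + 1) * 100)) (\<lambda>s'. ?P (Suc i) (put ''a'' (Suc i) s'))"
      proof (rule runs_Seq[where Q = "\<lambda>s'. s' ''s'' 0 = ?S"])
        show "runs (Set ''s'' (Read ''wv'' (Sc ''a''))) s2 10 (\<lambda>s'. s' ''s'' 0 = ?S)"
          by (rule runs_loop_free)
            (use i f2 f1 in \<open>simp_all add: writes_bfs push_pair_def push_arc_def\<close>)
      next
        fix s3 assume f3: "unchanged (writes (Set ''s'' (Read ''wv'' (Sc ''a'')))) s3 s2" and s3: "s3 ''s'' 0 = ?S"
        have A3: "holds_arcs s3" "\<forall>i<m. s3 ''ban'' i = 1 \<longleftrightarrow> i \<in> ?N"
          using A ban f1 f2 f3 by (simp_all add: writes_bfs push_pair_def push_arc_def holds_arcs_def holds_graph_def)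
        have s3n: "s3 ''s'' 0 < n" using s3 S Wn by simp
        show "runs (bfs ;; For ''b'' (Plus (Sc ''cn'') (Sc ''cn'')) push_pair) s3
          (1000 * (n + m + 1) + (?c + ?c + 1) * 100) (\<lambda>s'. ?P (Suc i) (put ''a'' (Suc i) s'))"
        proof (rule runs_Seq[OF runs_bfs[OF A3 s3n]])
          fix s4 assume f4: "unchanged (writes bfs) s4 s3"
            and B0: "bfs_post ?N (s3 ''s'' 0) (s4 ''sn'') (s4 ''ds'') (s4 ''br'')"
          have B: "bfs_post ?N ?S (s4 ''sn'') (s4 ''ds'') (s4 ''br'')" using B0 unfolding s3 .
          have f4': "s4 ''wv'' = s ''wv''" "s4 ''cn'' 0 = ?c" "s4 ''s'' 0 = ?S" "s4 ''in_m'' 0 = m"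
            "arcset s4 = arcset s2" "s4 ''na'' = s2 ''na''"
            using A f1 f2 f3 f4 s3
            by (simp_all add: writes_bfs push_pair_def push_arc_def holds_arcs_def holds_graph_def arcset_def)
          let ?R = "\<lambda>l s'::state. ?snd s' \<and> s' ''na'' 0 \<le> i * (?c + ?c) + l \<and>
            ?cmp (s ''wv'' ` {..<i}) ?W s' \<and> ?cmp {?S} (s ''wv'' ` {..<l}) s'"
          show "runs (For ''b'' (Plus (Sc ''cn'') (Sc ''cn'')) push_pair) s4 ((?c + ?c + 1) * 100)
             (\<lambda>s'. ?P (Suc i) (put ''a'' (Suc i) s'))"
          proof (rule runs_For[where P = ?R and h = "?c + ?c" and B = 60])
            fix l and s5 :: state
            assume l: "l < ?c + ?c" "s5 ''b'' 0 = l" and R: "?R l s5"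
              and f5: "unchanged (insert ''b'' (writes push_pair)) s5 s4"
            let ?y = "s ''wv'' l"
            have y: "?y \<in> ?W" using l(1) unfolding wset_def by blast
            then have yn: "?y < n" using Wn by blast
            have f5': "s5 ''wv'' = s ''wv''" "s5 ''s'' 0 = ?S" "s5 ''in_m'' 0 = m"
              "s5 ''sn'' = s4 ''sn''" "s5 ''ds'' = s4 ''ds''"
              using f5 f4' by (simp_all add: push_pair_def push_arc_def)
            have ins: "s ''wv'' ` {..<Suc l} = insert ?y (s ''wv'' ` {..<l})" by (simp add: lessThan_Suc)
            show "runs push_pair s5 60 (\<lambda>s'. ?R (Suc l) (put ''b'' (Suc l) s'))"
            proof (rule runs_loop_free)
              let ?s = "put ''b'' (Suc l) (run push_pair s5)"
              show "?R (Suc l) ?s"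
              proof (cases "s4 ''sn'' ?y = 1")
                case True
                have w: "(adj ?N ^^ s4 ''ds'' ?y) ?S ?y" "\<forall>L. (adj ?N ^^ L) ?S ?y \<longrightarrow> s4 ''ds'' ?y \<le> L"
                  using B yn True unfolding bfs_post_def by blast+
                have r: "?s ''na'' 0 = Suc (s5 ''na'' 0)" "?s ''fA'' = (s5 ''fA'')(s5 ''na'' 0 := ?S)"
                  "?s ''fB'' = (s5 ''fB'')(s5 ''na'' 0 := ?y)" "?s ''fW'' = (s5 ''fW'')(s5 ''na'' 0 := s4 ''ds'' ?y)"
                  "?s ''fT'' = (s5 ''fT'')(s5 ''na'' 0 := m)"
                  using True l f5' by (simp_all add: push_pair_def push_arc_def fun_eq_iff)
                have ar: "arcset ?s = insert (?S, ?y, s4 ''ds'' ?y, m) (arcset s5)"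
                  unfolding arcset_def r by (rule image_upd4_lessThan)
                have "sound_arc ?N ?W (?S, ?y, s4 ''ds'' ?y, m)" using S y w(1) by (simp add: sound_arc_def)
                then have "?snd ?s" using R unfolding ar by blast
                moreover have "?cmp (s ''wv'' ` {..<i}) ?W ?s" using R unfolding ar by blast
                moreover have "?cmp {?S} (s ''wv'' ` {..<Suc l}) ?s" using R w(2) unfolding ar ins by blast
                ultimately show ?thesis using R unfolding r(1) by simp
              next
                case False
                then have no: "\<forall>L. \<not> (adj ?N ^^ L) ?S ?y" using B yn unfolding bfs_post_def by blast
                have e: "run push_pair s5 = s5" using False l f5' by (simp add: push_pair_def)
                have ar: "arcset ?s = arcset s5" "?s ''na'' = s5 ''na''" unfolding e by (simp_all add: arcset_def)
                have "?cmp {?S} (s ''wv'' ` {..<Suc l}) s5" using R no unfolding ins by blast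
                then show ?thesis using R unfolding ar by simp
              qed
            qed (simp_all add: push_pair_def push_arc_def)
          next
            fix s5 assume R: "?R (?c + ?c) s5"
            have ar: "arcset (put ''a'' (Suc i) s5) = arcset s5" by (simp add: arcset_def)
            have ins: "s ''wv'' ` {..<Suc i} = insert ?S (s ''wv'' ` {..<i})" by (simp add: lessThan_Suc)
            have W: "s ''wv'' ` {..<?c + ?c} = ?W" by (simp add: wset_def)
            have "?cmp (s ''wv'' ` {..<Suc i}) ?W s5" using R unfolding W ins by blast
            then show "?P (Suc i) (put ''a'' (Suc i) s5)" using R unfolding ar by simp
          next
            fix s' :: state assume "unchanged (insert ''b'' (writes push_pair)) s' s4"
            then show "aval (Plus (Sc ''cn'') (Sc ''cn'')) s' = ?c + ?c"
              using f4' by (simp add: push_pair_def push_arc_def)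
          next
            have ar: "arcset (put ''b'' 0 s4) = arcset s2" using f4'(5) by (simp add: arcset_def)
            show "?R 0 (put ''b'' 0 s4)" using P f4'(6) unfolding ar by simp
          qed (simp_all add: push_pair_def push_arc_def)
        qed
      qed
    next
      fix s' :: state assume "unchanged (insert ''a'' (writes ?body)) s' s1"
      then show "aval (Plus (Sc ''cn'') (Sc ''cn'')) s' = ?c + ?c"
        using f1 by (simp add: push_pair_def push_arc_def writes_bfs)
    next
      show "?P 0 (put ''a'' 0 s1)" using na by (simp add: arcset_def)
    next
      fix s' assume "?P (?c + ?c) s'"
      then show "?Q s'" by (simp add: wset_def)
    next
      fix s2 assume f2: "unchanged (writes (For ''a'' (Plus (Sc ''cn'') (Sc ''cn'')) ?body)) s2 s1" and Q: "?Q s2"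
      let ?U = "\<lambda>i s'::state. ?snd s' \<and> s' ''na'' 0 \<le> (?c + ?c) * (?c + ?c) + (i + i) \<and> ?cmp ?W ?W s' \<and>
         (\<forall>e\<in>s ''li'' ` {..<i}. (u e, v e, 1, e) \<in> arcset s' \<and> (v e, u e, 1, e) \<in> arcset s')"
      have f2': "s2 ''li'' = s ''li''" "s2 ''cn'' 0 = ?c" "s2 ''wv'' = s ''wv''" "holds_graph s2"
        using A f1 f2 by (simp_all add: push_pair_def push_arc_def writes_bfs holds_arcs_def holds_graph_def)
      show "runs (For ''a'' (Sc ''cn'') push_edge) s2 ((?c + 1) * 200) compressed"
      proof (rule runs_For[where P = ?U and h = ?c and B = 150])
        fix i and s3 :: state
        assume i: "i < ?c" "s3 ''a'' 0 = i" and U: "?U i s3"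
          and f3: "unchanged (insert ''a'' (writes push_edge)) s3 s2"
        let ?e = "s ''li'' i"
        have e: "?e \<in> ?N" using i(1) unfolding cand_def by blast
        then have em: "?e < m" using N by blast
        have f3': "s3 ''li'' = s ''li''" "s3 ''in_u'' ?e = u ?e" "s3 ''in_v'' ?e = v ?e"
          using f3 f2' em by (simp_all add: push_edge_def push_arc_def holds_graph_def)
        show "runs push_edge s3 150 (\<lambda>s'. ?U (Suc i) (put ''a'' (Suc i) s'))"
        proof (rule runs_loop_free)
          let ?s = "put ''a'' (Suc i) (run push_edge s3)" and ?k = "s3 ''na'' 0"
          have r: "?s ''na'' 0 = Suc (Suc ?k)"
            "?s ''fA'' = (s3 ''fA'')(?k := u ?e, Suc ?k := v ?e)"
            "?s ''fB'' = (s3 ''fB'')(?k := v ?e, Suc ?k := u ?e)"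
            "?s ''fW'' = (s3 ''fW'')(?k := 1, Suc ?k := 1)"
            "?s ''fT'' = (s3 ''fT'')(?k := ?e, Suc ?k := ?e)"
            using i f3' by (simp_all add: push_edge_def push_arc_def fun_eq_iff)
          have ar: "arcset ?s = insert (v ?e, u ?e, 1, ?e) (insert (u ?e, v ?e, 1, ?e) (arcset s3))"
            unfolding arcset_def r by (simp only: image_upd4_lessThan)
          have "sound_arc ?N ?W (u ?e, v ?e, 1, ?e)" "sound_arc ?N ?W (v ?e, u ?e, 1, ?e)"
            using e unfolding sound_arc_def Weq by auto
          then have "?snd ?s" using U unfolding ar by blast
          moreover have "?cmp ?W ?W ?s" using U unfolding ar by blast
          moreover have "s ''li'' ` {..<Suc i} = insert ?e (s ''li'' ` {..<i})" by (simp add: lessThan_Suc)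
          then have "\<forall>e\<in>s ''li'' ` {..<Suc i}. (u e, v e, 1, e) \<in> arcset ?s \<and> (v e, u e, 1, e) \<in> arcset ?s"
            using U unfolding ar by auto
          ultimately show "?U (Suc i) ?s" using U unfolding r(1) by simp
        qed (simp_all add: push_edge_def push_arc_def)
      next
        fix s3 :: state assume f3: "unchanged (insert ''a'' (writes push_edge)) s3 s2" and U: "?U ?c s3"
        have "s3 ''li'' = s ''li''" "s3 ''cn'' 0 = ?c" "s3 ''wv'' = s ''wv''"
          using f2' f3 by (simp_all add: push_edge_def push_arc_def)
        then have eq: "cand s3 = ?N" "wset s3 = ?W" "s3 ''cn'' 0 = ?c"
          by (simp_all add: cand_def wset_def)
        have "(?c + ?c) * (?c + ?c) + (?c + ?c) \<le> 4 * (?c + 1) * (?c + 1)" by (simp add: algebra_simps)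
        then have "s3 ''na'' 0 \<le> 4 * (?c + 1) * (?c + 1)" using U by linarith
        moreover have "\<forall>e\<in>?N. (u e, v e, 1, e) \<in> arcset s3 \<and> (v e, u e, 1, e) \<in> arcset s3"
          using U unfolding cand_def by blast
        ultimately show "compressed s3" unfolding compressed_def eq using U by blast
      next
        fix s' :: state assume "unchanged (insert ''a'' (writes push_edge)) s' s2"
        then show "aval (Sc ''cn'') s' = ?c" using f2' by (simp add: push_edge_def push_arc_def)
      next
        have ar: "arcset (put ''a'' 0 s2) = arcset s2" by (simp add: arcset_def)
        show "?U 0 (put ''a'' 0 s2)" using Q unfolding ar by simp
      qed (simp_all add: push_edge_def push_arc_def)
    next
      show "(?c + ?c + 1) * (10 + (1000 * (n + m + 1) + (?c + ?c + 1) * 100) +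
          acost (Plus (Sc ''cn'') (Sc ''cn'')) + 20)
        \<le> (?c + ?c + 1) * (1000 * (n + m + 1) + 200 + (?c + ?c + 1) * 100)"
        by (rule mult_le_mono2) simp
    qed (simp_all add: push_pair_def push_arc_def writes_bfs)
  qed
  moreover have "10 + ((?c + ?c + 1) * (1000 * (n + m + 1) + 200 + (?c + ?c + 1) * 100) + (?c + 1) * 200)
      \<le> 4000 * (?c + 1) * (n + m + ?c + 1)"
  proof -
    define a where "a = ?c + 1"
    define b where "b = n + m + ?c + 1"
    define X where "X = (?c + ?c + 1) * (1000 * (n + m + 1) + 200 + (?c + ?c + 1) * 100)"
    have "X \<le> (2 * a) * (1300 * b)"
      unfolding X_def by (rule mult_le_mono) (simp_all add: a_def b_def)
    also have "\<dots> = 2600 * (a * b)" by simp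
    finally have "X \<le> 2600 * (a * b)" .
    moreover have "a * 1 \<le> a * b" by (rule mult_le_mono2) (simp add: b_def)
    moreover have "1 \<le> a" by (simp add: a_def)
    ultimately have "10 + (X + a * 200) \<le> 4000 * (a * b)" by linarith
    also have "\<dots> = 4000 * a * b" by (rule mult.assoc[symmetric])
    finally show ?thesis unfolding X_def a_def b_def .
  qed
  ultimately show ?thesis by (rule runs_conseq) assumption
qed

end

section \<open>Checking a set of removals\<close>

definition relax :: com where
  "relax = Cond (Conj (Equal (Read ''rm'' (Read ''fT'' (Sc ''j''))) (Const 0))
        (Less (Plus (Read ''dd'' (Read ''fA'' (Sc ''j''))) (Read ''fW'' (Sc ''j'')))
              (Read ''dd'' (Read ''fB'' (Sc ''j'')))))
     (Write ''dd'' (Read ''fB'' (Sc ''j'')) (Plus (Read ''dd'' (Read ''fA'' (Sc ''j''))) (Read ''fW'' (Sc ''j''))))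
     Skip"

text \<open>The value \<open>kk + 1\<close> plays the role of infinity. Rounds are counted by walk
  length in the original graph: \<open>kk\<close> of them suffice, since longer distances are of no
  interest.\<close>

definition bellman_ford :: com where
  "bellman_ford =
     For ''b'' (Plus (Sc ''cn'') (Sc ''cn''))
       (Write ''dd'' (Read ''wv'' (Sc ''b'')) (Plus (Sc ''kk'') (Const 1))) ;;
     Write ''dd'' (Read ''in_u'' (Sc ''e'')) (Const 0) ;;
     For ''r'' (Sc ''kk'') (For ''j'' (Sc ''na'') relax)"

context graph begin

text \<open>The last vertex of \<open>W\<close> on the walk splits off a tail in \<open>G - N\<close>, unless the walk ends with
  an edge of \<open>N\<close>.\<close>

lemma walk_last_hit:
  assumes N: "N \<subseteq> {..<m}" "W = u ` N \<union> v ` N" and S: "S \<in> W"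
  shows "(adj R ^^ L) S z \<Longrightarrow>
     \<exists>L1 L2 x. L1 + L2 = L \<and> x \<in> W \<and> (adj R ^^ L1) S x \<and> (adj N ^^ L2) x z"
proof (induction L arbitrary: z)
  case 0 then show ?case using S by (intro exI[of _ 0] exI[of _ S]) simp
next
  case (Suc L)
  then obtain y where y: "(adj R ^^ L) S y" "adj R y z" by auto
  from y(2) obtain i where i: "i < m" "i \<notin> R" "{u i, v i} = {y, z}" unfolding adj_def by blast
  show ?case
  proof (cases "i \<in> N")
    case True
    then have "z \<in> W" using N(2) i(3) by (auto simp: doubleton_eq_iff)
    then show ?thesis using Suc.prems by (intro exI[of _ "Suc L"] exI[of _ 0] exI[of _ z]) simp
  next
    case False
    then have yz: "adj N y z" using i unfolding adj_def by blast
    from Suc.IH[OF y(1)] obtain L1 L2 x where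
      x: "L1 + L2 = L" "x \<in> W" "(adj R ^^ L1) S x" "(adj N ^^ L2) x y" by blast
    have "(adj N ^^ Suc L2) x z" using x(4) yz by auto
    then show ?thesis using x by (intro exI[of _ L1] exI[of _ "Suc L2"] exI[of _ x]) simp
  qed
qed

text \<open>Last arc of a shortest walk in the compressed graph. The bound \<open>L1 \<le> L\<close>
  says that this arc has positive length, which is the progress on which the induction over the
  rounds rests.\<close>

lemma walk_last_arc:
  assumes N: "N \<subseteq> {..<m}" "W = u ` N \<union> v ` N" and S: "S \<in> W" and W: "(adj R ^^ Suc L) S y"
  shows "\<exists>x L1 w. x \<in> W \<and> L1 \<le> L \<and> L1 + w = Suc L \<and> (adj R ^^ L1) S x \<and>
     ((\<exists>t. t \<in> N \<and> t \<notin> R \<and> w = 1 \<and> {u t, v t} = {x, y}) \<or> (adj N ^^ w) x y)"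
proof -
  obtain z where z: "(adj R ^^ L) S z" "adj R z y" using W by auto
  from z(2) obtain i where i: "i < m" "i \<notin> R" "{u i, v i} = {z, y}" unfolding adj_def by blast
  show ?thesis
  proof (cases "i \<in> N")
    case True
    then have "z \<in> W" using N(2) i(3) by (auto simp: doubleton_eq_iff)
    moreover have "\<exists>t. t \<in> N \<and> t \<notin> R \<and> (1::nat) = 1 \<and> {u t, v t} = {z, y}" using True i by blast
    ultimately show ?thesis using z(1) by (intro exI[of _ z] exI[of _ L] exI[of _ 1]) simp
  next
    case False
    then have zy: "adj N z y" using i unfolding adj_def by blast
    from walk_last_hit[OF N S z(1)] obtain L1 L2 x where
      x: "L1 + L2 = L" "x \<in> W" "(adj R ^^ L1) S x" "(adj N ^^ L2) x z" by blast
    have "(adj N ^^ Suc L2) x y" using x(4) zy by auto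
    then show ?thesis using x by (intro exI[of _ x] exI[of _ L1] exI[of _ "Suc L2"]) simp
  qed
qed

definition ready :: "nat \<Rightarrow> state \<Rightarrow> bool" where
  "ready k s \<longleftrightarrow> holds_graph s \<and> s ''kk'' 0 = k \<and> compressed s \<and> cand s \<subseteq> {..<m} \<and>
     inj_on (s ''li'') {..<s ''cn'' 0} \<and> wset s = u ` cand s \<union> v ` cand s"

lemma ready_arcD:
  assumes r: "ready k s" and a: "(x, y, w, t) \<in> arcset s"
  shows "x \<in> wset s" "y \<in> wset s" "t \<le> m"
    "t = m \<and> (adj (cand s) ^^ w) x y \<or> t \<in> cand s \<and> t < m \<and> w = 1 \<and> {u t, v t} = {x, y}"
proof -
  have "compressed s" using r unfolding ready_def by blast
  then have "\<forall>a\<in>arcset s. sound_arc (cand s) (wset s) a" unfolding compressed_def by (rule conjunct1)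
  with a have sa: "sound_arc (cand s) (wset s) (x, y, w, t)" by blast
  then show "x \<in> wset s" "y \<in> wset s" unfolding sound_arc_def by simp_all
  have sub: "cand s \<subseteq> {..<m}" using r unfolding ready_def by blast
  have *: "t = m \<and> (adj (cand s) ^^ w) x y \<or> t \<in> cand s \<and> w = 1 \<and> {u t, v t} = {x, y}"
    using sa unfolding sound_arc_def by simp
  have "t \<in> cand s \<Longrightarrow> t < m" using sub by auto
  with * show "t = m \<and> (adj (cand s) ^^ w) x y \<or> t \<in> cand s \<and> t < m \<and> w = 1 \<and> {u t, v t} = {x, y}"
    by (elim disjE) simp_all
  then show "t \<le> m" by (elim disjE) simp_all
qed

text \<open>The arrays that the search for a solution reads but never writes.\<close>

definition frozen :: "string set" where
  "frozen = {''in_n'', ''in_m'', ''in_u'', ''in_v'', ''kk'', ''li'', ''cn'', ''wv'', ''fA'', ''fB'', ''fW'', ''fT'', ''na''}"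

lemma frozen_cong:
  assumes "\<forall>x\<in>frozen. s' x = s x"
  shows "ready k s' \<longleftrightarrow> ready k s" "cand s' = cand s" "wset s' = wset s" "arcset s' = arcset s"
    "s' ''li'' = s ''li''" "s' ''cn'' = s ''cn''" "s' ''kk'' = s ''kk''" "s' ''na'' = s ''na''"
    "s' ''in_u'' = s ''in_u''" "s' ''in_v'' = s ''in_v''" "s' ''wv'' = s ''wv''" "s' ''fT'' = s ''fT''"
    "s' ''fA'' = s ''fA''" "s' ''fB'' = s ''fB''" "s' ''fW'' = s ''fW''" "s' ''in_m'' = s ''in_m''" "s' ''in_n'' = s ''in_n''"
proof -
  show *: "s' ''li'' = s ''li''" "s' ''cn'' = s ''cn''" "s' ''kk'' = s ''kk''" "s' ''na'' = s ''na''"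
    "s' ''in_u'' = s ''in_u''" "s' ''in_v'' = s ''in_v''" "s' ''wv'' = s ''wv''" "s' ''fT'' = s ''fT''"
    "s' ''fA'' = s ''fA''" "s' ''fB'' = s ''fB''" "s' ''fW'' = s ''fW''" "s' ''in_m'' = s ''in_m''" "s' ''in_n'' = s ''in_n''"
    using assms by (simp_all add: frozen_def)
  show c: "cand s' = cand s" "wset s' = wset s" "arcset s' = arcset s"
    unfolding cand_def wset_def arcset_def * by simp_all
  show "ready k s' \<longleftrightarrow> ready k s"
    unfolding ready_def holds_graph_def compressed_def c * by simp
qed

text \<open>The index \<open>m\<close> is included: it is the tag of the arcs that stand for paths,
  it is never removed, and so the relaxation can test all tags in the same way.\<close>

definition marked :: "nat set \<Rightarrow> state \<Rightarrow> bool" where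
  "marked R s \<longleftrightarrow> (\<forall>t\<le>m. s ''rm'' t = (if t \<in> R then 1 else 0))"

definition dist_sound :: "nat \<Rightarrow> nat set \<Rightarrow> nat \<Rightarrow> state \<Rightarrow> bool" where
  "dist_sound k R S s \<longleftrightarrow> (\<forall>y\<in>wset s. s ''dd'' y \<le> k \<longrightarrow> (adj R ^^ s ''dd'' y) S y)"

text \<open>Estimates are updated in place, so a later arc may profit from an earlier one of the
  same round. Hence only upper bounds in terms of the old estimates are claimed, while soundness is
  kept as an invariant.\<close>

lemma runs_round:
  assumes r: "ready k s" and mk: "marked R s" and R: "R \<subseteq> cand s" and sound: "dist_sound k R S s"
  shows "runs (For ''j'' (Sc ''na'') relax) s ((s ''na'' 0 + 1) * 150)
    (\<lambda>s'. dist_sound k R S s' \<and> (\<forall>y. s' ''dd'' y \<le> s ''dd'' y) \<and>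
       (\<forall>(x, y, w, t)\<in>arcset s. t \<notin> R \<longrightarrow> s' ''dd'' y \<le> s ''dd'' x + w))"
proof -
  let ?P = "\<lambda>i s'::state. dist_sound k R S s' \<and> (\<forall>y. s' ''dd'' y \<le> s ''dd'' y) \<and>
    (\<forall>j<i. s ''fT'' j \<notin> R \<longrightarrow> s' ''dd'' (s ''fB'' j) \<le> s ''dd'' (s ''fA'' j) + s ''fW'' j)"
  have Rm: "R \<subseteq> {..<m}" using R r unfolding ready_def by blast
  show ?thesis
  proof (rule runs_For[where P = ?P and h = "s ''na'' 0" and B = 100])
    fix i and s' :: state
    assume i: "i < s ''na'' 0" "s' ''j'' 0 = i" and P: "?P i s'"
      and f: "unchanged (insert ''j'' (writes relax)) s' s"
    have fr: "\<forall>x\<in>frozen. s' x = s x" using f by (simp add: frozen_def relax_def)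
    note fc = frozen_cong[OF fr]
    define x y w t where d: "x = s ''fA'' i" "y = s ''fB'' i" "w = s ''fW'' i" "t = s ''fT'' i"
    have "(x, y, w, t) \<in> arcset s" unfolding d arcset_def using i(1) by blast
    note arc = ready_arcD[OF r this]
    have rm: "s' ''rm'' t = (if t \<in> R then 1 else 0)"
      using mk arc(3) f unfolding marked_def by (simp add: relax_def)
    show "runs relax s' 100 (\<lambda>s''. ?P (Suc i) (put ''j'' (Suc i) s''))"
    proof (rule runs_loop_free)
      let ?s = "put ''j'' (Suc i) (run relax s')"
      show "?P (Suc i) ?s"
      proof (cases "t \<notin> R \<and> s' ''dd'' x + w < s' ''dd'' y")
        case True
        have dd: "?s ''dd'' = (s' ''dd'')(y := s' ''dd'' x + w)"
          using True rm i fc(12-15) by (simp add: relax_def d fun_eq_iff)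
        have ws: "wset ?s = wset s" using fc(3) by (simp add: wset_def relax_def)
        have step: "(adj R ^^ w) x y"
        proof -
          show ?thesis using arc(4)
          proof
            assume "t = m \<and> (adj (cand s) ^^ w) x y"
            then show ?thesis using walk_mono[OF _ R] by simp
          next
            assume *: "t \<in> cand s \<and> t < m \<and> w = 1 \<and> {u t, v t} = {x, y}"
            then have "adj R x y" unfolding adj_def using True by (intro exI[of _ t]) simp
            then have "(adj R ^^ 1) x y" by (rule walk1)
            then show ?thesis using * by simp
          qed
        qed
        have "dist_sound k R S ?s" unfolding dist_sound_def ws dd
        proof (intro ballI impI)
          fix z assume z: "z \<in> wset s" "((s' ''dd'')(y := s' ''dd'' x + w)) z \<le> k"
          show "(adj R ^^ ((s' ''dd'')(y := s' ''dd'' x + w)) z) S z"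
          proof (cases "z = y")
            case True
            then have "s' ''dd'' x \<le> k" using z(2) by simp
            then have "(adj R ^^ s' ''dd'' x) S x" using P arc(1) fc(3) unfolding dist_sound_def by simp
            then show ?thesis using walk_append step True by simp
          next
            case False
            then show ?thesis using z P fc(3) unfolding dist_sound_def by simp
          qed
        qed
        moreover have "\<forall>z. ?s ''dd'' z \<le> s ''dd'' z"
        proof
          fix z
          have "?s ''dd'' z \<le> s' ''dd'' z" unfolding dd using True by simp
          also have "\<dots> \<le> s ''dd'' z" using P by blast
          finally show "?s ''dd'' z \<le> s ''dd'' z" .
        qed
        moreover have "\<forall>j<Suc i. s ''fT'' j \<notin> R \<longrightarrow> ?s ''dd'' (s ''fB'' j) \<le> s ''dd'' (s ''fA'' j) + s ''fW'' j"
        proof (intro allI impI)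
          fix j assume j: "j < Suc i" "s ''fT'' j \<notin> R"
          have le: "?s ''dd'' (s ''fB'' j) \<le> s' ''dd'' (s ''fB'' j)" unfolding dd using True by simp
          from j(1) have "j < i \<or> j = i" by linarith
          then show "?s ''dd'' (s ''fB'' j) \<le> s ''dd'' (s ''fA'' j) + s ''fW'' j"
          proof
            assume "j < i"
            then have "s' ''dd'' (s ''fB'' j) \<le> s ''dd'' (s ''fA'' j) + s ''fW'' j" using P j(2) by blast
            with le show ?thesis by (rule le_trans)
          next
            assume "j = i"
            moreover have "s' ''dd'' x \<le> s ''dd'' x" using P by blast
            ultimately show ?thesis unfolding dd by (simp add: d)
          qed
        qed
        ultimately show ?thesis by blast
      next
        case False
        have "run relax s' = s'"
          using False rm i fc(12-15) by (cases "s ''fT'' i \<in> R") (simp_all add: relax_def d)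
        then have e: "?s ''dd'' = s' ''dd''" "wset ?s = wset s'" by (simp_all add: wset_def)
        have "s' ''dd'' (s ''fB'' i) \<le> s ''dd'' (s ''fA'' i) + s ''fW'' i" if "s ''fT'' i \<notin> R"
        proof -
          have "s' ''dd'' y \<le> s' ''dd'' x + w" using False that unfolding d by simp
          moreover have "s' ''dd'' x \<le> s ''dd'' x" using P by blast
          ultimately show ?thesis unfolding d by linarith
        qed
        then show ?thesis using P unfolding dist_sound_def e by (simp add: less_Suc_eq)
      qed
    qed (simp_all add: relax_def)
  next
    fix s' assume P: "?P (s ''na'' 0) s'"
    then show "dist_sound k R S s' \<and> (\<forall>y. s' ''dd'' y \<le> s ''dd'' y) \<and>
       (\<forall>(x, y, w, t)\<in>arcset s. t \<notin> R \<longrightarrow> s' ''dd'' y \<le> s ''dd'' x + w)"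
      unfolding arcset_def by simp
  next
    show "?P 0 (put ''j'' 0 s)" using sound by (simp add: dist_sound_def wset_def)
  qed (simp_all add: relax_def)
qed

lemma runs_bellman_ford:
  assumes r: "ready k s" and mk: "marked R s" and R: "R \<subseteq> cand s" and E: "s ''e'' 0 \<in> cand s"
  shows "runs bellman_ford s (400 * (k + 1) * (s ''na'' 0 + s ''cn'' 0 + 1))
    (\<lambda>s'. s' ''dd'' (v (s ''e'' 0)) \<le> k \<longleftrightarrow> (\<exists>L\<le>k. (adj R ^^ L) (u (s ''e'' 0)) (v (s ''e'' 0))))"
proof -
  let ?e = "s ''e'' 0" and ?S = "u (s ''e'' 0)" and ?c = "s ''cn'' 0" and ?a = "s ''na'' 0"
  let ?init = "Write ''dd'' (Read ''wv'' (Sc ''b'')) (Plus (Sc ''kk'') (Const 1))"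
  let ?post = "\<lambda>s'::state. s' ''dd'' (v ?e) \<le> k \<longleftrightarrow> (\<exists>L\<le>k. (adj R ^^ L) ?S (v ?e))"
  have kk: "s ''kk'' 0 = k" using r by (simp add: ready_def)
  have W: "wset s = u ` cand s \<union> v ` cand s" "cand s \<subseteq> {..<m}" using r by (simp_all add: ready_def)
  then have SW: "?S \<in> wset s" "v ?e \<in> wset s" and em: "?e < m" using E by auto
  have ue: "s ''in_u'' ?e = ?S" using r em by (simp add: ready_def holds_graph_def)
  have "runs bellman_ford s ((?c + ?c + 1) * 60 + (20 + (k + 1) * ((?a + 1) * 150 + 50))) ?post"
    unfolding bellman_ford_def
  proof (rule runs_Seq[where Q = "\<lambda>s'. \<forall>x\<in>wset s. s' ''dd'' x = k + 1"])
    show "runs (For ''b'' (Plus (Sc ''cn'') (Sc ''cn'')) ?init) s ((?c + ?c + 1) * 60)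
        (\<lambda>s'. \<forall>x\<in>wset s. s' ''dd'' x = k + 1)"
    proof (rule runs_For[where P = "\<lambda>i s'. \<forall>x\<in>s ''wv'' ` {..<i}. s' ''dd'' x = k + 1" and h = "?c + ?c" and B = 20])
      fix i and s' :: state
      assume i: "s' ''b'' 0 = i" and P: "\<forall>x\<in>s ''wv'' ` {..<i}. s' ''dd'' x = k + 1"
        and f: "unchanged (insert ''b'' (writes ?init)) s' s"
      have f': "s' ''wv'' = s ''wv''" "s' ''kk'' 0 = k" using f kk by simp_all
      show "runs ?init s' 20 (\<lambda>s''. \<forall>x\<in>s ''wv'' ` {..<Suc i}. put ''b'' (Suc i) s'' ''dd'' x = k + 1)"
        by (rule runs_loop_free) (use P i f' in \<open>auto simp: less_Suc_eq\<close>)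
    qed (simp_all add: wset_def)
  next
    fix s1 assume f1: "unchanged (writes (For ''b'' (Plus (Sc ''cn'') (Sc ''cn'')) ?init)) s1 s"
      and d1: "\<forall>x\<in>wset s. s1 ''dd'' x = k + 1"
    let ?w = "Write ''dd'' (Read ''in_u'' (Sc ''e'')) (Const 0)"
    let ?Q = "\<lambda>s'::state. \<forall>x\<in>wset s. s' ''dd'' x = (if x = ?S then 0 else k + 1)"
    show "runs (?w ;; For ''r'' (Sc ''kk'') (For ''j'' (Sc ''na'') relax)) s1
       (20 + (k + 1) * ((?a + 1) * 150 + 50)) ?post"
    proof (rule runs_Seq[where Q = ?Q])
      have f1': "s1 ''e'' = s ''e''" "s1 ''in_u'' = s ''in_u''" using f1 by simp_all
      show "runs ?w s1 20 ?Q" by (rule runs_loop_free) (use d1 ue f1' in simp_all)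
    next
      fix s2 assume f2: "unchanged (writes ?w) s2 s1" and d2: "?Q s2"
      have fr2: "\<forall>x\<in>frozen. s2 x = s x" "s2 ''rm'' = s ''rm''" using f1 f2 by (simp_all add: frozen_def)
      \<comment> \<open>After \<open>i\<close> rounds the estimate is correct for every vertex of
        \<open>wset\<close> that is at distance at most \<open>i\<close> in the graph without
        \<open>R\<close>.\<close>
      let ?P = "\<lambda>i s'::state. dist_sound k R ?S s' \<and> (\<forall>y\<in>wset s. \<forall>L\<le>i. (adj R ^^ L) ?S y \<longrightarrow> s' ''dd'' y \<le> L)"
      show "runs (For ''r'' (Sc ''kk'') (For ''j'' (Sc ''na'') relax)) s2 ((k + 1) * ((?a + 1) * 150 + 50)) ?post"
      proof (rule runs_For[where P = ?P and h = k and B = "(?a + 1) * 150"])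
        fix i and s3 :: state
        assume i: "i < k" "s3 ''r'' 0 = i" and P: "?P i s3"
          and f3: "unchanged (insert ''r'' (writes (For ''j'' (Sc ''na'') relax))) s3 s2"
        have fr3: "\<forall>x\<in>frozen. s3 x = s x" "s3 ''rm'' = s ''rm''"
          using f3 fr2 by (simp_all add: frozen_def relax_def)
        note fc = frozen_cong[OF fr3(1)]
        have r3: "ready k s3" "marked R s3" "R \<subseteq> cand s3"
          using r mk R fc(1,2) fr3(2) by (simp_all add: marked_def)
        show "runs (For ''j'' (Sc ''na'') relax) s3 ((?a + 1) * 150) (\<lambda>s''. ?P (Suc i) (put ''r'' (Suc i) s''))"
        proof (rule runs_conseq[OF runs_round[OF r3 conjunct1[OF P]]])
          show "(s3 ''na'' 0 + 1) * 150 \<le> (?a + 1) * 150" using fc(8) by simp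
        next
          fix s4 assume *: "dist_sound k R ?S s4 \<and> (\<forall>y. s4 ''dd'' y \<le> s3 ''dd'' y) \<and>
             (\<forall>(x, y, w, t)\<in>arcset s3. t \<notin> R \<longrightarrow> s4 ''dd'' y \<le> s3 ''dd'' x + w)"
          have "\<forall>y\<in>wset s. \<forall>L\<le>Suc i. (adj R ^^ L) ?S y \<longrightarrow> s4 ''dd'' y \<le> L"
          proof (intro ballI allI impI)
            fix y L assume y: "y \<in> wset s" "L \<le> Suc i" "(adj R ^^ L) ?S y"
            show "s4 ''dd'' y \<le> L"
            proof (cases "L \<le> i")
              case True
              then have "s3 ''dd'' y \<le> L" using P y by blast
              then show ?thesis using * le_trans by blast
            next
              case False
              then have L: "L = Suc i" using y(2) by simp
              from walk_last_arc[OF W(2,1) SW(1) y(3)[unfolded L]] obtain x L1 w where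
                x: "x \<in> wset s" "L1 \<le> i" "L1 + w = Suc i" "(adj R ^^ L1) ?S x"
                  "(\<exists>t. t \<in> cand s \<and> t \<notin> R \<and> w = 1 \<and> {u t, v t} = {x, y}) \<or> (adj (cand s) ^^ w) x y" by blast
              have "\<exists>w'\<le>w. \<exists>t. t \<notin> R \<and> (x, y, w', t) \<in> arcset s"
                using x(5)
              proof
                assume "\<exists>t. t \<in> cand s \<and> t \<notin> R \<and> w = 1 \<and> {u t, v t} = {x, y}"
                then obtain t where t: "t \<in> cand s" "t \<notin> R" "w = 1" "{u t, v t} = {x, y}" by blast
                have "(u t, v t, 1, t) \<in> arcset s" "(v t, u t, 1, t) \<in> arcset s"
                  using r t(1) unfolding ready_def compressed_def by blast+
                moreover have "u t = x \<and> v t = y \<or> u t = y \<and> v t = x" using t(4) unfolding doubleton_eq_iff .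
                ultimately have "(x, y, 1, t) \<in> arcset s" by auto
                then show ?thesis using t(2,3) by blast
              next
                assume "(adj (cand s) ^^ w) x y"
                \<comment> \<open>The recorded path may be shorter than the tail it replaces, which
                  can only improve the estimate.\<close>
                then obtain w' where "w' \<le> w" "(x, y, w', m) \<in> arcset s"
                  using r x(1) y(1) unfolding ready_def compressed_def by blast
                moreover have "m \<notin> R" using R W(2) by auto
                ultimately show ?thesis by blast
              qed
              then obtain w' t where "w' \<le> w" "t \<notin> R" "(x, y, w', t) \<in> arcset s3" using fc(4) by blast
              then have "s4 ''dd'' y \<le> s3 ''dd'' x + w'" using * by blast
              moreover have "s3 ''dd'' x \<le> L1" using P x(1,2,4) by blast
              ultimately show ?thesis using \<open>w' \<le> w\<close> x(3) L by linarith
            qed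
          qed
          then show "?P (Suc i) (put ''r'' (Suc i) s4)" using * by (simp add: dist_sound_def wset_def)
        qed
      next
        fix s3 assume f3: "unchanged (insert ''r'' (writes (For ''j'' (Sc ''na'') relax))) s3 s2" and P: "?P k s3"
        have "wset s3 = wset s" using f3 fr2 by (intro frozen_cong(3)) (simp add: frozen_def relax_def)
        then have v: "v ?e \<in> wset s3" "v ?e \<in> wset s" using SW(2) by simp_all
        show "?post s3"
        proof
          assume "s3 ''dd'' (v ?e) \<le> k"
          then show "\<exists>L\<le>k. (adj R ^^ L) ?S (v ?e)" using P v(1) unfolding dist_sound_def by blast
        next
          assume "\<exists>L\<le>k. (adj R ^^ L) ?S (v ?e)"
          then obtain L where L: "L \<le> k" "(adj R ^^ L) ?S (v ?e)" by blast
          then have "s3 ''dd'' (v ?e) \<le> L" using P v(2) by blast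
          then show "s3 ''dd'' (v ?e) \<le> k" using L(1) by simp
        qed
      next
        fix s' :: state assume "unchanged (insert ''r'' (writes (For ''j'' (Sc ''na'') relax))) s' s2"
        then show "aval (Sc ''kk'') s' = k" using fr2 kk by (simp add: frozen_def relax_def)
      next
        have ws: "wset (put ''r'' 0 s2) = wset s" using frozen_cong(3)[OF fr2(1)] by (simp add: wset_def)
        show "?P 0 (put ''r'' 0 s2)" unfolding dist_sound_def ws using d2 by simp
      next
        show "(k + 1) * ((?a + 1) * 150 + acost (Sc ''kk'') + 20) \<le> (k + 1) * ((?a + 1) * 150 + 50)"
          by (rule mult_le_mono2) simp
      qed (simp_all add: relax_def)
    qed
  qed
  moreover have "(?c + ?c + 1) * 60 + (20 + (k + 1) * ((?a + 1) * 150 + 50)) \<le> 400 * (k + 1) * (?a + ?c + 1)"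
  proof -
    define p where "p = ?a + ?c + 1"
    define X where "X = (k + 1) * ((?a + 1) * 150 + 50)"
    define Z where "Z = (k + 1) * p"
    have "X \<le> (k + 1) * (200 * p)"
      unfolding X_def by (rule mult_le_mono2) (simp add: p_def)
    then have 1: "X \<le> 200 * Z" by (simp add: Z_def mult.left_commute)
    have "1 * p \<le> Z" unfolding Z_def by (rule mult_le_mono1) simp
    moreover have "(?c + ?c + 1) * 60 + 20 \<le> 140 * p" by (simp add: p_def)
    ultimately have "(?c + ?c + 1) * 60 + (20 + X) \<le> 400 * Z" using 1 by linarith
    also have "\<dots> = 400 * (k + 1) * p" unfolding Z_def by (rule mult.assoc[symmetric])
    finally show ?thesis unfolding X_def p_def .
  qed
  ultimately show ?thesis by (rule runs_conseq) assumption
qed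

end

section \<open>Enumerating sets of removals\<close>

definition val :: "nat \<Rightarrow> nat \<Rightarrow> (nat \<Rightarrow> nat) \<Rightarrow> nat" where
  "val c r f = (\<Sum>i<r. f i * c ^ i)"

lemma val_less: "\<forall>i<r. f i < c \<Longrightarrow> val c r f < c ^ r"
proof (induction r)
  case (Suc r)
  then have "val c r f + 1 \<le> c ^ r" by (simp add: Suc_le_eq)
  moreover have "(f r + 1) * c ^ r \<le> c * c ^ r" using Suc.prems by (intro mult_right_mono) (auto simp: Suc_le_eq)
  ultimately show ?case by (simp add: val_def)
qed (simp add: val_def)

lemma digit_unique:
  fixes a b x y q :: nat
  assumes "a < q" "b < q" "a + x * q = b + y * q"
  shows "x = y \<and> a = b"
proof -
  have "(a + x * q) div q = x" "(b + y * q) div q = y" using assms(1,2) by simp_all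
  then have "x = y" using assms(3) by simp
  then show ?thesis using assms(3) by simp
qed

lemma val_inj:
  "\<forall>i<r. f i < c \<Longrightarrow> \<forall>i<r. g i < c \<Longrightarrow> val c r f = val c r g \<Longrightarrow> \<forall>i<r. f i = g i"
proof (induction r)
  case (Suc r)
  have f: "val c r f < c ^ r" and g: "val c r g < c ^ r" using Suc.prems by (auto intro: val_less)
  have e: "val c r f + f r * c ^ r = val c r g + g r * c ^ r" using Suc.prems(3) by (simp add: val_def)
  have fg: "f r = g r" "val c r f = val c r g" using digit_unique[OF f g e] by simp_all
  have "\<forall>i<r. f i = g i" by (rule Suc.IH) (use Suc.prems(1,2) fg(2) in auto)
  then show ?case using fg(1) by (simp add: less_Suc_eq)
qed simp

lemma val_max: "\<forall>l<i. f l + 1 = c \<Longrightarrow> val c i f + 1 = c ^ i"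
proof (induction i)
  case (Suc i)
  then have "val c i f + 1 = c ^ i" by simp
  moreover have "c = f i + 1" using Suc.prems by simp
  ultimately show ?case by (simp add: val_def)
qed (simp add: val_def)

text \<open>The \<open>i\<close> lowest digits are maximal and contribute \<open>c ^ i - 1\<close>;
  resetting them to 0 while raising digit \<open>i\<close> adds exactly 1.\<close>

lemma val_carry:
  assumes "\<forall>l<i. f l + 1 = c" "\<forall>l<i. g l = 0" "g i = f i + 1"
  shows "i < r \<Longrightarrow> \<forall>l. i < l \<longrightarrow> l < r \<longrightarrow> g l = f l \<Longrightarrow> val c r g = val c r f + 1"
proof (induction r)
  case (Suc r)
  show ?case
  proof (cases "r = i")
    case True
    have "val c i g = 0" using assms(2) by (simp add: val_def)
    then have "val c (Suc i) g = (f i + 1) * c ^ i" using assms(3) by (simp add: val_def)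
    moreover have "val c (Suc i) f + 1 = c ^ i + f i * c ^ i" using val_max[OF assms(1)] by (simp add: val_def)
    ultimately show ?thesis unfolding True by simp
  next
    case False
    then have "val c r g = val c r f + 1" "g r = f r" using Suc by simp_all
    then show ?thesis by (simp add: val_def)
  qed
qed simp

text \<open>The current tuple \<open>tp\<close> holds positions in the list \<open>li\<close> of \<open>N\<close>, read as digits in base
  \<open>cn = |N|\<close>; \<open>rm\<close> marks the removed edges.\<close>

definition mark_tuple :: com where
  "mark_tuple = Set ''ok'' (Const 1) ;;
     For ''i'' (Sc ''in_rho'')
       (Set ''e'' (Read ''li'' (Read ''tp'' (Sc ''i''))) ;;
        Cond (Equal (Read ''rm'' (Sc ''e'')) (Const 1)) (Set ''ok'' (Const 0)) (Write ''rm'' (Sc ''e'') (Const 1)))"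

definition verify :: com where
  "verify = For ''i'' (Sc ''in_rho'')
     (Set ''e'' (Read ''li'' (Read ''tp'' (Sc ''i''))) ;; bellman_ford ;;
      Cond (Less (Sc ''kk'') (Read ''dd'' (Read ''in_v'' (Sc ''e'')))) (Set ''ok'' (Const 0)) Skip)"

definition unmark_tuple :: com where
  "unmark_tuple = For ''i'' (Sc ''in_rho'') (Write ''rm'' (Read ''li'' (Read ''tp'' (Sc ''i''))) (Const 0))"

text \<open>An odometer: maximal digits are reset until one can be raised. If the carry runs past
  the last digit, all tuples have been tried.\<close>

definition advance :: com where
  "advance = Set ''i'' (Const 0) ;;
     Loop (Conj (Less (Sc ''i'') (Sc ''in_rho'')) (Equal (Plus (Read ''tp'' (Sc ''i'')) (Const 1)) (Sc ''cn'')))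
       (Write ''tp'' (Sc ''i'') (Const 0) ;; Set ''i'' (Plus (Sc ''i'') (Const 1))) ;;
     Cond (Equal (Sc ''i'') (Sc ''in_rho'')) (Set ''dn'' (Const 1))
       (Write ''tp'' (Sc ''i'') (Plus (Read ''tp'' (Sc ''i'')) (Const 1)))"

text \<open>After a success the marks in \<open>rm\<close> are kept on purpose, since the witness is
  read off from them; only a rejected tuple is unmarked.\<close>

definition try_tuple :: com where
  "try_tuple = mark_tuple ;; verify ;;
     Cond (Equal (Sc ''ok'') (Const 1)) (Set ''fd'' (Const 1) ;; Set ''dn'' (Const 1)) (unmark_tuple ;; advance)"

lemma writes_bellman_ford: "writes bellman_ford = {''b'', ''dd'', ''r'', ''j''}"
  by (auto simp: bellman_ford_def relax_def)

lemma runs_advance: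
  assumes r: "s ''in_rho'' 0 = r" and c: "s ''cn'' 0 = c" and tp: "\<forall>i<r. s ''tp'' i < c"
  shows "runs advance s (100 * (r + 1)) (\<lambda>s'.
    s' ''dn'' 0 = 1 \<and> val c r (s ''tp'') + 1 = c ^ r \<or>
    s' ''dn'' = s ''dn'' \<and> val c r (s' ''tp'') = val c r (s ''tp'') + 1 \<and> (\<forall>i<r. s' ''tp'' i < c))"
    (is "runs _ _ _ ?post")
proof -
  let ?b = "Conj (Less (Sc ''i'') (Sc ''in_rho'')) (Equal (Plus (Read ''tp'' (Sc ''i'')) (Const 1)) (Sc ''cn''))"
  let ?c = "Write ''tp'' (Sc ''i'') (Const 0) ;; Set ''i'' (Plus (Sc ''i'') (Const 1))"
  let ?d = "Cond (Equal (Sc ''i'') (Sc ''in_rho'')) (Set ''dn'' (Const 1))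
       (Write ''tp'' (Sc ''i'') (Plus (Read ''tp'' (Sc ''i'')) (Const 1)))"
  let ?I = "\<lambda>s'::state. s' ''i'' 0 \<le> r \<and> (\<forall>l<s' ''i'' 0. s ''tp'' l + 1 = c \<and> s' ''tp'' l = 0) \<and>
     (\<forall>l\<ge>s' ''i'' 0. s' ''tp'' l = s ''tp'' l)"
  have "runs advance s (10 + ((r + 1) * 50 + 40)) ?post" unfolding advance_def
  proof (rule runs_Seq[where Q = ?I])
    show "runs (Set ''i'' (Const 0)) s 10 ?I" by (rule runs_loop_free) simp_all
  next
    fix s1 assume f1: "unchanged (writes (Set ''i'' (Const 0))) s1 s" and I1: "?I s1"
    have g1: "s1 ''in_rho'' 0 = r" "s1 ''cn'' 0 = c" "s1 ''dn'' = s ''dn''" using f1 r c by simp_all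
    show "runs (Loop ?b ?c ;; ?d) s1 ((r + 1) * 50 + 40) ?post"
    proof (rule runs_Seq[where Q = "\<lambda>s'. ?I s' \<and> \<not> bval ?b s'"])
      show "runs (Loop ?b ?c) s1 ((r + 1) * 50) (\<lambda>s'. ?I s' \<and> \<not> bval ?b s')"
      proof (rule runs_Loop[where Inv = ?I and \<mu> = "\<lambda>s'. r - s' ''i'' 0" and B = 20])
        fix s' assume f: "unchanged (writes ?c) s' s1" and I: "?I s'" and b: "bval ?b s'"
        have g: "s' ''in_rho'' 0 = r" "s' ''cn'' 0 = c" using f g1 by simp_all
        have b': "s' ''i'' 0 < r" "s' ''tp'' (s' ''i'' 0) + 1 = c" using b g by simp_all
        have e: "s' ''tp'' (s' ''i'' 0) = s ''tp'' (s' ''i'' 0)" using I by blast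
        show "runs ?c s' 20 (\<lambda>s''. ?I s'' \<and> r - s'' ''i'' 0 < r - s' ''i'' 0)"
        proof (rule runs_loop_free)
          show "?I (run ?c s') \<and> r - run ?c s' ''i'' 0 < r - s' ''i'' 0"
            using I b' e by (simp add: less_Suc_eq)
        qed simp_all
      next
        show "(r - s1 ''i'' 0 + 1) * (1 + bcost ?b + 20) \<le> (r + 1) * 50" by (rule mult_le_mono) simp_all
      qed (use I1 in simp_all)
    next
      fix s2 assume f2: "unchanged (writes (Loop ?b ?c)) s2 s1" and I2: "?I s2 \<and> \<not> bval ?b s2"
      have g2: "s2 ''in_rho'' 0 = r" "s2 ''cn'' 0 = c" "s2 ''dn'' = s ''dn''" using f2 g1 by simp_all
      let ?i = "s2 ''i'' 0"
      have I: "?i \<le> r" "\<forall>l<?i. s ''tp'' l + 1 = c" "\<forall>l<?i. s2 ''tp'' l = 0" "\<forall>l\<ge>?i. s2 ''tp'' l = s ''tp'' l"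
        using I2 by simp_all
      show "runs ?d s2 40 ?post"
      proof (rule runs_loop_free)
        show "?post (run ?d s2)"
        proof (cases "?i = r")
          case True
          have "val c r (s ''tp'') + 1 = c ^ r" using val_max[OF I(2)] True by simp
          then show ?thesis using True g2 by simp
        next
          case False
          then have i: "?i < r" using I(1) by simp
          have "\<not> bval ?b s2" using I2 by blast
          then have nb: "s2 ''tp'' ?i + 1 \<noteq> c" using i g2 by simp
          let ?g = "(s2 ''tp'')(?i := s2 ''tp'' ?i + 1)"
          have "run ?d s2 = s2(''tp'' := ?g)" using False g2 by simp
          moreover have "val c r ?g = val c r (s ''tp'') + 1"
            by (rule val_carry[of ?i]) (use I i in simp_all)
          moreover have "\<forall>l<r. ?g l < c"
          proof (intro allI impI)
            fix l assume l: "l < r"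
            have "s ''tp'' l < c" using tp l by blast
            moreover have "s2 ''tp'' l \<le> s ''tp'' l" using I(3,4) by (cases "l < ?i") simp_all
            ultimately show "?g l < c" using nb by auto
          qed
          ultimately show ?thesis using g2 by simp
        qed
      qed simp_all
    qed
  qed
  then show ?thesis by (rule runs_conseq) simp_all
qed

text \<open>The factors are the number of Bellman-Ford calls, the number of rounds in each, and, up
  to a constant, the number of arcs.\<close>

definition step_time :: "nat \<Rightarrow> nat \<Rightarrow> nat \<Rightarrow> nat" where
  "step_time k r c = 3000 * ((r + 1) * (k + 1) * ((c + 1) * (c + 1)))"

lemma step_time_bound:
  assumes "na \<le> 4 * (c + 1) * (c + 1)"
  shows "100 * (r + 1) + ((r + 1) * (400 * (k + 1) * (na + c + 1) + 100) + (20 + (50 * (r + 1) + 100 * (r + 1))))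
     \<le> step_time k r c"
proof -
  define q where "q = (c + 1) * (c + 1)"
  have "c + 1 \<le> q" unfolding q_def by simp
  then have 1: "na + c + 1 \<le> 5 * q" 
    using assms unfolding mult.assoc[of 4 "c + 1"] q_def[symmetric] by linarith
  have "(k + 1) * (na + c + 1) \<le> (k + 1) * (5 * q)" by (rule mult_le_mono2[OF 1])
  then have "(k + 1) * (na + c + 1) \<le> 5 * ((k + 1) * q)" unfolding mult.left_commute[of "k + 1" 5] .
  then have "400 * ((k + 1) * (na + c + 1)) \<le> 400 * (5 * ((k + 1) * q))" by (rule mult_le_mono2)
  then have 2: "400 * (k + 1) * (na + c + 1) \<le> 2000 * ((k + 1) * q)"
    unfolding mult.assoc[of 400 "k + 1"] by simp
  have "1 \<le> q" unfolding q_def by simp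
  then have 3: "1 \<le> (k + 1) * q" by simp
  have "400 * (k + 1) * (na + c + 1) + 400 \<le> 3000 * ((k + 1) * q)" using 2 3 by linarith
  then have "(r + 1) * (400 * (k + 1) * (na + c + 1) + 400) \<le> (r + 1) * (3000 * ((k + 1) * q))"
    by (rule mult_le_mono2)
  also have "\<dots> = step_time k r c" unfolding step_time_def q_def by (simp only: mult.assoc mult.left_commute)
  finally have "(r + 1) * (400 * (k + 1) * (na + c + 1) + 400) \<le> step_time k r c" .
  moreover have "100 * (r + 1) + ((r + 1) * (X + 100) + (20 + (50 * (r + 1) + 100 * (r + 1)))) \<le> (r + 1) * (X + 400)" for X
    by (simp add: algebra_simps)
  ultimately show ?thesis using le_trans by blast
qed

section \<open>Correctness of one step of the enumeration\<close>

context graph begin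

text \<open>Tuples with repetitions are rejected, because they would remove fewer than
  \<open>r\<close> edges.\<close>

definition valid :: "nat \<Rightarrow> nat \<Rightarrow> (nat \<Rightarrow> nat) \<Rightarrow> bool" where
  "valid k r h \<longleftrightarrow> inj_on h {..<r} \<and> good k (h ` {..<r})"

lemma runs_mark_tuple:
  assumes r: "s ''in_rho'' 0 = r" and mk: "marked {} s"
    and h: "\<forall>l. s ''li'' (s ''tp'' l) = h l" "\<forall>l<r. h l < m"
  shows "runs mark_tuple s (100 * (r + 1)) (\<lambda>s'. marked (h ` {..<r}) s' \<and>
     s' ''ok'' 0 = (if inj_on h {..<r} then 1 else 0))"
proof -
  let ?P = "\<lambda>i s'. marked (h ` {..<i}) s' \<and> s' ''ok'' 0 = (if inj_on h {..<i} then 1 else 0)"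
  let ?c = "Set ''e'' (Read ''li'' (Read ''tp'' (Sc ''i''))) ;;
        Cond (Equal (Read ''rm'' (Sc ''e'')) (Const 1)) (Set ''ok'' (Const 0)) (Write ''rm'' (Sc ''e'') (Const 1))"
  have "runs mark_tuple s (10 + (r + 1) * 80) (?P r)" unfolding mark_tuple_def
  proof (rule runs_Seq[where Q = "\<lambda>s'. s' ''ok'' 0 = 1"])
    show "runs (Set ''ok'' (Const 1)) s 10 (\<lambda>s'. s' ''ok'' 0 = 1)" by (rule runs_loop_free) simp_all
  next
    fix s1 assume f1: "unchanged (writes (Set ''ok'' (Const 1))) s1 s" and ok: "s1 ''ok'' 0 = 1"
    show "runs (For ''i'' (Sc ''in_rho'') ?c) s1 ((r + 1) * 80) (?P r)"
    proof (rule runs_For[where P = ?P and h = r and B = 50])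
      fix i and s2 :: state
      assume i: "i < r" "s2 ''i'' 0 = i" and P: "?P i s2"
        and f2: "unchanged (insert ''i'' (writes ?c)) s2 s1"
      have e: "s2 ''li'' (s2 ''tp'' i) = h i" using f2 f1 h(1) by simp
      have hm: "h i \<le> m" using h(2) i(1) by (simp add: less_imp_le)
      have rm: "s2 ''rm'' (h i) = (if h i \<in> h ` {..<i} then 1 else 0)" using P hm by (simp add: marked_def)
      have ins: "h ` {..<Suc i} = insert (h i) (h ` {..<i})" by (simp add: lessThan_Suc)
      have inj: "inj_on h {..<Suc i} \<longleftrightarrow> inj_on h {..<i} \<and> h i \<notin> h ` {..<i}"
        by (simp add: lessThan_Suc)
      show "runs ?c s2 50 (\<lambda>s''. ?P (Suc i) (put ''i'' (Suc i) s''))"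
      proof (rule runs_loop_free)
        show "?P (Suc i) (put ''i'' (Suc i) (run ?c s2))"
        proof (cases "h i \<in> h ` {..<i}")
          case True
          then have "insert (h i) (h ` {..<i}) = h ` {..<i}" by (rule insert_absorb)
          then show ?thesis unfolding ins inj using P True rm e i by (simp add: marked_def)
        next
          case False
          then show ?thesis unfolding ins inj using P rm e i by (simp add: marked_def)
        qed
      qed simp_all
    qed (use f1 ok mk r in \<open>simp_all add: marked_def\<close>)
  qed
  then show ?thesis by (rule runs_conseq) simp_all
qed

text \<open>The flag can only drop to 0, so a repetition detected while marking is not
  forgotten.\<close>

lemma runs_verify:
  assumes rd: "ready k s" and r: "s ''in_rho'' 0 = r" and mk: "marked (h ` {..<r}) s"
    and h: "\<forall>l. s ''li'' (s ''tp'' l) = h l" "\<forall>l<r. h l \<in> cand s"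
  shows "runs verify s ((r + 1) * (400 * (k + 1) * (s ''na'' 0 + s ''cn'' 0 + 1) + 100))
     (\<lambda>s'. s' ''ok'' 0 = (if good k (h ` {..<r}) then s ''ok'' 0 else 0))"
proof -
  let ?T = "400 * (k + 1) * (s ''na'' 0 + s ''cn'' 0 + 1)"
  let ?R = "h ` {..<r}"
  let ?ok = "\<lambda>e. \<exists>L\<le>k. (adj ?R ^^ L) (u e) (v e)"
  let ?d = "Cond (Less (Sc ''kk'') (Read ''dd'' (Read ''in_v'' (Sc ''e'')))) (Set ''ok'' (Const 0)) Skip"
  let ?c = "Set ''e'' (Read ''li'' (Read ''tp'' (Sc ''i''))) ;; bellman_ford ;; ?d"
  let ?P = "\<lambda>i s'::state. s' ''ok'' 0 = (if \<forall>l<i. ?ok (h l) then s ''ok'' 0 else 0)"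
  have R: "?R \<subseteq> cand s" using h(2) by auto
  have cm: "cand s \<subseteq> {..<m}" using rd unfolding ready_def by blast
  show ?thesis unfolding verify_def
  proof (rule runs_For[where P = ?P and h = r and B = "10 + (?T + 40)"])
    fix i and s1 :: state
    assume i: "i < r" "s1 ''i'' 0 = i" and P: "?P i s1"
      and f1: "unchanged (insert ''i'' (writes ?c)) s1 s"
    have hc: "h i \<in> cand s" using h(2) i(1) by blast
    then have hm: "h i < m" using cm by auto
    have fr1: "\<forall>x\<in>frozen. s1 x = s x" "s1 ''tp'' = s ''tp''" "s1 ''rm'' = s ''rm''"
      using f1 by (simp_all add: writes_bellman_ford frozen_def)
    show "runs ?c s1 (10 + (?T + 40)) (\<lambda>s'. ?P (Suc i) (put ''i'' (Suc i) s'))"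
    proof (rule runs_Seq[where Q = "\<lambda>s'. s' ''e'' 0 = h i"])
      show "runs (Set ''e'' (Read ''li'' (Read ''tp'' (Sc ''i'')))) s1 10 (\<lambda>s'. s' ''e'' 0 = h i)"
        by (rule runs_loop_free) (use i fr1(2) frozen_cong(5)[OF fr1(1)] h(1) in simp_all)
    next
      fix s2 assume f2: "unchanged (writes (Set ''e'' (Read ''li'' (Read ''tp'' (Sc ''i''))))) s2 s1"
        and e: "s2 ''e'' 0 = h i"
      have fr2: "\<forall>x\<in>frozen. s2 x = s x" "s2 ''rm'' = s ''rm''" "s2 ''ok'' = s1 ''ok''"
        using f2 fr1 by (simp_all add: frozen_def)
      note fc = frozen_cong[OF fr2(1)]
      have pre: "ready k s2" "marked ?R s2" "?R \<subseteq> cand s2" "s2 ''e'' 0 \<in> cand s2"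
        using rd mk R hc fc(1,2) fr2(2) e by (simp_all add: marked_def)
      have T: "400 * (k + 1) * (s2 ''na'' 0 + s2 ''cn'' 0 + 1) = ?T" using fc(6,8) by simp
      show "runs (bellman_ford ;; ?d) s2 (?T + 40) (\<lambda>s'. ?P (Suc i) (put ''i'' (Suc i) s'))"
      proof (rule runs_Seq[OF runs_bellman_ford[OF pre, unfolded T e]])
        fix s3 assume f3: "unchanged (writes bellman_ford) s3 s2"
          and B: "s3 ''dd'' (v (h i)) \<le> k \<longleftrightarrow> ?ok (h i)"
        have "s3 ''kk'' 0 = k" "s3 ''in_v'' (h i) = v (h i)" "s3 ''e'' 0 = h i" "s3 ''ok'' = s1 ''ok''"
          using f3 e pre(1) hm fr2(3) by (simp_all add: writes_bellman_ford ready_def holds_graph_def)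
        note g = this
        show "runs ?d s3 40 (\<lambda>s'. ?P (Suc i) (put ''i'' (Suc i) s'))"
        proof (rule runs_loop_free)
          show "?P (Suc i) (put ''i'' (Suc i) (run ?d s3))"
          proof (cases "?ok (h i)")
            case True
            then have "\<not> k < s3 ''dd'' (v (h i))" using B by simp
            then have "run ?d s3 ''ok'' = s1 ''ok''" using g by simp
            moreover have "(\<forall>l<Suc i. ?ok (h l)) \<longleftrightarrow> (\<forall>l<i. ?ok (h l))" using True by (simp only: less_Suc_eq) blast
            ultimately show ?thesis using P by simp
          next
            case False
            then have "\<not> s3 ''dd'' (v (h i)) \<le> k" unfolding B .
            then have "k < s3 ''dd'' (v (h i))" by simp
            then have "run ?d s3 ''ok'' 0 = 0" using g by simp
            moreover have n: "\<not> (\<forall>l<Suc i. ?ok (h l))" using False by blast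
            ultimately show ?thesis unfolding if_not_P[OF n] by simp
          qed
        qed simp_all
      qed
    qed
  next
    fix s' assume P: "?P r s'"
    have "good k ?R \<longleftrightarrow> (\<forall>l<r. ?ok (h l))" using R cm unfolding good_def by auto
    then show "s' ''ok'' 0 = (if good k ?R then s ''ok'' 0 else 0)" using P by simp
  next
    show "(r + 1) * (10 + (?T + 40) + acost (Sc ''in_rho'') + 20) \<le> (r + 1) * (?T + 100)"
      by (rule mult_le_mono2) simp
  qed (use r in \<open>simp_all add: writes_bellman_ford\<close>)
qed

lemma runs_unmark_tuple:
  assumes r: "s ''in_rho'' 0 = r" and mk: "marked (h ` {..<r}) s"
    and h: "\<forall>l. s ''li'' (s ''tp'' l) = h l"
  shows "runs unmark_tuple s (50 * (r + 1)) (marked {})"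
  unfolding unmark_tuple_def
proof (rule runs_For[where P = "\<lambda>i. marked (h ` {..<r} - h ` {..<i})" and h = r and B = 20])
  let ?c = "Write ''rm'' (Read ''li'' (Read ''tp'' (Sc ''i''))) (Const 0)"
  fix i and s1 :: state
  assume i: "s1 ''i'' 0 = i" and P: "marked (h ` {..<r} - h ` {..<i}) s1"
    and f: "unchanged (insert ''i'' (writes ?c)) s1 s"
  have e: "s1 ''li'' (s1 ''tp'' i) = h i" using f h(1) by simp
  have ins: "h ` {..<Suc i} = insert (h i) (h ` {..<i})" by (simp add: lessThan_Suc)
  show "runs ?c s1 20 (\<lambda>s'. marked (h ` {..<r} - h ` {..<Suc i}) (put ''i'' (Suc i) s'))"
    unfolding ins by (rule runs_loop_free) (use P e i in \<open>simp_all add: marked_def\<close>)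
qed (use r mk in \<open>simp_all add: marked_def\<close>)

text \<open>While the search is undecided, all tuples of smaller value are known to be invalid.
  Nothing refers to the loop that is running, so a second loop can take over from the state in which
  the first one stopped.\<close>

definition searching :: "nat \<Rightarrow> nat \<Rightarrow> state \<Rightarrow> bool" where
  "searching k r s \<longleftrightarrow> ready k s \<and> s ''in_rho'' 0 = r \<and>
     (if s ''dn'' 0 = 0 then s ''fd'' 0 = 0 \<and> marked {} s \<and> (\<forall>i<r. s ''tp'' i < s ''cn'' 0) \<and>
        (\<forall>f. (\<forall>i<r. f i < s ''cn'' 0) \<longrightarrow> val (s ''cn'' 0) r f < val (s ''cn'' 0) r (s ''tp'') \<longrightarrow>
           \<not> valid k r (\<lambda>l. s ''li'' (f l)))
      else s ''dn'' 0 = 1 \<and>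
        (s ''fd'' 0 = 1 \<and> (\<exists>R \<subseteq> cand s. good k R \<and> card R = r \<and> marked R s) \<or>
         s ''fd'' 0 = 0 \<and> \<not> (\<exists>R \<subseteq> cand s. good k R \<and> card R = r)))"

text \<open>Any \<open>r\<close> candidates can be listed without repetition, and choosing a
  position in \<open>li\<close> for each of them gives a tuple that the enumeration meets.\<close>

lemma no_valid_no_good:
  fixes c :: nat and li :: "nat \<Rightarrow> nat"
  assumes "\<forall>f. (\<forall>i<r. f i < c) \<longrightarrow> \<not> valid k r (\<lambda>l. li (f l))"
  shows "\<not> (\<exists>R \<subseteq> li ` {..<c}. good k R \<and> card R = r)"
proof
  assume "\<exists>R \<subseteq> li ` {..<c}. good k R \<and> card R = r"
  then obtain R where R: "R \<subseteq> li ` {..<c}" "good k R" "card R = r" by blast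
  have "finite R" by (rule finite_subset[OF R(1)]) simp
  from ex_bij_betw_nat_finite[OF this] obtain h where h: "bij_betw h {..<r} R"
    unfolding R(3) lessThan_atLeast0 by blast
  have "\<forall>l\<in>{..<r}. \<exists>i. i < c \<and> li i = h l"
  proof
    fix l assume "l \<in> {..<r}"
    then have "h l \<in> R" using h by (auto simp: bij_betw_def)
    then have "h l \<in> li ` {..<c}" using R(1) by blast
    then show "\<exists>i. i < c \<and> li i = h l" by (metis imageE lessThan_iff)
  qed
  then have "\<exists>f. \<forall>l\<in>{..<r}. f l < c \<and> li (f l) = h l" by (rule bchoice)
  then obtain f where f: "\<forall>l\<in>{..<r}. f l < c \<and> li (f l) = h l" by blast
  have "(\<lambda>l. li (f l)) ` {..<r} = h ` {..<r}" using f by (intro image_cong) auto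
  then have "(\<lambda>l. li (f l)) ` {..<r} = R" using h by (simp add: bij_betw_def)
  moreover have "inj_on (\<lambda>l. li (f l)) {..<r}"
    using f h inj_on_cong[of "{..<r}" "\<lambda>l. li (f l)" h] by (simp add: bij_betw_def)
  ultimately have "valid k r (\<lambda>l. li (f l))" using R(2) by (simp add: valid_def)
  then show False using assms f by blast
qed

lemma runs_try_tuple:
  assumes S: "searching k r s" and dn: "s ''dn'' 0 = 0"
  shows "runs try_tuple s (step_time k r (s ''cn'' 0))
    (\<lambda>s'. searching k r s' \<and> (s' ''dn'' 0 = 0 \<longrightarrow>
       val (s ''cn'' 0) r (s' ''tp'') = val (s ''cn'' 0) r (s ''tp'') + 1))" (is "runs _ _ _ ?post")
proof -
  let ?c = "s ''cn'' 0"
  define h where "h = (\<lambda>l. s ''li'' (s ''tp'' l))"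
  let ?R = "h ` {..<r}"
  have rd: "ready k s" and r: "s ''in_rho'' 0 = r" using S unfolding searching_def by blast+
  have S0: "s ''fd'' 0 = 0" "marked {} s" "\<forall>i<r. s ''tp'' i < ?c"
    "\<forall>f. (\<forall>i<r. f i < ?c) \<longrightarrow> val ?c r f < val ?c r (s ''tp'') \<longrightarrow> \<not> valid k r (\<lambda>l. s ''li'' (f l))"
    using S dn unfolding searching_def by simp_all
  have hc: "\<forall>l<r. h l \<in> cand s" using S0(3) unfolding h_def cand_def by blast
  have cm: "cand s \<subseteq> {..<m}" using rd unfolding ready_def by blast
  have hm: "\<forall>l<r. h l < m" using hc cm by auto
  have Rc: "?R \<subseteq> cand s" using hc by auto
  have h0: "\<forall>l. s ''li'' (s ''tp'' l) = h l" by (simp add: h_def)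
  have na: "s ''na'' 0 \<le> 4 * (?c + 1) * (?c + 1)"
    using rd unfolding ready_def compressed_def by (elim conjE)
  have "runs try_tuple s (100 * (r + 1) + ((r + 1) * (400 * (k + 1) * (s ''na'' 0 + ?c + 1) + 100) +
      (20 + (50 * (r + 1) + 100 * (r + 1))))) ?post"
    unfolding try_tuple_def
  proof (rule runs_Seq[OF runs_mark_tuple[OF r S0(2) h0 hm]])
    fix s1 assume f1: "unchanged (writes mark_tuple) s1 s"
      and M: "marked ?R s1 \<and> s1 ''ok'' 0 = (if inj_on h {..<r} then 1 else 0)"
    have fr1: "\<forall>x\<in>frozen. s1 x = s x" "s1 ''tp'' = s ''tp''" "s1 ''in_rho'' = s ''in_rho''"
      "s1 ''fd'' = s ''fd''" "s1 ''dn'' = s ''dn''"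
      using f1 by (simp_all add: mark_tuple_def frozen_def)
    note fc = frozen_cong[OF fr1(1)]
    have pre: "ready k s1" "s1 ''in_rho'' 0 = r" "marked ?R s1" "\<forall>l. s1 ''li'' (s1 ''tp'' l) = h l"
      "\<forall>l<r. h l \<in> cand s1"
      using rd r M h0 hc fc(1,2,5) fr1(2,3) by simp_all
    have T: "400 * (k + 1) * (s1 ''na'' 0 + s1 ''cn'' 0 + 1) = 400 * (k + 1) * (s ''na'' 0 + ?c + 1)"
      using fc(6,8) by simp
    let ?d = "Cond (Equal (Sc ''ok'') (Const 1)) (Set ''fd'' (Const 1) ;; Set ''dn'' (Const 1)) (unmark_tuple ;; advance)"
    show "runs (verify ;; ?d) s1 ((r + 1) * (400 * (k + 1) * (s ''na'' 0 + ?c + 1) + 100) +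
      (20 + (50 * (r + 1) + 100 * (r + 1)))) ?post"
    proof (rule runs_Seq[OF runs_verify[OF pre, unfolded T]])
      fix s2 assume f2: "unchanged (writes verify) s2 s1"
        and V: "s2 ''ok'' 0 = (if good k ?R then s1 ''ok'' 0 else 0)"
      have ok: "s2 ''ok'' 0 = 1 \<longleftrightarrow> valid k r h" using V M unfolding valid_def by simp
      have fr2: "\<forall>x\<in>frozen. s2 x = s x" "s2 ''tp'' = s ''tp''" "s2 ''in_rho'' 0 = r"
        "s2 ''fd'' 0 = 0" "s2 ''dn'' 0 = 0" "s2 ''rm'' = s1 ''rm''"
        using f2 fr1 r S0(1) dn by (simp_all add: verify_def writes_bellman_ford frozen_def)
      note fc2 = frozen_cong[OF fr2(1)]
      have mk2: "marked ?R s2" using M fr2(6) by (simp add: marked_def)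
      show "runs ?d s2 (20 + (50 * (r + 1) + 100 * (r + 1))) ?post"
      proof (rule runs_conseq[OF runs_Cond[where T = "10 + (50 * (r + 1) + 100 * (r + 1))"]])
        assume "bval (Equal (Sc ''ok'') (Const 1)) s2"
        then have v: "valid k r h" using ok by simp
        let ?e = "Set ''fd'' (Const 1) ;; Set ''dn'' (Const 1)"
        show "runs ?e s2 (10 + (50 * (r + 1) + 100 * (r + 1))) ?post"
        proof (rule runs_loop_free)
          let ?s = "run ?e s2"
          have frs: "\<forall>x\<in>frozen. ?s x = s x" using fr2(1) by (simp add: frozen_def)
          note fcs = frozen_cong[OF frs]
          have g: "?s ''dn'' 0 = 1" "?s ''fd'' 0 = 1" "?s ''rm'' = s2 ''rm''" "?s ''in_rho'' 0 = r"
            using fr2(3) by simp_all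
          have "card ?R = r" using v by (simp add: valid_def card_image)
          moreover have "good k ?R" using v by (simp add: valid_def)
          moreover have "marked ?R ?s" using mk2 g(3) by (simp add: marked_def)
          ultimately have "\<exists>R \<subseteq> cand ?s. good k R \<and> card R = r \<and> marked R ?s"
            using Rc unfolding fcs(2) by blast
          moreover have "ready k ?s" using rd unfolding fcs(1) .
          ultimately show "?post ?s" unfolding searching_def using g(1,2,4) by simp
        qed simp_all
      next
        assume "\<not> bval (Equal (Sc ''ok'') (Const 1)) s2"
        then have nv: "\<not> valid k r h" using ok by simp
        have h2: "\<forall>l. s2 ''li'' (s2 ''tp'' l) = h l" using h0 fc2(5) fr2(2) by simp
        have "runs (unmark_tuple ;; advance) s2 (50 * (r + 1) + 100 * (r + 1)) ?post"
        proof (rule runs_Seq[OF runs_unmark_tuple[OF fr2(3) mk2 h2]])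
          fix s3 assume f3: "unchanged (writes unmark_tuple) s3 s2" and mk3: "marked {} s3"
          have fr3: "\<forall>x\<in>frozen. s3 x = s x" "s3 ''tp'' = s ''tp''" "s3 ''in_rho'' 0 = r"
            "s3 ''fd'' 0 = 0" "s3 ''dn'' 0 = 0"
            using f3 fr2 by (simp_all add: unmark_tuple_def frozen_def)
          have c3: "s3 ''cn'' 0 = ?c" using frozen_cong(6)[OF fr3(1)] by simp
          have tp3: "\<forall>i<r. s3 ''tp'' i < ?c" using S0(3) fr3(2) by simp
          show "runs advance s3 (100 * (r + 1)) ?post"
          proof (rule runs_conseq[OF runs_advance[OF fr3(3) c3 tp3] order_refl])
            fix s4 assume f4: "unchanged (writes advance) s4 s3"
              and A: "s4 ''dn'' 0 = 1 \<and> val ?c r (s3 ''tp'') + 1 = ?c ^ r \<or>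
                s4 ''dn'' = s3 ''dn'' \<and> val ?c r (s4 ''tp'') = val ?c r (s3 ''tp'') + 1 \<and> (\<forall>i<r. s4 ''tp'' i < ?c)"
            have fr4: "\<forall>x\<in>frozen. s4 x = s x" "s4 ''in_rho'' 0 = r" "s4 ''fd'' 0 = 0" "s4 ''rm'' = s3 ''rm''"
              using f4 fr3 by (simp_all add: advance_def frozen_def)
            note fc4 = frozen_cong[OF fr4(1)]
            have rd4: "ready k s4" using rd unfolding fc4(1) .
            have mk4: "marked {} s4" using mk3 fr4(4) by (simp add: marked_def)
            \<comment> \<open>By injectivity of \<open>val\<close>, the tuple just rejected is the
              only one that is added when the bound on the value is raised by 1.\<close>
            have ex: "\<not> valid k r (\<lambda>l. s ''li'' (f l))"
              if f: "\<forall>i<r. f i < ?c" "val ?c r f < val ?c r (s ''tp'') + 1" for f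
            proof (cases "val ?c r f < val ?c r (s ''tp'')")
              case True
              then show ?thesis using S0(4) f(1) by blast
            next
              case False
              then have "\<forall>i<r. f i = s ''tp'' i" using val_inj[OF f(1) S0(3)] f(2) by simp
              then have eq: "\<forall>l\<in>{..<r}. s ''li'' (f l) = h l" by (simp add: h_def)
              then have "(\<lambda>l. s ''li'' (f l)) ` {..<r} = ?R" by (intro image_cong) auto
              moreover have "inj_on (\<lambda>l. s ''li'' (f l)) {..<r} \<longleftrightarrow> inj_on h {..<r}"
                using eq by (intro inj_on_cong) auto
              ultimately show ?thesis using nv by (simp add: valid_def)
            qed
            show "?post s4" using A
            proof
              assume A1: "s4 ''dn'' 0 = 1 \<and> val ?c r (s3 ''tp'') + 1 = ?c ^ r"
              \<comment> \<open>The overflow means that the current value is maximal, so every tuple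
                falls under the raised bound.\<close>
              have "\<forall>f. (\<forall>i<r. f i < ?c) \<longrightarrow> \<not> valid k r (\<lambda>l. s ''li'' (f l))"
                using ex val_less A1 fr3(2) by simp
              then have "\<not> (\<exists>R \<subseteq> s ''li'' ` {..<?c}. good k R \<and> card R = r)" by (rule no_valid_no_good)
              then have "\<not> (\<exists>R \<subseteq> cand s4. good k R \<and> card R = r)" unfolding fc4(2) unfolding cand_def .
              then show ?thesis unfolding searching_def using A1 rd4 fr4(2,3) by simp
            next
              assume A2: "s4 ''dn'' = s3 ''dn'' \<and> val ?c r (s4 ''tp'') = val ?c r (s3 ''tp'') + 1 \<and> (\<forall>i<r. s4 ''tp'' i < ?c)"
              have d4: "s4 ''dn'' 0 = 0" "val ?c r (s4 ''tp'') = val ?c r (s ''tp'') + 1" "\<forall>i<r. s4 ''tp'' i < ?c"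
                using A2 fr3(2,5) by simp_all
              have "\<forall>f. (\<forall>i<r. f i < ?c) \<longrightarrow> val ?c r f < val ?c r (s4 ''tp'') \<longrightarrow> \<not> valid k r (\<lambda>l. s ''li'' (f l))"
                unfolding d4(2) using ex by blast
              then show ?thesis unfolding searching_def fc4(5,6) using d4 rd4 mk4 fr4(2,3) by simp
            qed
          qed
        qed
        then show "runs (unmark_tuple ;; advance) s2 (10 + (50 * (r + 1) + 100 * (r + 1))) ?post"
          by (rule runs_conseq) simp_all
      qed simp_all
    qed
  qed
  then show ?thesis using step_time_bound[OF na] by (rule runs_conseq) assumption
qed

end

section \<open>The kernelization and the solver\<close>

text \<open>The final test answers no if there are fewer candidates than removals. It also protects
  the running time: from then on \<rho> is at most |N|, although \<rho> itself may be exponential in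
  its encoding.\<close>

definition prep :: com where
  "prep = compute_k ;; build_arcs ;; mark_nontriv ;; compute_bound ;; collect ;; compress ;;
     Cond (Less (Sc ''cn'') (Sc ''in_rho'')) (Set ''dn'' (Const 1)) Skip"

definition capped_search :: com where
  "capped_search = Set ''st'' (Const 0) ;;
     Loop (Conj (Equal (Sc ''dn'') (Const 0)) (Less (Sc ''st'') (Sc ''in_n'')))
       (try_tuple ;; Set ''st'' (Plus (Sc ''st'') (Const 1)))"

definition emit_kernel :: com where
  "emit_kernel =
     Cond (Equal (Sc ''dn'') (Const 1))
       (Set ''ker_n'' (Const 1) ;; Set ''ker_m'' (Const 0) ;; Set ''ker_numer'' (Const 1) ;;
        Set ''ker_denom'' (Const 1) ;; Set ''ker_rho'' (Minus (Const 1) (Sc ''fd'')))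
       (Set ''ker_n'' (Sc ''in_n'') ;; Set ''ker_m'' (Sc ''in_m'') ;; Set ''ker_numer'' (Sc ''in_numer'') ;;
        Set ''ker_denom'' (Sc ''in_denom'') ;; Set ''ker_rho'' (Sc ''in_rho'')) ;;
     For ''i'' (Sc ''ker_m'')
       (Write ''ker_u'' (Sc ''i'') (Read ''in_u'' (Sc ''i'')) ;;
        Write ''ker_v'' (Sc ''i'') (Read ''in_v'' (Sc ''i'')))"

definition full_search :: com where
  "full_search = Loop (Equal (Sc ''dn'') (Const 0)) try_tuple"

definition kernel_com :: com where
  "kernel_com = prep ;; capped_search ;; emit_kernel"

definition emit_answer :: "string \<Rightarrow> com" where
  "emit_answer p = Set (p @ ''answer'') (Sc ''fd'') ;;
     For ''i'' (Sc (p @ ''m'')) (Write (p @ ''keep'') (Sc ''i'') (Minus (Const 1) (Read ''rm'' (Sc ''i''))))"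

definition solve_com :: com where
  "solve_com = full_search ;; emit_answer ''ker_''"

text \<open>One vertex and no edges: a yes-instance exactly for \<rho> = 0, so both answers can be
  encoded, with \<open>1 - fd\<close> as the number of removals.\<close>

definition trivial_inst :: "nat \<Rightarrow> inst" where
  "trivial_inst \<rho> = \<lparr>nverts = 1, elist = [], stretch = 1, removals = \<rho>\<rparr>"

lemma quotient_of_1: "numer 1 = 1" "denom 1 = 1"
  by (simp_all add: numer_def denom_def)

lemma basic_trivial_inst: "basic_instance (trivial_inst \<rho>)"
proof -
  have "simple_path {0} {} 0 [0] 0" by (simp add: simple_path_def)
  then have "connected_graph (verts (trivial_inst \<rho>)) (edges (trivial_inst \<rho>))"
    unfolding connected_graph_def by (auto simp: trivial_inst_def verts_def edges_def nedges_def lessThan_Suc)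
  then show ?thesis by (simp add: basic_instance_def trivial_inst_def nedges_def)
qed

lemma solution_trivial_inst: "solution (trivial_inst \<rho>) F \<longleftrightarrow> \<rho> = 0 \<and> F = {}"
proof -
  have "edges (trivial_inst \<rho>) = {}" by (simp add: trivial_inst_def edges_def nedges_def)
  then have e: "edges (trivial_inst \<rho>) = {}" "nontrivial_edges l V {} a = {}" for l V a
    by (simp_all add: nontrivial_edges_def)
  have sp: "spanner unit_length V {} 1 {}" for V :: "nat set"
    unfolding spanner_def by simp
  have "stretch (trivial_inst \<rho>) = 1" "removals (trivial_inst \<rho>) = \<rho>" by (simp_all add: trivial_inst_def)
  then show ?thesis unfolding solution_def e using sp by auto
qed

lemma yes_trivial_inst: "yes_instance (trivial_inst \<rho>) \<longleftrightarrow> \<rho> = 0"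
  by (simp add: yes_instance_def solution_trivial_inst)

text \<open>A kernel solver must cope with every basic instance that the memory represents; this
  shows that there is only one. The stretch factor is recovered as the quotient of its two stored
  parts.\<close>

lemma holds_inst_unique:
  assumes "holds_inst p I s" "holds_inst p J s" "basic_instance I" "basic_instance J"
  shows "I = J"
proof -
  interpret A: basic_inst I by unfold_locales (rule assms(3))
  interpret B: basic_inst J by unfold_locales (rule assms(4))
  have n: "nverts I = nverts J" "nedges I = nedges J" "removals I = removals J"
    "numer (stretch I) = numer (stretch J)" "denom (stretch I) = denom (stretch J)"
    using assms(1,2) by (simp_all add: holds_inst_def)
  have "elist I = elist J"
    using assms(1,2) n(2) by (intro nth_equalityI) (auto simp: holds_inst_def nedges_def)
  moreover have "stretch I = stretch J"
    using A.stretch_eq B.stretch_eq n(4,5) by (metis of_rat_eq_iff)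
  ultimately show ?thesis using n by simp
qed

lemma runs_emit_answer:
  assumes p: "p = ''ker_'' \<or> p = ''in_''"
  shows "runs (emit_answer p) s (100 * (s (p @ ''m'') 0 + 1)) (\<lambda>s'. s' (p @ ''answer'') 0 = s ''fd'' 0 \<and>
     (\<forall>i<s (p @ ''m'') 0. s' (p @ ''keep'') i = 1 - s ''rm'' i))"
proof -
  let ?h = "s (p @ ''m'') 0"
  let ?c = "Write (p @ ''keep'') (Sc ''i'') (Minus (Const 1) (Read ''rm'' (Sc ''i'')))"
  let ?P = "\<lambda>i s'::state. s' (p @ ''answer'') 0 = s ''fd'' 0 \<and> (\<forall>l<i. s' (p @ ''keep'') l = 1 - s ''rm'' l)"
  have "runs (emit_answer p) s (10 + (?h + 1) * 50) (?P ?h)" unfolding emit_answer_def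
  proof (rule runs_Seq[where Q = "?P 0"])
    show "runs (Set (p @ ''answer'') (Sc ''fd'')) s 10 (?P 0)" by (rule runs_loop_free) simp_all
  next
    fix s1 assume f1: "unchanged (writes (Set (p @ ''answer'') (Sc ''fd''))) s1 s" and P1: "?P 0 s1"
    show "runs (For ''i'' (Sc (p @ ''m'')) ?c) s1 ((?h + 1) * 50) (?P ?h)"
    proof (rule runs_For[where P = ?P and h = ?h and B = 20])
      fix i and s2 :: state
      assume i: "s2 ''i'' 0 = i" and P: "?P i s2" and f2: "unchanged (insert ''i'' (writes ?c)) s2 s1"
      have rm: "s2 ''rm'' = s ''rm''" using p f1 f2 by (elim disjE) simp_all
      have a: "put ''i'' (Suc i) (run ?c s2) (p @ ''answer'') = s2 (p @ ''answer'')"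
        using p by (elim disjE) simp_all
      have k: "put ''i'' (Suc i) (run ?c s2) (p @ ''keep'') = (s2 (p @ ''keep''))(i := 1 - s ''rm'' i)"
        using p i rm by (elim disjE) (simp_all add: fun_eq_iff)
      show "runs ?c s2 20 (\<lambda>s'. ?P (Suc i) (put ''i'' (Suc i) s'))"
      proof (rule runs_loop_free)
        show "?P (Suc i) (put ''i'' (Suc i) (run ?c s2))" unfolding a k using P by (simp add: less_Suc_eq)
      qed simp_all
    next
      fix s' :: state assume f2: "unchanged (insert ''i'' (writes ?c)) s' s1"
      show "aval (Sc (p @ ''m'')) s' = ?h" using p f1 f2 by (elim disjE) simp_all
    next
      show "?P 0 (put ''i'' 0 s1)" using p P1 by (elim disjE) simp_all
    next
      show "''i'' \<notin> writes ?c" using p by (elim disjE) simp_all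
    qed simp_all
  qed
  then show ?thesis by (rule runs_conseq) simp_all
qed

lemma writes_prep_parts:
  "writes compute_k = {''kk'', ''ac''}" "writes build_arcs = {''i'', ''j'', ''as'', ''at'', ''ae'', ''nx'', ''hd''}"
  "writes mark_nontriv = {''sn'', ''ds'', ''br'', ''q'', ''qh'', ''qt'', ''p'', ''y'', ''j'', ''z'', ''x'', ''s'', ''i'', ''nt''}"
  "writes compute_bound = {''bd'', ''c''}" "writes collect = {''cn'', ''i'', ''li'', ''wv'', ''ban''}"
  "writes compress = {''sn'', ''ds'', ''br'', ''q'', ''qh'', ''qt'', ''p'', ''y'', ''j'', ''z'', ''x'', ''s'', ''a'', ''b'', ''e'',
     ''na'', ''fA'', ''fB'', ''fW'', ''fT''}"
  "writes try_tuple = {''ok'', ''i'', ''e'', ''rm'', ''b'', ''dd'', ''r'', ''j'', ''fd'', ''dn'', ''tp''}"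
  by (auto simp: compute_k_def build_arcs_def mark_nontriv_def mark_pair_def writes_bfs compute_bound_def
      collect_def collect_step_def compress_def push_pair_def push_edge_def push_arc_def
      try_tuple_def mark_tuple_def verify_def unmark_tuple_def advance_def writes_bellman_ford)

lemma step_time_mono: "r \<le> r' \<Longrightarrow> k \<le> k' \<Longrightarrow> c \<le> c' \<Longrightarrow> step_time k r c \<le> step_time k' r' c'"
  unfolding step_time_def by (intro mult_le_mono2 mult_le_mono) simp_all

context graph begin

lemma searching_cong:
  assumes "\<forall>x\<in>frozen. s' x = s x"
    "s' ''in_rho'' = s ''in_rho''" "s' ''dn'' = s ''dn''" "s' ''fd'' = s ''fd''" "s' ''rm'' = s ''rm''" "s' ''tp'' = s ''tp''"
  shows "searching k r s' \<longleftrightarrow> searching k r s"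
  unfolding searching_def marked_def frozen_cong[OF assms(1)] assms(2-6) ..

end

section \<open>Correctness of the kernelization on a basic instance\<close>

context basic_inst begin

abbreviation "\<rho> \<equiv> removals I"

definition cmax :: nat where
  "cmax = min (nedges I) (\<rho> * (2 * kk + 1))"

text \<open>What both search loops preserve: the state of the enumeration, the size of
  \<open>N\<close>, and the equivalence that reduces the question to subsets of
  \<open>N\<close>.\<close>

definition base :: "state \<Rightarrow> bool" where
  "base s \<longleftrightarrow> searching kk \<rho> s \<and> s ''cn'' 0 \<le> cmax \<and> (s ''dn'' 0 = 0 \<longrightarrow> \<rho> \<le> s ''cn'' 0) \<and>
     (yes_instance I \<longleftrightarrow> (\<exists>R \<subseteq> cand s. good kk R \<and> card R = \<rho>))"

lemma base_cong:
  assumes "\<forall>x\<in>frozen. s' x = s x"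
    "s' ''in_rho'' = s ''in_rho''" "s' ''dn'' = s ''dn''" "s' ''fd'' = s ''fd''" "s' ''rm'' = s ''rm''" "s' ''tp'' = s ''tp''"
  shows "base s' \<longleftrightarrow> base s"
  unfolding base_def searching_cong[OF assms] frozen_cong[OF assms(1)] assms(3) ..

definition prep_time :: nat where
  "prep_time = 100 * (nverts I + 1) + (500 * (nedges I + 1) +
     (4000 * (nverts I + 1) * (nverts I + nedges I + 1) + (100 * (nedges I + 1) + (200 * (nedges I + 1) +
     (4000 * (cmax + 1) * (nverts I + nedges I + cmax + 1) + 20)))))"

lemma input_state_simps:
  "input_state I ''in_n'' 0 = nverts I" "input_state I ''in_m'' 0 = nedges I" "input_state I ''in_rho'' 0 = \<rho>"
  "input_state I ''in_numer'' 0 = numer (stretch I)" "input_state I ''in_denom'' 0 = denom (stretch I)"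
  "holds_graph (input_state I)"
  "input_state I ''hd'' = (\<lambda>_. 0)" "input_state I ''ban'' = (\<lambda>_. 0)" "input_state I ''nt'' = (\<lambda>_. 0)"
  "input_state I ''rm'' = (\<lambda>_. 0)" "input_state I ''tp'' = (\<lambda>_. 0)" "input_state I ''fd'' = (\<lambda>_. 0)"
  "input_state I ''dn'' = (\<lambda>_. 0)"
  by (simp_all add: input_state_def params_state_def holds_graph_def)

lemma runs_prep:
  "runs prep (input_state I) prep_time (\<lambda>s. base s \<and> (s ''dn'' 0 = 0 \<longrightarrow> val (s ''cn'' 0) \<rho> (s ''tp'') = 0))"
  (is "runs _ _ _ ?post")
proof -
  let ?s = "input_state I" and ?n = "nverts I" and ?m = "nedges I"
  note st = input_state_simps
  have D: "0 < ?s ''in_denom'' 0" "?s ''in_denom'' 0 \<le> ?s ''in_numer'' 0"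
    unfolding st using denom_pos denom_le_numer .
  show ?thesis unfolding prep_def prep_time_def
  proof (rule runs_Seq[OF runs_compute_k[of ?s, OF D, unfolded st, folded kk_def]])
    fix s1 assume "unchanged (writes compute_k) s1 ?s" and k1: "s1 ''kk'' 0 = kk"
    then have f1: "unchanged {''kk'', ''ac''} s1 ?s" unfolding writes_prep_parts by blast
    have z1: "s1 ''fd'' 0 = 0" "s1 ''dn'' 0 = 0" "s1 ''rm'' = (\<lambda>_. 0)" "s1 ''tp'' = (\<lambda>_. 0)"
        "s1 ''in_rho'' 0 = \<rho>" "s1 ''kk'' 0 = kk"
        using k1 st(3,10-13) f1 by simp_all
    have G1: "holds_graph s1" "\<forall>x. s1 ''hd'' x = 0" using f1 st by (simp_all add: holds_graph_def)
    show "runs (build_arcs ;; mark_nontriv ;; compute_bound ;; collect ;; compress ;;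
        Cond (Less (Sc ''cn'') (Sc ''in_rho'')) (Set ''dn'' (Const 1)) Skip) s1 (500 * (?m + 1) +
     (4000 * (?n + 1) * (?n + ?m + 1) + (100 * (?m + 1) + (200 * (?m + 1) +
     (4000 * (cmax + 1) * (?n + ?m + cmax + 1) + 20))))) ?post"
    proof (rule runs_Seq[OF runs_build_arcs[OF G1]])
      fix s2 assume "unchanged (writes build_arcs) s2 s1" and A2: "holds_arcs s2"
      then have f2: "unchanged {''i'', ''j'', ''as'', ''at'', ''ae'', ''nx'', ''hd''} s2 s1"
        unfolding writes_prep_parts by blast
      have z2: "s2 ''fd'' 0 = 0" "s2 ''dn'' 0 = 0" "s2 ''rm'' = (\<lambda>_. 0)" "s2 ''tp'' = (\<lambda>_. 0)"
        "s2 ''in_rho'' 0 = \<rho>" "s2 ''kk'' 0 = kk"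
        using z1 f2 by simp_all
      have b2: "\<forall>i. s2 ''ban'' i = 0" "\<forall>i. s2 ''nt'' i = 0" using f1 f2 st(8,9) by simp_all
      show "runs (mark_nontriv ;; compute_bound ;; collect ;; compress ;;
        Cond (Less (Sc ''cn'') (Sc ''in_rho'')) (Set ''dn'' (Const 1)) Skip) s2
        (4000 * (?n + 1) * (?n + ?m + 1) + (100 * (?m + 1) + (200 * (?m + 1) +
        (4000 * (cmax + 1) * (?n + ?m + cmax + 1) + 20)))) ?post"
      proof (rule runs_Seq[OF runs_mark_nontriv[OF A2 b2 connected_walk, unfolded z2(6)]])
        fix s3 assume "unchanged (writes mark_nontriv) s3 s2"
          and nt: "\<forall>e<?m. s3 ''nt'' e = 1 \<longleftrightarrow> nontriv kk e"
        then have f3: "unchanged {''sn'', ''ds'', ''br'', ''q'', ''qh'', ''qt'', ''p'', ''y'', ''j'', ''z'', ''x'', ''s'', ''i'', ''nt''} s3 s2"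
          unfolding writes_prep_parts by blast
        have z3: "s3 ''fd'' 0 = 0" "s3 ''dn'' 0 = 0" "s3 ''rm'' = (\<lambda>_. 0)" "s3 ''tp'' = (\<lambda>_. 0)"
        "s3 ''in_rho'' 0 = \<rho>" "s3 ''kk'' 0 = kk"
        using z2 f3 by simp_all
        have g3: "s3 ''in_m'' 0 = ?m" "s3 ''in_rho'' 0 = \<rho>" "s3 ''kk'' 0 = kk" "\<forall>i. s3 ''ban'' i = 0" "holds_arcs s3"
          using z3(5,6) b2(1) f3 A2 by (simp_all add: holds_arcs_def holds_graph_def)
        show "runs (compute_bound ;; collect ;; compress ;;
          Cond (Less (Sc ''cn'') (Sc ''in_rho'')) (Set ''dn'' (Const 1)) Skip) s3
          (100 * (?m + 1) + (200 * (?m + 1) + (4000 * (cmax + 1) * (?n + ?m + cmax + 1) + 20))) ?post"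
        proof (rule runs_Seq[OF runs_compute_bound[of s3, unfolded g3(1-3)]])
          fix s4 assume "unchanged (writes compute_bound) s4 s3"
            and bd: "s4 ''bd'' 0 \<le> \<rho> * (2 * kk + 1) \<and> (s4 ''bd'' 0 = \<rho> * (2 * kk + 1) \<or> ?m \<le> s4 ''bd'' 0)"
          then have f4: "unchanged {''bd'', ''c''} s4 s3" unfolding writes_prep_parts by blast
          have z4: "s4 ''fd'' 0 = 0" "s4 ''dn'' 0 = 0" "s4 ''rm'' = (\<lambda>_. 0)" "s4 ''tp'' = (\<lambda>_. 0)"
        "s4 ''in_rho'' 0 = \<rho>" "s4 ''kk'' 0 = kk"
        using z3 f4 by simp_all
          have G4: "holds_graph s4" "\<forall>i. s4 ''ban'' i = 0" "\<forall>e<?m. s4 ''nt'' e = 1 \<longleftrightarrow> nontriv kk e"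
            using f4 g3(4,5) nt by (simp_all add: holds_arcs_def holds_graph_def)
          show "runs (collect ;; compress ;;
            Cond (Less (Sc ''cn'') (Sc ''in_rho'')) (Set ''dn'' (Const 1)) Skip) s4
            (200 * (?m + 1) + (4000 * (cmax + 1) * (?n + ?m + cmax + 1) + 20)) ?post"
          proof (rule runs_Seq[OF runs_collect[OF G4 conjunct1[OF bd] conjunct2[OF bd]]])
            fix s5 assume "unchanged (writes collect) s5 s4" and C5: "collected kk \<rho> s5"
            then have f5: "unchanged {''cn'', ''i'', ''li'', ''wv'', ''ban''} s5 s4"
              unfolding writes_prep_parts by blast
            have z5: "s5 ''fd'' 0 = 0" "s5 ''dn'' 0 = 0" "s5 ''rm'' = (\<lambda>_. 0)" "s5 ''tp'' = (\<lambda>_. 0)"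
        "s5 ''in_rho'' 0 = \<rho>" "s5 ''kk'' 0 = kk"
        using z4 f5 by simp_all
            have A5: "holds_arcs s5" using f4 f5 g3(5) by (simp add: holds_arcs_def holds_graph_def)
            have cN: "\<forall>e\<in>cand s5. nontriv kk e" "inj_on (s5 ''li'') {..<s5 ''cn'' 0}"
              "cand s5 = {e. nontriv kk e} \<or> s5 ''cn'' 0 = \<rho> * (2 * kk + 1)" "s5 ''cn'' 0 \<le> \<rho> * (2 * kk + 1)"
              "wset s5 = src ` cand s5 \<union> tgt ` cand s5"
              using C5 unfolding collected_def by blast+
            have cm: "cand s5 \<subseteq> {..<?m}" using cN(1) by (auto simp: nontriv_def)
            have card: "card (cand s5) = s5 ''cn'' 0" unfolding cand_def using cN(2) by (simp add: card_image)
            then have "s5 ''cn'' 0 \<le> ?m" using card_mono[OF _ cm] by simp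
            then have cmax: "s5 ''cn'' 0 \<le> cmax" using cN(4) by (simp add: cmax_def)
            have yes: "yes_instance I \<longleftrightarrow> (\<exists>R \<subseteq> cand s5. good kk R \<and> card R = \<rho>)"
              using yes_iff_good[OF cN(1)] cN(3) unfolding card by auto
            show "runs (compress ;; Cond (Less (Sc ''cn'') (Sc ''in_rho'')) (Set ''dn'' (Const 1)) Skip) s5
              (4000 * (cmax + 1) * (?n + ?m + cmax + 1) + 20) ?post"
            proof (rule runs_Seq[where Q = compressed])
              have "(s5 ''cn'' 0 + 1) * (?n + ?m + s5 ''cn'' 0 + 1) \<le> (cmax + 1) * (?n + ?m + cmax + 1)"
                using cmax by (intro mult_le_mono) simp_all
              then have "4000 * (s5 ''cn'' 0 + 1) * (?n + ?m + s5 ''cn'' 0 + 1) \<le> 4000 * (cmax + 1) * (?n + ?m + cmax + 1)"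
                unfolding mult.assoc by (rule mult_le_mono2)
              then show "runs compress s5 (4000 * (cmax + 1) * (?n + ?m + cmax + 1)) compressed"
                by (rule runs_conseq[OF runs_compress[OF A5 C5]])
            next
              fix s6 assume "unchanged (writes compress) s6 s5" and C6: "compressed s6"
              then have f6: "unchanged {''sn'', ''ds'', ''br'', ''q'', ''qh'', ''qt'', ''p'', ''y'', ''j'', ''z'', ''x'', ''s'', ''a'', ''b'', ''e'',
                ''na'', ''fA'', ''fB'', ''fW'', ''fT''} s6 s5" unfolding writes_prep_parts by blast
              have z6: "s6 ''fd'' 0 = 0" "s6 ''dn'' 0 = 0" "s6 ''rm'' = (\<lambda>_. 0)" "s6 ''tp'' = (\<lambda>_. 0)"
        "s6 ''in_rho'' 0 = \<rho>" "s6 ''kk'' 0 = kk"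
        using z5 f6 by simp_all
              have g6: "s6 ''li'' = s5 ''li''" "s6 ''cn'' = s5 ''cn''" "s6 ''wv'' = s5 ''wv''" "s6 ''kk'' 0 = kk"
                "s6 ''in_rho'' 0 = \<rho>" "s6 ''fd'' 0 = 0" "s6 ''dn'' 0 = 0" "\<forall>i. s6 ''rm'' i = 0" "\<forall>i. s6 ''tp'' i = 0"
                using f6 z6 by simp_all
              have G6: "holds_graph s6" using f6 A5 by (simp add: holds_arcs_def holds_graph_def)
              have c6: "cand s6 = cand s5" "wset s6 = wset s5" unfolding cand_def wset_def g6 by simp_all
              have rd: "ready kk s6" unfolding ready_def c6 using g6(1-4) G6 C6 cm cN(2,5) by simp
              let ?d = "Cond (Less (Sc ''cn'') (Sc ''in_rho'')) (Set ''dn'' (Const 1)) Skip"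
              show "runs ?d s6 20 ?post"
              proof (rule runs_loop_free)
                show "?post (run ?d s6)"
                proof (cases "s5 ''cn'' 0 < \<rho>")
                  case True
                  let ?t = "run ?d s6"
                  have t: "?t = s6(''dn'' := (s6 ''dn'')(0 := 1))" using True g6 by simp
                  have fr: "\<forall>x\<in>frozen. ?t x = s6 x" unfolding t by (simp add: frozen_def)
                  note fc = frozen_cong[OF fr]
                  have g: "?t ''dn'' 0 = 1" "?t ''fd'' 0 = 0" "?t ''in_rho'' 0 = \<rho>" unfolding t using g6 by simp_all
                  have "\<not> (\<exists>R \<subseteq> cand s5. good kk R \<and> card R = \<rho>)"
                  proof
                    assume "\<exists>R \<subseteq> cand s5. good kk R \<and> card R = \<rho>"
                    then obtain R where R: "R \<subseteq> cand s5" "card R = \<rho>" by blast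
                    have "card R \<le> card (cand s5)" using R(1) by (rule card_mono[rotated]) (simp add: cand_def)
                    then show False using True R(2) card by simp
                  qed
                  then have "searching kk \<rho> ?t" unfolding searching_def fc(1,2) c6 using rd g by simp
                  then show ?thesis unfolding base_def fc(2,6) c6 g6(2) using yes cmax g(1) by simp
                next
                  case False
                  have t: "run ?d s6 = s6" using False g6 by simp
                  have v0: "val (s6 ''cn'' 0) \<rho> (s6 ''tp'') = 0" using g6(9) by (simp add: val_def)
                  have "\<forall>i<\<rho>. s6 ''tp'' i < s6 ''cn'' 0" using False g6(2,9) by auto
                  then have "searching kk \<rho> s6" unfolding searching_def marked_def v0 using rd g6 by simp
                  then show ?thesis unfolding t base_def c6 using yes cmax False v0 g6(2) by simp
                qed
              qed simp_all
            qed
          qed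
        qed
      qed
    qed
  qed
qed

text \<open>During the search \<rho> \<le> |N|, so \<rho> may be replaced by
  \<open>min \<rho> cmax\<close>; this makes the cost of a step polynomial in the size of the
  graph.\<close>

definition loop_time :: nat where
  "loop_time = step_time kk (min \<rho> cmax) cmax + 50"

lemma runs_base_step:
  assumes b: "base s" and dn: "s ''dn'' 0 = 0"
  shows "runs try_tuple s (step_time kk (min \<rho> cmax) cmax) (\<lambda>s'. base s' \<and> s' ''cn'' = s ''cn'' \<and>
     (s' ''dn'' 0 = 0 \<longrightarrow> val (s ''cn'' 0) \<rho> (s' ''tp'') = val (s ''cn'' 0) \<rho> (s ''tp'') + 1))"
proof -
  have S: "searching kk \<rho> s" "s ''cn'' 0 \<le> cmax" "\<rho> \<le> s ''cn'' 0"
    "yes_instance I \<longleftrightarrow> (\<exists>R \<subseteq> cand s. good kk R \<and> card R = \<rho>)"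
    using b dn unfolding base_def by blast+
  have T: "step_time kk \<rho> (s ''cn'' 0) \<le> step_time kk (min \<rho> cmax) cmax"
    using S(2,3) by (intro step_time_mono) simp_all
  show ?thesis
  proof (rule runs_conseq[OF runs_try_tuple[OF S(1) dn] T])
    fix s' assume f: "unchanged (writes try_tuple) s' s"
      and P: "searching kk \<rho> s' \<and> (s' ''dn'' 0 = 0 \<longrightarrow>
        val (s ''cn'' 0) \<rho> (s' ''tp'') = val (s ''cn'' 0) \<rho> (s ''tp'') + 1)"
    have fr: "\<forall>x\<in>frozen. s' x = s x" using f unfolding writes_prep_parts frozen_def by simp
    note fc = frozen_cong[OF fr]
    have "base s'" unfolding base_def fc(2,6) using P S by simp
    then show "base s' \<and> s' ''cn'' = s ''cn'' \<and> (s' ''dn'' 0 = 0 \<longrightarrow>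
        val (s ''cn'' 0) \<rho> (s' ''tp'') = val (s ''cn'' 0) \<rho> (s ''tp'') + 1)" using P fc(6) by simp
  qed
qed

lemma base_val_less:
  assumes "base s" "s ''dn'' 0 = 0" shows "val (s ''cn'' 0) \<rho> (s ''tp'') < s ''cn'' 0 ^ \<rho>" "s ''cn'' 0 ^ \<rho> \<le> cmax ^ \<rho>"
proof -
  have "\<forall>i<\<rho>. s ''tp'' i < s ''cn'' 0" using assms unfolding base_def searching_def by simp
  then show "val (s ''cn'' 0) \<rho> (s ''tp'') < s ''cn'' 0 ^ \<rho>" by (rule val_less)
  show "s ''cn'' 0 ^ \<rho> \<le> cmax ^ \<rho>" using assms(1) by (intro power_mono) (simp_all add: base_def)
qed

text \<open>The measure is the number of tuples that are still ahead. Since any \<open>base\<close>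
  state may be the start, the lemma applies to an enumeration that has been interrupted.\<close>

lemma runs_full_search:
  assumes b: "base s"
  shows "runs full_search s ((cmax ^ \<rho> + 1) * loop_time) (\<lambda>s'. base s' \<and> s' ''dn'' 0 \<noteq> 0)"
proof -
  let ?\<mu> = "\<lambda>s'::state. if s' ''dn'' 0 = 0 then s' ''cn'' 0 ^ \<rho> - val (s' ''cn'' 0) \<rho> (s' ''tp'') else 0"
  show ?thesis unfolding full_search_def
  proof (rule runs_Loop[where Inv = base and \<mu> = ?\<mu> and B = "step_time kk (min \<rho> cmax) cmax"])
    fix s' assume b': "base s'" and "bval (Equal (Sc ''dn'') (Const 0)) s'"
    then have dn: "s' ''dn'' 0 = 0" by simp
    show "runs try_tuple s' (step_time kk (min \<rho> cmax) cmax) (\<lambda>s''. base s'' \<and> ?\<mu> s'' < ?\<mu> s')"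
    proof (rule runs_conseq[OF runs_base_step[OF b' dn] order_refl])
      fix s'' assume "base s'' \<and> s'' ''cn'' = s' ''cn'' \<and> (s'' ''dn'' 0 = 0 \<longrightarrow>
        val (s' ''cn'' 0) \<rho> (s'' ''tp'') = val (s' ''cn'' 0) \<rho> (s' ''tp'') + 1)"
      then show "base s'' \<and> ?\<mu> s'' < ?\<mu> s'" using base_val_less(1)[OF b' dn] dn by auto
    qed
  next
    have "?\<mu> s \<le> cmax ^ \<rho>" using base_val_less(2)[OF b] by (auto intro: le_trans[OF diff_le_self])
    then have "?\<mu> s + 1 \<le> cmax ^ \<rho> + 1" by simp
    then show "(?\<mu> s + 1) * (1 + bcost (Equal (Sc ''dn'') (Const 0)) + step_time kk (min \<rho> cmax) cmax)
        \<le> (cmax ^ \<rho> + 1) * loop_time"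
      by (rule mult_le_mono) (simp add: loop_time_def)
  qed (use b in simp_all)
qed

text \<open>The value of the current tuple equals the step counter, as the enumeration starts at 0.
  If the search is undecided after \<open>n\<close> steps, this value is at least \<open>n\<close>
  and below \<open>|N|^\<rho>\<close>, which is the bound on \<open>n\<close> that makes the
  instance its own kernel.\<close>

lemma runs_capped_search:
  assumes b: "base s" and n: "s ''in_n'' 0 = nverts I"
    and v0: "s ''dn'' 0 = 0 \<longrightarrow> val (s ''cn'' 0) \<rho> (s ''tp'') = 0"
  shows "runs capped_search s (10 + (min (nverts I) (cmax ^ \<rho>) + 1) * (loop_time + 50))
     (\<lambda>s'. base s' \<and> (s' ''dn'' 0 = 0 \<longrightarrow> nverts I \<le> cmax ^ \<rho>))"
proof -
  let ?n = "nverts I"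
  let ?b = "Conj (Equal (Sc ''dn'') (Const 0)) (Less (Sc ''st'') (Sc ''in_n''))"
  let ?i = "Set ''st'' (Plus (Sc ''st'') (Const 1))"
  let ?c = "try_tuple ;; ?i"
  \<comment> \<open>Both limits enter the measure: \<open>n\<close> for the polynomial bound on the
    kernelization, and the number of remaining tuples for the bound on the whole algorithm.\<close>
  let ?\<mu> = "\<lambda>s'::state. if s' ''dn'' 0 = 0
     then min (?n - s' ''st'' 0) (s' ''cn'' 0 ^ \<rho> - val (s' ''cn'' 0) \<rho> (s' ''tp'')) else 0"
  let ?I = "\<lambda>s'::state. base s' \<and> (s' ''dn'' 0 = 0 \<longrightarrow> val (s' ''cn'' 0) \<rho> (s' ''tp'') = s' ''st'' 0)"
  let ?B = "step_time kk (min \<rho> cmax) cmax"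
  show ?thesis unfolding capped_search_def
  proof (rule runs_Seq[where Q = "?I"])
    show "runs (Set ''st'' (Const 0)) s 10 ?I"
    proof (rule runs_loop_free)
      have "base (run (Set ''st'' (Const 0)) s) \<longleftrightarrow> base s" by (rule base_cong) (simp_all add: frozen_def)
      then show "?I (run (Set ''st'' (Const 0)) s)" using b v0 by simp
    qed simp_all
  next
    fix s1 assume f1: "unchanged (writes (Set ''st'' (Const 0))) s1 s" and I1: "?I s1"
    show "runs (Loop ?b ?c) s1 ((min ?n (cmax ^ \<rho>) + 1) * (loop_time + 50))
       (\<lambda>s'. base s' \<and> (s' ''dn'' 0 = 0 \<longrightarrow> ?n \<le> cmax ^ \<rho>))"
    proof (rule runs_Loop[where Inv = ?I and \<mu> = ?\<mu> and B = "?B + 20"])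
      fix s2 assume f2: "unchanged (writes ?c) s2 s1" and I2: "?I s2" and b2: "bval ?b s2"
      have n2: "s2 ''in_n'' 0 = ?n" using f1 f2 n by (simp add: writes_prep_parts)
      have b2': "base s2" "s2 ''dn'' 0 = 0" "s2 ''st'' 0 < ?n" "val (s2 ''cn'' 0) \<rho> (s2 ''tp'') = s2 ''st'' 0"
        using I2 b2 n2 by simp_all
      show "runs ?c s2 (?B + 20) (\<lambda>s'. ?I s' \<and> ?\<mu> s' < ?\<mu> s2)"
      proof (rule runs_Seq[OF runs_base_step[OF b2'(1,2)]])
        fix s3 assume "unchanged (writes try_tuple) s3 s2"
          and P: "base s3 \<and> s3 ''cn'' = s2 ''cn'' \<and> (s3 ''dn'' 0 = 0 \<longrightarrow>
             val (s2 ''cn'' 0) \<rho> (s3 ''tp'') = val (s2 ''cn'' 0) \<rho> (s2 ''tp'') + 1)"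
        then have st: "s3 ''st'' = s2 ''st''" unfolding writes_prep_parts by simp
        have bc: "base (run ?i s3) \<longleftrightarrow> base s3" by (rule base_cong) (simp_all add: frozen_def)
        show "runs ?i s3 20 (\<lambda>s'. ?I s' \<and> ?\<mu> s' < ?\<mu> s2)"
        proof (rule runs_loop_free)
          have lt: "s2 ''st'' 0 < s2 ''cn'' 0 ^ \<rho>" using base_val_less(1)[OF b2'(1,2)] b2'(4) by simp
          have r: "run ?i s3 ''dn'' = s3 ''dn''" "run ?i s3 ''cn'' = s2 ''cn''" "run ?i s3 ''tp'' = s3 ''tp''"
            "run ?i s3 ''st'' 0 = s2 ''st'' 0 + 1" using P st by simp_all
          have v3: "s3 ''dn'' 0 = 0 \<longrightarrow> val (s2 ''cn'' 0) \<rho> (s3 ''tp'') = s2 ''st'' 0 + 1" using P b2'(4) by simp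
          show "?I (run ?i s3) \<and> ?\<mu> (run ?i s3) < ?\<mu> s2"
          proof (cases "s3 ''dn'' 0 = 0")
            case True
            have "min (?n - (s2 ''st'' 0 + 1)) (s2 ''cn'' 0 ^ \<rho> - (s2 ''st'' 0 + 1))
                < min (?n - s2 ''st'' 0) (s2 ''cn'' 0 ^ \<rho> - s2 ''st'' 0)"
              using lt b2'(3) by auto
            then show ?thesis
              unfolding bc r b2'(4) v3[rule_format, OF True] using conjunct1[OF P] b2'(2) True by simp
          next
            case False
            then show ?thesis unfolding bc r b2'(4) using conjunct1[OF P] b2'(2,3) lt by simp
          qed
        qed simp_all
      qed
    next
      fix s2 assume f2: "unchanged (writes ?c) s2 s1" and I2: "?I s2" and b2: "\<not> bval ?b s2"
      have n2: "s2 ''in_n'' 0 = ?n" using f1 f2 n by (simp add: writes_prep_parts)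
      have "?n \<le> cmax ^ \<rho>" if dn: "s2 ''dn'' 0 = 0"
      proof -
        have "?n \<le> s2 ''st'' 0" using b2 dn n2 by simp
        moreover have "s2 ''st'' 0 < s2 ''cn'' 0 ^ \<rho>" using base_val_less(1)[of s2] I2 dn by simp
        moreover have "s2 ''cn'' 0 ^ \<rho> \<le> cmax ^ \<rho>" using base_val_less(2)[of s2] I2 dn by simp
        ultimately show ?thesis by linarith
      qed
      then show "base s2 \<and> (s2 ''dn'' 0 = 0 \<longrightarrow> ?n \<le> cmax ^ \<rho>)" using I2 by blast
    next
      have "?\<mu> s1 \<le> min ?n (cmax ^ \<rho>)"
      proof (cases "s1 ''dn'' 0 = 0")
        case True
        then have "s1 ''cn'' 0 ^ \<rho> \<le> cmax ^ \<rho>" using base_val_less(2)[of s1] I1 by simp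
        then have "s1 ''cn'' 0 ^ \<rho> - val (s1 ''cn'' 0) \<rho> (s1 ''tp'') \<le> cmax ^ \<rho>" by linarith
        then have "min (?n - s1 ''st'' 0) (s1 ''cn'' 0 ^ \<rho> - val (s1 ''cn'' 0) \<rho> (s1 ''tp'')) \<le> min ?n (cmax ^ \<rho>)"
          by (rule min.mono[OF diff_le_self])
        then show ?thesis using True by simp
      qed simp
      then have "?\<mu> s1 + 1 \<le> min ?n (cmax ^ \<rho>) + 1" by simp
      then show "(?\<mu> s1 + 1) * (1 + bcost ?b + (?B + 20)) \<le> (min ?n (cmax ^ \<rho>) + 1) * (loop_time + 50)"
        by (rule mult_le_mono) (simp add: loop_time_def)
    qed (use I1 in simp_all)
  qed
qed

text \<open>Besides the emitted kernel, the state of the enumeration on the original instance is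
  retained; the solver works on the latter.\<close>

definition kernel_state :: "state \<Rightarrow> bool" where
  "kernel_state s \<longleftrightarrow> base s \<and> s ''in_m'' 0 = nedges I \<and>
     (if s ''dn'' 0 = 0 then holds_inst ''ker_'' I s \<and> nverts I \<le> cmax ^ \<rho>
      else holds_inst ''ker_'' (trivial_inst (1 - s ''fd'' 0)) s)"

definition kernel_time :: nat where
  "kernel_time = prep_time + (10 + (min (nverts I) (cmax ^ \<rho>) + 1) * (loop_time + 50) + 200 * (nedges I + 1))"

lemma runs_emit_kernel:
  assumes b: "base s" "s ''dn'' 0 = 0 \<longrightarrow> nverts I \<le> cmax ^ \<rho>" and i: "holds_inst ''in_'' I s"
  shows "runs emit_kernel s (200 * (nedges I + 1)) kernel_state"
proof -
  let ?m = "nedges I"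
  let ?c = "Cond (Equal (Sc ''dn'') (Const 1))
       (Set ''ker_n'' (Const 1) ;; Set ''ker_m'' (Const 0) ;; Set ''ker_numer'' (Const 1) ;;
        Set ''ker_denom'' (Const 1) ;; Set ''ker_rho'' (Minus (Const 1) (Sc ''fd'')))
       (Set ''ker_n'' (Sc ''in_n'') ;; Set ''ker_m'' (Sc ''in_m'') ;; Set ''ker_numer'' (Sc ''in_numer'') ;;
        Set ''ker_denom'' (Sc ''in_denom'') ;; Set ''ker_rho'' (Sc ''in_rho''))"
  let ?d = "Write ''ker_u'' (Sc ''i'') (Read ''in_u'' (Sc ''i'')) ;;
        Write ''ker_v'' (Sc ''i'') (Read ''in_v'' (Sc ''i''))"
  let ?J = "if s ''dn'' 0 = 0 then I else trivial_inst (1 - s ''fd'' 0)"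
  have "searching kk \<rho> s" using b(1) unfolding base_def by (rule conjunct1)
  then have dn: "s ''dn'' 0 = 0 \<or> s ''dn'' 0 = 1"
    unfolding searching_def by (cases "s ''dn'' 0 = 0") simp_all
  have in_s: "s ''in_n'' 0 = nverts I" "s ''in_m'' 0 = ?m" "s ''in_numer'' 0 = numer (stretch I)"
    "s ''in_denom'' 0 = denom (stretch I)" "s ''in_rho'' 0 = \<rho>"
    "\<forall>i<?m. (s ''in_u'' i, s ''in_v'' i) = elist I ! i"
    using i by (simp_all add: holds_inst_def)
  let ?Q = "\<lambda>s'::state. s' ''ker_n'' 0 = nverts ?J \<and> s' ''ker_m'' 0 = nedges ?J \<and> s' ''ker_numer'' 0 = numer (stretch ?J) \<and>
     s' ''ker_denom'' 0 = denom (stretch ?J) \<and> s' ''ker_rho'' 0 = removals ?J"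
  let ?P = "\<lambda>i s'::state. ?Q s' \<and> (\<forall>l<i. (s' ''ker_u'' l, s' ''ker_v'' l) = elist I ! l)"
  have mJ: "nedges ?J \<le> ?m" by (simp add: trivial_inst_def nedges_def)
  have "runs emit_kernel s (100 + (nedges ?J + 1) * 50) kernel_state" unfolding emit_kernel_def
  proof (rule runs_Seq[where Q = ?Q])
    show "runs ?c s 100 ?Q"
    proof (rule runs_loop_free)
      show "?Q (run ?c s)"
      proof (cases "s ''dn'' 0 = 0")
        case True
        then show ?thesis using in_s(1-5) by simp
      next
        case False
        then have "s ''dn'' 0 = 1" using dn by simp
        then show ?thesis by (simp add: trivial_inst_def nedges_def quotient_of_1)
      qed
    qed simp_all
  next
    fix s1 assume f1: "unchanged (writes ?c) s1 s" and Q1: "?Q s1"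
    have g1: "s1 ''in_u'' = s ''in_u''" "s1 ''in_v'' = s ''in_v''" using f1 by simp_all
    show "runs (For ''i'' (Sc ''ker_m'') ?d) s1 ((nedges ?J + 1) * 50) kernel_state"
    proof (rule runs_For[where P = ?P and h = "nedges ?J" and B = 20])
      fix i and s2 :: state
      assume i: "i < nedges ?J" "s2 ''i'' 0 = i" and P: "?P i s2"
        and f2: "unchanged (insert ''i'' (writes ?d)) s2 s1"
      have im: "i < ?m" using i(1) mJ by simp
      have g2: "s2 ''in_u'' = s ''in_u''" "s2 ''in_v'' = s ''in_v''" using f2 g1 by simp_all
      have "(s2 ''in_u'' i, s2 ''in_v'' i) = elist I ! i" unfolding g2 using in_s(6) im by blast
      then show "runs ?d s2 20 (\<lambda>s'. ?P (Suc i) (put ''i'' (Suc i) s'))"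
        using P i(2) by (intro runs_loop_free) (simp_all add: less_Suc_eq)
    next
      fix s2 assume f2: "unchanged (insert ''i'' (writes ?d)) s2 s1" and P: "?P (nedges ?J) s2"
      have fr: "\<forall>x\<in>frozen. s2 x = s x" using f1 f2 by (simp add: frozen_def)
      have g: "s2 ''in_rho'' = s ''in_rho''" "s2 ''dn'' = s ''dn''" "s2 ''fd'' = s ''fd''"
        "s2 ''rm'' = s ''rm''" "s2 ''tp'' = s ''tp''" "s2 ''in_m'' = s ''in_m''"
        using f1 f2 by simp_all
      have "base s2" using b(1) base_cong[OF fr g(1-5)] by simp
      moreover have "holds_inst ''ker_'' ?J s2"
      proof (cases "s ''dn'' 0 = 0")
        case True
        then show ?thesis using P by (simp add: holds_inst_def)
      next
        case False
        then show ?thesis using P by (simp add: holds_inst_def trivial_inst_def nedges_def)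
      qed
      ultimately show "kernel_state s2" unfolding kernel_state_def g using b(2) in_s(2)
        by (cases "s ''dn'' 0 = 0") simp_all
    next
      fix s' :: state assume "unchanged (insert ''i'' (writes ?d)) s' s1"
      then show "aval (Sc ''ker_m'') s' = nedges ?J" using Q1 by simp
    qed (use Q1 in simp_all)
  qed
  moreover have "100 + (nedges ?J + 1) * 50 \<le> 200 * (?m + 1)" using mJ by simp
  ultimately show ?thesis by (rule runs_conseq) assumption
qed

lemma runs_kernel: "runs kernel_com (input_state I) kernel_time kernel_state"
  unfolding kernel_com_def kernel_time_def
proof (rule runs_Seq[OF runs_prep])
  fix s1 assume f1: "unchanged (writes prep) s1 (input_state I)"
    and P1: "base s1 \<and> (s1 ''dn'' 0 = 0 \<longrightarrow> val (s1 ''cn'' 0) \<rho> (s1 ''tp'') = 0)"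
  have wp: "x \<notin> writes prep" if "x \<in> {''in_n'', ''in_m'', ''in_u'', ''in_v'', ''in_numer'', ''in_denom'', ''in_rho''}" for x
    using that unfolding prep_def writes.simps writes_prep_parts by auto
  have i1: "holds_inst ''in_'' I s1"
    using holds_inst_input_state[of I] f1 wp by (simp add: holds_inst_def)
  then have n1: "s1 ''in_n'' 0 = nverts I" by (simp add: holds_inst_def)
  show "runs (capped_search ;; emit_kernel) s1
     (10 + (min (nverts I) (cmax ^ \<rho>) + 1) * (loop_time + 50) + 200 * (nedges I + 1)) kernel_state"
  proof (rule runs_Seq[OF runs_capped_search[OF conjunct1[OF P1] n1 conjunct2[OF P1]]])
    fix s2 assume f2: "unchanged (writes capped_search) s2 s1"
      and P2: "base s2 \<and> (s2 ''dn'' 0 = 0 \<longrightarrow> nverts I \<le> cmax ^ \<rho>)"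
    have i2: "holds_inst ''in_'' I s2"
      using i1 f2 by (simp add: holds_inst_def capped_search_def writes_prep_parts)
    show "runs emit_kernel s2 (200 * (nedges I + 1)) kernel_state"
      by (rule runs_emit_kernel[OF conjunct1[OF P2] conjunct2[OF P2] i2])
  qed
qed

lemma base_finished:
  assumes b: "base s" and dn: "s ''dn'' 0 \<noteq> 0"
  shows "s ''fd'' 0 = (if yes_instance I then 1 else 0)"
    and "yes_instance I \<Longrightarrow> solution I (edge I ` {i. i < nedges I \<and> 1 - s ''rm'' i = 1})"
proof -
  have y: "yes_instance I \<longleftrightarrow> (\<exists>R \<subseteq> cand s. good kk R \<and> card R = \<rho>)" using b unfolding base_def by blast
  have c: "s ''fd'' 0 = 1 \<and> (\<exists>R \<subseteq> cand s. good kk R \<and> card R = \<rho> \<and> marked R s) \<or>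
         s ''fd'' 0 = 0 \<and> \<not> (\<exists>R \<subseteq> cand s. good kk R \<and> card R = \<rho>)"
    using b dn unfolding base_def searching_def by simp
  show "s ''fd'' 0 = (if yes_instance I then 1 else 0)" using c unfolding y by auto
  assume "yes_instance I"
  then obtain R where R: "good kk R" "card R = \<rho>" "marked R s" using c unfolding y by blast
  have "{i. i < nedges I \<and> 1 - s ''rm'' i = 1} = {..<nedges I} - R"
  proof (rule set_eqI)
    fix i
    have "i < nedges I \<Longrightarrow> s ''rm'' i = (if i \<in> R then 1 else 0)" using R(3) by (simp add: marked_def)
    then show "i \<in> {i. i < nedges I \<and> 1 - s ''rm'' i = 1} \<longleftrightarrow> i \<in> {..<nedges I} - R" by auto
  qed
  then show "solution I (edge I ` {i. i < nedges I \<and> 1 - s ''rm'' i = 1})"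
    using good_solution[OF R(1)] R(2) by simp
qed

end

section \<open>Running times\<close>

text \<open>Lifting the solution amounts to reading the marks in \<open>rm\<close> again, now for
  all edges of the input: the marks refer to the edge numbers of the original instance even when the
  kernel is the one-vertex instance.\<close>

definition total_com :: com where
  "total_com = kernel_com ;; solve_com ;; emit_answer ''in_''"

lemma writes_emit_answer:
  "writes (emit_answer ''ker_'') = {''ker_answer'', ''ker_keep'', ''i''}"
  "writes (emit_answer ''in_'') = {''in_answer'', ''in_keep'', ''i''}"
  by (auto simp: emit_answer_def)

context basic_inst begin

text \<open>If the kernelization left the search undecided, the kernel is the instance itself and
  the finished search answers it. Otherwise the search is already over, and the kernel has no edges,
  so that the empty set is its only candidate solution. The additional postconditions feed the
  lifting step.\<close>

lemma runs_solve:
  assumes K: "kernel_state s" and J: "basic_instance J" "holds_inst ''ker_'' J s"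
  shows "runs solve_com s ((cmax ^ \<rho> + 1) * loop_time + 100 * (s ''ker_m'' 0 + 1))
     (\<lambda>s'. answered ''ker_'' J s' \<and> base s' \<and> s' ''dn'' 0 \<noteq> 0 \<and> s' ''in_m'' 0 = nedges I)"
  unfolding solve_com_def
proof (rule runs_Seq[OF runs_full_search])
  show b: "base s" using K by (simp add: kernel_state_def)
  fix s1 assume "unchanged (writes full_search) s1 s" and b1: "base s1 \<and> s1 ''dn'' 0 \<noteq> 0"
  then have f1: "unchanged {''ok'', ''i'', ''e'', ''rm'', ''b'', ''dd'', ''r'', ''j'', ''fd'', ''dn'', ''tp''} s1 s"
    unfolding full_search_def writes.simps writes_prep_parts by blast
  have m1: "s1 ''ker_m'' = s ''ker_m''" "s1 ''in_m'' = s ''in_m''" using f1 by simp_all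
  have mJ: "s ''ker_m'' 0 = nedges J" using J(2) by (simp add: holds_inst_def)
  note fin = base_finished[OF conjunct1[OF b1] conjunct2[OF b1]]
  have ans: "answered ''ker_'' J s'"
    if s': "s' ''ker_answer'' 0 = s1 ''fd'' 0" "\<forall>i<nedges J. s' ''ker_keep'' i = 1 - s1 ''rm'' i" for s'
  proof (cases "s ''dn'' 0 = 0")
    case True
    then have "holds_inst ''ker_'' I s" using K by (simp add: kernel_state_def)
    then have JI: "J = I" using holds_inst_unique J basic by blast
    have "{i. i < nedges I \<and> s' ''ker_keep'' i = 1} = {i. i < nedges I \<and> 1 - s1 ''rm'' i = 1}"
      using s'(2) unfolding JI by auto
    then show ?thesis unfolding answered_def JI using s'(1) fin by simp
  next
    case False
    then have "holds_inst ''ker_'' (trivial_inst (1 - s ''fd'' 0)) s" using K by (simp add: kernel_state_def)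
    then have JT: "J = trivial_inst (1 - s ''fd'' 0)" using holds_inst_unique J basic_trivial_inst by blast
    have e: "nedges J = 0" unfolding JT by (simp add: trivial_inst_def nedges_def)
    have fd: "s ''fd'' 0 = (if yes_instance I then 1 else 0)" using base_finished(1)[OF b False] .
    have y: "yes_instance J \<longleftrightarrow> yes_instance I" unfolding JT yes_trivial_inst fd by simp
    have "yes_instance J \<Longrightarrow> solution J {}"
      unfolding JT yes_trivial_inst solution_trivial_inst by simp
    then show ?thesis unfolding answered_def e using s'(1) fin(1) y by simp
  qed
  show "runs (emit_answer ''ker_'') s1 (100 * (s ''ker_m'' 0 + 1))
     (\<lambda>s'. answered ''ker_'' J s' \<and> base s' \<and> s' ''dn'' 0 \<noteq> 0 \<and> s' ''in_m'' 0 = nedges I)"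
  proof (rule runs_conseq[OF runs_emit_answer[of "''ker_''"]])
    show "100 * (s1 (''ker_'' @ ''m'') 0 + 1) \<le> 100 * (s ''ker_m'' 0 + 1)" using m1(1) by simp
    fix s2 assume "unchanged (writes (emit_answer ''ker_'')) s2 s1"
      and P: "s2 (''ker_'' @ ''answer'') 0 = s1 ''fd'' 0 \<and>
        (\<forall>i<s1 (''ker_'' @ ''m'') 0. s2 (''ker_'' @ ''keep'') i = 1 - s1 ''rm'' i)"
    then have f2: "unchanged {''ker_answer'', ''ker_keep'', ''i''} s2 s1"
      unfolding writes_emit_answer by blast
    have "base s2 \<longleftrightarrow> base s1" by (rule base_cong) (use f2 in \<open>simp_all add: frozen_def\<close>)
    moreover have "s2 ''dn'' = s1 ''dn''" "s2 ''in_m'' 0 = nedges I"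
      using f2 m1(2) K by (simp_all add: kernel_state_def)
    moreover have "answered ''ker_'' J s2" using P m1(1) mJ by (intro ans) simp_all
    ultimately show "answered ''ker_'' J s2 \<and> base s2 \<and> s2 ''dn'' 0 \<noteq> 0 \<and> s2 ''in_m'' 0 = nedges I"
      using b1 by simp
  qed simp
qed

definition kernel_inst :: "state \<Rightarrow> inst" where
  "kernel_inst s = (if s ''dn'' 0 = 0 then I else trivial_inst (1 - s ''fd'' 0))"

lemma kernel_inst:
  assumes "kernel_state s"
  shows "holds_inst ''ker_'' (kernel_inst s) s" "basic_instance (kernel_inst s)"
    "yes_instance (kernel_inst s) \<longleftrightarrow> yes_instance I" "nedges (kernel_inst s) \<le> nedges I"
proof -
  have b: "base s" using assms by (simp add: kernel_state_def)
  show "holds_inst ''ker_'' (kernel_inst s) s"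
    using assms by (cases "s ''dn'' 0 = 0") (simp_all add: kernel_state_def kernel_inst_def)
  show "basic_instance (kernel_inst s)" using basic basic_trivial_inst by (simp add: kernel_inst_def)
  show "yes_instance (kernel_inst s) \<longleftrightarrow> yes_instance I"
    using base_finished(1)[OF b] by (simp add: kernel_inst_def yes_trivial_inst)
  show "nedges (kernel_inst s) \<le> nedges I"
    by (simp add: kernel_inst_def trivial_inst_def nedges_def)
qed

definition total_time :: nat where
  "total_time = kernel_time + ((cmax ^ \<rho> + 1) * loop_time + 100 * (nedges I + 1) + 100 * (nedges I + 1))"

lemma runs_total: "runs total_com (input_state I) total_time (answered ''in_'' I)"
  unfolding total_com_def total_time_def
proof (rule runs_Seq[OF runs_kernel])
  fix s1 assume K: "kernel_state s1"
  note ki = kernel_inst[OF K]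
  have "s1 ''ker_m'' 0 \<le> nedges I" using ki(1,4) by (simp add: holds_inst_def)
  then have T: "(cmax ^ \<rho> + 1) * loop_time + 100 * (s1 ''ker_m'' 0 + 1) \<le>
      (cmax ^ \<rho> + 1) * loop_time + 100 * (nedges I + 1)" by simp
  let ?Q = "\<lambda>s'::state. base s' \<and> s' ''dn'' 0 \<noteq> 0 \<and> s' ''in_m'' 0 = nedges I"
  show "runs (solve_com ;; emit_answer ''in_'') s1
     ((cmax ^ \<rho> + 1) * loop_time + 100 * (nedges I + 1) + 100 * (nedges I + 1)) (answered ''in_'' I)"
  proof (rule runs_Seq[where Q = ?Q])
    show "runs solve_com s1 ((cmax ^ \<rho> + 1) * loop_time + 100 * (nedges I + 1)) ?Q"
      by (rule runs_conseq[OF runs_solve[OF K ki(2,1)] T]) blast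
  next
    fix s2 assume Q: "?Q s2"
    note fin = base_finished[OF conjunct1[OF Q] conjunct1[OF conjunct2[OF Q]]]
    show "runs (emit_answer ''in_'') s2 (100 * (nedges I + 1)) (answered ''in_'' I)"
    proof (rule runs_conseq[OF runs_emit_answer[of "''in_''"]])
      show "100 * (s2 (''in_'' @ ''m'') 0 + 1) \<le> 100 * (nedges I + 1)" using Q by simp
      fix s3 assume P: "s3 (''in_'' @ ''answer'') 0 = s2 ''fd'' 0 \<and>
        (\<forall>i<s2 (''in_'' @ ''m'') 0. s3 (''in_'' @ ''keep'') i = 1 - s2 ''rm'' i)"
      have "\<forall>i<nedges I. s3 (''in_'' @ ''keep'') i = 1 - s2 ''rm'' i" using P Q by simp
      then have "{i. i < nedges I \<and> s3 (''in_'' @ ''keep'') i = 1} = {i. i < nedges I \<and> 1 - s2 ''rm'' i = 1}" by auto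
      then show "answered ''in_'' I s3" unfolding answered_def using P fin by simp
    qed simp
  qed
qed

text \<open>With at least two vertices a connected graph has an edge, and both factors are positive;
  the summand 1 covers the single vertex.\<close>

lemma nverts_le: "nverts I \<le> nverts I * nedges I + 1" "nedges I \<le> nverts I * nedges I + 1"
  using nedges_ge n_pos by (cases "nedges I"; cases "nverts I"; auto)+

lemma kk_le_nverts: "kk \<le> nverts I"
  by (simp add: kk_def)

lemma cmax_le: "cmax \<le> nedges I" "cmax \<le> \<rho> * (2 * kk + 1)"
  by (simp_all add: cmax_def)

text \<open>With \<open>M = m + 2\<close>, each of \<open>n\<close>, \<open>k\<close> and |N| is
  below \<open>M\<close>. One step of the enumeration costs \<open>O(M^4)\<close>, and fewer than
  \<open>M\<close> steps are made.\<close>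

lemma kernel_time_poly: "kernel_time \<le> 25000 * (nedges I + 2) ^ 5"
proof -
  define M where "M = nedges I + 2"
  have M: "nverts I + 1 \<le> M" "nedges I + 1 \<le> M" "cmax + 1 \<le> M" "kk + 1 \<le> M" "2 \<le> M"
    using nedges_ge cmax_le(1) kk_le_nverts by (simp_all add: M_def)
  have p: "M ^ i \<le> M ^ 5" if "i \<le> 5" for i
    using M(5) that by (intro power_increasing) simp_all
  have p1: "M \<le> M ^ 5" using p[of 1] by simp
  have p2: "M * M \<le> M ^ 5" using p[of 2] by (simp add: power2_eq_square)
  have p5: "M * (M * (M * (M * M))) = M ^ 5" by (simp add: eval_nat_numeral)
  have p4: "M * (M * (M * M)) \<le> M ^ 5" using p[of 4] by (simp add: eval_nat_numeral)
  have a: "(nverts I + 1) * (nverts I + nedges I + 1) \<le> M * (2 * M)"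
    using M by (intro mult_le_mono) simp_all
  have b: "(cmax + 1) * (nverts I + nedges I + cmax + 1) \<le> M * (3 * M)"
    using M by (intro mult_le_mono) simp_all
  have prep: "prep_time \<le> 21000 * M ^ 5"
  proof -
    define x where "x = (nverts I + 1) * (nverts I + nedges I + 1)"
    define y where "y = (cmax + 1) * (nverts I + nedges I + cmax + 1)"
    have "x \<le> 2 * (M * M)" "y \<le> 3 * (M * M)" using a b by (simp_all add: x_def y_def mult.left_commute)
    moreover have "100 * a + (500 * b + (4000 * x + (100 * b + (200 * b + (4000 * y + 20))))) \<le> 21000 * P"
      if "x \<le> 2 * Q" "y \<le> 3 * Q" "a \<le> M" "b \<le> M" "2 \<le> M" "M \<le> P" "Q \<le> P" for a b P Q
      using that by linarith
    ultimately show ?thesis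
      unfolding prep_time_def mult.assoc[of 4000] x_def[symmetric] y_def[symmetric]
      using M(1,2,5) p1 p2 by blast
  qed
  have "min \<rho> cmax + 1 \<le> M" using M(3) by simp
  then have "(min \<rho> cmax + 1) * (kk + 1) * ((cmax + 1) * (cmax + 1)) \<le> M * M * (M * M)"
    using M by (intro mult_le_mono)
  then have "loop_time + 50 \<le> 3000 * (M * (M * (M * M))) + 100"
    unfolding loop_time_def step_time_def by (simp add: mult.assoc)
  moreover have "min (nverts I) (cmax ^ \<rho>) + 1 \<le> M" using M(1) by simp
  ultimately have "(min (nverts I) (cmax ^ \<rho>) + 1) * (loop_time + 50) \<le> M * (3000 * (M * (M * (M * M))) + 100)"
    by (intro mult_le_mono)
  also have "\<dots> = 3000 * M ^ 5 + 100 * M" unfolding p5[symmetric] by (simp add: algebra_simps)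
  finally have "(min (nverts I) (cmax ^ \<rho>) + 1) * (loop_time + 50) \<le> 3000 * M ^ 5 + 100 * M" .
  moreover have "q + (10 + w + 200 * b) \<le> 25000 * P"
    if "w \<le> 3000 * P + 100 * M" "q \<le> 21000 * P" "M \<le> P" "b \<le> M" "2 \<le> M" for q w b P
    using that by linarith
  ultimately have "kernel_time \<le> 25000 * M ^ 5"
    unfolding kernel_time_def using prep p1 M(2,5) by blast
  then show ?thesis by (simp add: M_def)
qed

end

section \<open>Encoding lengths and bounds in terms of the parameters\<close>

lemma bits_le: "bits x \<le> x + 1"
proof -
  have "x < 2 ^ x" by (rule less_exp)
  then have "floorlog 2 x \<le> x" by (intro floorlog_leI) simp_all
  then show ?thesis by (simp add: bits_def)
qed

lemma bits_pos: "1 \<le> bits x"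
  by (simp add: bits_def)

lemma sum_bits_ge: "2 * length xs \<le> (\<Sum>(u, v)\<leftarrow>xs. bits u + bits v)"
proof (induction xs)
  case (Cons a xs)
  then show ?case using bits_pos[of "fst a"] bits_pos[of "snd a"] by (simp add: case_prod_beta)
qed simp

lemma sum_bits_le:
  "\<forall>(u, v)\<in>set xs. u < n \<and> v < n \<Longrightarrow> (\<Sum>(u, v)\<leftarrow>xs. bits u + bits v) \<le> length xs * (2 * n)"
proof (induction xs)
  case (Cons a xs)
  then have "bits (fst a) \<le> n" "bits (snd a) \<le> n"
    using bits_le[of "fst a"] bits_le[of "snd a"] by (auto simp: case_prod_beta)
  then show ?case using Cons by (simp add: case_prod_beta)
qed simp

lemma nedges_le_encoding: "2 * nedges I + 2 \<le> encoding_length I"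
  using sum_bits_ge[of "elist I"] bits_pos[of "nverts I"] bits_pos[of "numer (stretch I)"]
  unfolding encoding_length_def nedges_def by linarith

text \<open>A bound on \<open>|N|^\<rho>\<close>, and thereby on the number of vertices of an
  undecided kernel. The cap of \<open>kk\<close> at \<open>n\<close> is dropped, as only the
  parameters may occur.\<close>

definition size_bound :: "nat \<Rightarrow> rat \<Rightarrow> nat" where
  "size_bound r a = (r * (2 * (numer a div denom a) + 1)) ^ r"

text \<open>With at most \<open>X\<close> vertices there are at most \<open>X * X\<close> edges,
  each encoded by two numbers of at most \<open>X\<close> bits. The constant 10 takes care of the
  one-vertex kernels.\<close>

definition kernel_bound :: "nat \<Rightarrow> rat \<Rightarrow> nat" where
  "kernel_bound r a = size_bound r a + 1 + size_bound r a * size_bound r a * (2 * size_bound r a) +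
     bits (numer a) + bits (denom a) + bits r + 10"

definition solver_bound :: "nat \<Rightarrow> rat \<Rightarrow> nat" where
  "solver_bound r a = (size_bound r a + 1) * (step_time (numer a div denom a) r (r * (2 * (numer a div denom a) + 1)) + 50) +
     100 * (size_bound r a * size_bound r a + 1)"

context basic_inst begin

lemma kk_le_floor: "kk \<le> numer (stretch I) div denom (stretch I)"
  by (simp add: kk_def)

lemma cmax_le_floor: "cmax \<le> \<rho> * (2 * (numer (stretch I) div denom (stretch I)) + 1)"
proof -
  have "\<rho> * (2 * kk + 1) \<le> \<rho> * (2 * (numer (stretch I) div denom (stretch I)) + 1)"
    using kk_le_floor by (intro mult_le_mono2) simp
  with cmax_le(2) show ?thesis by (rule le_trans)
qed

lemma cmax_power_le: "cmax ^ \<rho> \<le> size_bound \<rho> (stretch I)"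
  unfolding size_bound_def using cmax_le_floor by (rule power_mono) simp

lemma kernel_size:
  assumes K: "kernel_state s" shows "encoding_length (kernel_inst s) \<le> kernel_bound \<rho> (stretch I)"
    and "s ''ker_m'' 0 \<le> size_bound \<rho> (stretch I) * size_bound \<rho> (stretch I)"
proof -
  let ?X = "size_bound \<rho> (stretch I)"
  have "encoding_length (kernel_inst s) \<le> kernel_bound \<rho> (stretch I) \<and> nedges (kernel_inst s) \<le> ?X * ?X"
  proof (cases "s ''dn'' 0 = 0")
    case True
    then have n: "nverts I \<le> ?X" using K cmax_power_le unfolding kernel_state_def by auto
    have m: "nedges I \<le> ?X * ?X" using nedges_le mult_le_mono[OF n n] by (rule le_trans)
    have "\<forall>(u, v)\<in>set (elist I). u < nverts I \<and> v < nverts I"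
    proof
      fix p assume "p \<in> set (elist I)"
      then obtain i where "i < nedges I" "p = elist I ! i" by (auto simp: in_set_conv_nth nedges_def)
      then show "case p of (u, v) \<Rightarrow> u < nverts I \<and> v < nverts I" using ends[of i] by (simp add: case_prod_beta)
    qed
    then have "(\<Sum>(u, v)\<leftarrow>elist I. bits u + bits v) \<le> nedges I * (2 * nverts I)"
      unfolding nedges_def by (rule sum_bits_le)
    also have "\<dots> \<le> ?X * ?X * (2 * ?X)" using m n by (intro mult_le_mono) simp_all
    finally have "(\<Sum>(u, v)\<leftarrow>elist I. bits u + bits v) \<le> ?X * ?X * (2 * ?X)" .
    moreover have "bits (nverts I) \<le> ?X + 1" using bits_le[of "nverts I"] n by linarith
    ultimately have "encoding_length I \<le> kernel_bound \<rho> (stretch I)"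
      unfolding encoding_length_def kernel_bound_def by linarith
    then show ?thesis using True m by (simp add: kernel_inst_def)
  next
    case False
    have "encoding_length (trivial_inst (1 - x)) \<le> 10" for x
      using bits_le[of "1 - x"] bits_le[of 1]
      by (simp add: encoding_length_def trivial_inst_def quotient_of_1)
    then have "encoding_length (kernel_inst s) \<le> 10" using False by (simp add: kernel_inst_def)
    moreover have "nedges (kernel_inst s) = 0" using False by (simp add: kernel_inst_def trivial_inst_def nedges_def)
    ultimately show ?thesis unfolding kernel_bound_def by simp
  qed
  moreover have "s ''ker_m'' 0 = nedges (kernel_inst s)" using kernel_inst(1)[OF K] by (simp add: holds_inst_def)
  ultimately show "encoding_length (kernel_inst s) \<le> kernel_bound \<rho> (stretch I)" "s ''ker_m'' 0 \<le> ?X * ?X" by simp_all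
qed

lemma solve_time:
  assumes "kernel_state s"
  shows "(cmax ^ \<rho> + 1) * loop_time + 100 * (s ''ker_m'' 0 + 1) \<le> solver_bound \<rho> (stretch I)"
proof -
  have "loop_time \<le> step_time (numer (stretch I) div denom (stretch I)) \<rho> (\<rho> * (2 * (numer (stretch I) div denom (stretch I)) + 1)) + 50"
    unfolding loop_time_def using kk_le_floor cmax_le_floor by (intro add_le_mono1 step_time_mono) simp_all
  then have "(cmax ^ \<rho> + 1) * loop_time \<le> (size_bound \<rho> (stretch I) + 1) *
     (step_time (numer (stretch I) div denom (stretch I)) \<rho> (\<rho> * (2 * (numer (stretch I) div denom (stretch I)) + 1)) + 50)"
    using cmax_power_le by (intro mult_le_mono) simp_all
  moreover have "100 * (s ''ker_m'' 0 + 1) \<le> 100 * (size_bound \<rho> (stretch I) * size_bound \<rho> (stretch I) + 1)"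
    using kernel_size(2)[OF assms] by simp
  ultimately show ?thesis unfolding solver_bound_def by (rule add_mono)
qed

end

lemma kernelization_kernel_com: "kernelization kernel_com"
  unfolding kernelization_def
proof (rule exI[of _ kernel_bound], rule exI[of _ 25000], rule exI[of _ 5], intro allI impI)
  fix I assume "basic_instance I"
  then interpret basic_inst I by unfold_locales
  from runs_kernel obtain t s where ts: "exec kernel_com (input_state I) t s" "t \<le> kernel_time" "kernel_state s"
    unfolding runs_def by blast
  have "(nedges I + 2) ^ 5 \<le> encoding_length I ^ 5"
    using nedges_le_encoding[of I] by (intro power_mono) simp_all
  then have "t \<le> 25000 * encoding_length I ^ 5" using ts(2) kernel_time_poly by linarith
  then show "\<exists>t s J. exec kernel_com (input_state I) t s \<and> t \<le> 25000 * encoding_length I ^ 5 \<and>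
      holds_inst ''ker_'' J s \<and> basic_instance J \<and> (yes_instance J \<longleftrightarrow> yes_instance I) \<and>
      encoding_length J \<le> kernel_bound (removals I) (stretch I)"
    using ts(1) kernel_inst(1-3)[OF ts(3)] kernel_size(1)[OF ts(3)] by blast
qed

lemma kernel_solver_solve_com: "kernel_solver kernel_com solve_com"
  unfolding kernel_solver_def
proof (rule exI[of _ solver_bound], intro allI impI)
  fix I J t s assume "basic_instance I" and ex: "exec kernel_com (input_state I) t s"
    and J: "basic_instance J" "holds_inst ''ker_'' J s"
  then interpret basic_inst I by unfold_locales
  from runs_kernel obtain t' s' where "exec kernel_com (input_state I) t' s'" "kernel_state s'"
    unfolding runs_def by blast
  \<comment> \<open>The solver has to work after every halting run of the kernelization; by
    determinism there is only the run already analysed.\<close>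
  then have K: "kernel_state s" using exec_deterministic[OF ex] by blast
  from runs_solve[OF K J] obtain t' s' where "exec solve_com s t' s'"
    "t' \<le> (cmax ^ \<rho> + 1) * loop_time + 100 * (s ''ker_m'' 0 + 1)" "answered ''ker_'' J s'"
    unfolding runs_def by blast
  moreover have "t' \<le> solver_bound (removals I) (stretch I)" using calculation(2) solve_time[OF K] by (rule le_trans)
  ultimately show "\<exists>t' s'. exec solve_com s t' s' \<and> answered ''ker_'' J s' \<and> t' \<le> solver_bound (removals I) (stretch I)"
    by blast
qed

text \<open>A crude bound that is computable with additions alone: the exponent arises from 5 by
  repeated quadrupling, the value from 1 by repeated doubling.\<close>

definition tower :: "nat \<Rightarrow> rat \<Rightarrow> nat" where
  "tower r a = 2 ^ (5 * 4 ^ (r + numer a))"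

lemma computable_tower: "computable tower"
proof -
  let ?q = "Set ''v'' (Plus (Plus (Sc ''v'') (Sc ''v'')) (Plus (Sc ''v'') (Sc ''v'')))"
  let ?d = "Set ''value'' (Plus (Sc ''value'') (Sc ''value''))"
  let ?c = "(Set ''v'' (Const 5) ;; Set ''value'' (Const 1)) ;;
     For ''i'' (Plus (Sc ''in_rho'') (Sc ''in_numer'')) ?q ;; For ''i'' (Sc ''v'') ?d"
  have "\<exists>T. runs ?c (params_state r a) T (\<lambda>s. s ''value'' 0 = tower r a)" for r a
  proof -
    let ?s = "params_state r a" and ?h = "r + numer a"
    have "runs ?c ?s (20 + ((?h + 1) * 100 + (5 * 4 ^ ?h + 1) * 100)) (\<lambda>s. s ''value'' 0 = tower r a)"
    proof (rule runs_Seq[where Q = "\<lambda>s. s ''v'' 0 = 5 \<and> s ''value'' 0 = 1"])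
      show "runs (Set ''v'' (Const 5) ;; Set ''value'' (Const 1)) ?s 20 (\<lambda>s. s ''v'' 0 = 5 \<and> s ''value'' 0 = 1)"
        by (rule runs_loop_free) simp_all
    next
      fix s1 assume f1: "unchanged (writes (Set ''v'' (Const 5) ;; Set ''value'' (Const 1))) s1 ?s"
        and v1: "s1 ''v'' 0 = 5 \<and> s1 ''value'' 0 = 1"
      have g1: "s1 ''in_rho'' 0 = r" "s1 ''in_numer'' 0 = numer a" using f1 by (simp_all add: params_state_def)
      show "runs (For ''i'' (Plus (Sc ''in_rho'') (Sc ''in_numer'')) ?q ;; For ''i'' (Sc ''v'') ?d) s1
         ((?h + 1) * 100 + (5 * 4 ^ ?h + 1) * 100) (\<lambda>s. s ''value'' 0 = tower r a)"
      proof (rule runs_Seq[where Q = "\<lambda>s. s ''v'' 0 = 5 * 4 ^ ?h"])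
        show "runs (For ''i'' (Plus (Sc ''in_rho'') (Sc ''in_numer'')) ?q) s1 ((?h + 1) * 100) (\<lambda>s. s ''v'' 0 = 5 * 4 ^ ?h)"
        proof (rule runs_For[where P = "\<lambda>i s. s ''v'' 0 = 5 * 4 ^ i" and h = ?h and B = 50])
          fix i and s' :: state assume "s' ''v'' 0 = 5 * 4 ^ i"
          then show "runs ?q s' 50 (\<lambda>s''. put ''i'' (Suc i) s'' ''v'' 0 = 5 * 4 ^ Suc i)"
            by (intro runs_loop_free) simp_all
        qed (use g1 v1 in simp_all)
      next
        fix s2 assume f2: "unchanged (writes (For ''i'' (Plus (Sc ''in_rho'') (Sc ''in_numer'')) ?q)) s2 s1"
          and v2: "s2 ''v'' 0 = 5 * 4 ^ ?h"
        have "s2 ''value'' 0 = 1" using f2 v1 by simp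
        note v3 = this
        show "runs (For ''i'' (Sc ''v'') ?d) s2 ((5 * 4 ^ ?h + 1) * 100) (\<lambda>s. s ''value'' 0 = tower r a)"
        proof (rule runs_For[where P = "\<lambda>i s. s ''value'' 0 = 2 ^ i" and h = "5 * 4 ^ ?h" and B = 50])
          fix i and s' :: state assume "s' ''value'' 0 = 2 ^ i"
          then have "put ''i'' (Suc i) (run ?d s') ''value'' 0 = 2 ^ Suc i" by simp
          then show "runs ?d s' 50 (\<lambda>s''. put ''i'' (Suc i) s'' ''value'' 0 = 2 ^ Suc i)"
            by (intro runs_loop_free) simp_all
        qed (use v2 v3 in \<open>simp_all add: tower_def\<close>)
      qed
    qed
    then show ?thesis by blast
  qed
  then show ?thesis unfolding computable_def runs_def by blast
qed

section \<open>The running time in terms of \<rho>, \<alpha>, \<open>n\<close> and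
  \<open>m\<close>\<close>

lemma real_le_two_power: "real x \<le> 2 ^ x"
  by (rule less_imp_le) (rule of_nat_less_two_power)

context basic_inst begin

definition budget :: real where
  "budget = real \<rho> ^ (2 * \<rho> + 3) * \<alpha> ^ (2 * \<rho> + 2)"

lemma budget_nonneg: "0 \<le> budget"
  using stretch_ge1 by (simp add: budget_def)

lemma power_le_budget:
  assumes "1 \<le> \<rho>" "i \<le> 2 * \<rho> + 3" "j \<le> 2 * \<rho> + 2"
  shows "real \<rho> ^ i * \<alpha> ^ j \<le> budget"
  unfolding budget_def using assms stretch_ge1
  by (intro mult_mono power_increasing) simp_all

text \<open>For \<rho> \<ge> 3 the base 3 is dominated by \<rho>; the factor 27 is only there for
  \<rho> = 1 and \<rho> = 2. This is what turns the exponential factor of the tuple count into a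
  power of \<rho>.\<close>

lemma three_power_le: "1 \<le> \<rho> \<Longrightarrow> 3 ^ \<rho> \<le> 27 * real \<rho> ^ \<rho>"
proof -
  assume r: "1 \<le> \<rho>"
  consider "\<rho> = 1" | "\<rho> = 2" | "3 \<le> \<rho>" using r by linarith
  then show ?thesis
  proof cases
    case 3
    then have "3 ^ \<rho> \<le> real \<rho> ^ \<rho>" by (intro power_mono) simp_all
    also have "\<dots> \<le> 27 * real \<rho> ^ \<rho>" by simp
    finally show ?thesis .
  qed simp_all
qed

text \<open>The constant is 3 because \<open>2 k + 1 \<le> 3 \<alpha>\<close> for \<alpha> \<ge>
  1.\<close>

lemma cmax_real: "real cmax \<le> 3 * real \<rho> * \<alpha>"
proof -
  have "real (2 * kk + 1) = 2 * real kk + 1" by simp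
  then have "real (2 * kk + 1) \<le> 3 * \<alpha>" using kk_le[OF order_refl] stretch_ge1 by linarith
  then have "real \<rho> * real (2 * kk + 1) \<le> real \<rho> * (3 * \<alpha>)" by (intro mult_left_mono) simp_all
  moreover have "real cmax \<le> real \<rho> * real (2 * kk + 1)"
    using cmax_le(2) by (metis of_nat_le_iff of_nat_mult)
  ultimately show ?thesis by (simp add: mult.assoc mult.left_commute)
qed

text \<open>If \<open>cmax\<close> exceeds the number of vertices, then even the cubic cost is within the budget.\<close>

lemma compress_cost:
  "real ((cmax + 1) * (nverts I + nedges I + cmax + 1)) \<le> 9 * real (nverts I * nedges I + 1) + 216 * budget"
proof (cases "cmax \<le> nverts I")
  case True
  have "(cmax + 1) * (nverts I + nedges I + cmax + 1) \<le> (nverts I + 1) * (3 * (nedges I + 1))"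
    using True nedges_ge by (intro mult_le_mono) simp_all
  also have "\<dots> = 3 * (nverts I * nedges I + nverts I + nedges I + 1)" by (simp add: algebra_simps)
  also have "\<dots> \<le> 9 * (nverts I * nedges I + 1)" using nverts_le by simp
  finally have "real ((cmax + 1) * (nverts I + nedges I + cmax + 1)) \<le> real (9 * (nverts I * nedges I + 1))"
    by (rule of_nat_mono)
  then show ?thesis using budget_nonneg by simp
next
  case False
  then have c: "1 \<le> cmax" "nverts I \<le> cmax" using n_pos by simp_all
  then have "\<rho> \<noteq> 0" using cmax_le(2) by (intro notI) simp
  then have r: "1 \<le> \<rho>" by simp
  \<comment> \<open>Here \<open>n < cmax\<close>, and the number of edges is at most
    \<open>n * n\<close>, so the product is cubic in \<open>cmax\<close>;
    \<open>(3 \<rho> \<alpha>)^3\<close> fits into the budget as \<rho> \<ge> 1.\<close>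
  have "nedges I \<le> cmax * cmax" using nedges_le mult_le_mono[OF c(2) c(2)] by (rule le_trans)
  moreover have "cmax * 1 \<le> cmax * cmax" using c(1) by (rule mult_le_mono2)
  ultimately have "nverts I + nedges I + cmax + 1 \<le> 4 * (cmax * cmax)" using c by linarith
  then have "(cmax + 1) * (nverts I + nedges I + cmax + 1) \<le> (2 * cmax) * (4 * (cmax * cmax))"
    using c(1) by (intro mult_le_mono) simp_all
  also have "\<dots> = 8 * cmax ^ 3" by (simp add: power3_eq_cube)
  finally have "real ((cmax + 1) * (nverts I + nedges I + cmax + 1)) \<le> 8 * real cmax ^ 3"
    by (metis of_nat_le_iff of_nat_mult of_nat_numeral of_nat_power)
  also have "\<dots> \<le> 8 * (3 * real \<rho> * \<alpha>) ^ 3"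
    using cmax_real by (intro mult_left_mono power_mono) simp_all
  also have "\<dots> = 216 * (real \<rho> ^ 3 * \<alpha> ^ 3)" by (simp add: power_mult_distrib)
  also have "\<dots> \<le> 216 * budget" using power_le_budget[OF r, of 3 3] r by simp
  finally have le: "real ((cmax + 1) * (nverts I + nedges I + cmax + 1)) \<le> 216 * budget" .
  show ?thesis by (rule add_increasing[OF _ le]) simp
qed

text \<open>Up to constants the cost is \<open>(3 z)^\<rho> * z^3\<close> with
  \<open>z = \<rho> \<alpha>\<close>. Trading \<open>3^\<rho>\<close> for
  \<open>\<rho>^\<rho>\<close> gives the exponents \<open>2 \<rho> + 3\<close> for \<rho> and
  \<open>\<rho> + 3\<close> for \<alpha>; the latter is at most \<open>2 \<rho> + 2\<close> because
  \<rho> \<ge> 1.\<close>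

lemma search_cost:
  "real ((cmax ^ \<rho> + 1) * (loop_time + 50)) \<le> 13000 * real (nverts I * nedges I + 1) + 10500000 * budget"
proof (cases "\<rho> = 0")
  case True
  then have c: "cmax = 0" using cmax_le(2) by simp
  \<comment> \<open>For \<rho> = 0 the budget vanishes, so the cost must be charged to the graph:
    \<open>cmax\<close> is 0 as well, and a linear function of \<open>k \<le> n\<close>
    remains.\<close>
  have "(cmax ^ \<rho> + 1) * (loop_time + 50) = 2 * (3000 * (kk + 1) + 100)"
    unfolding loop_time_def step_time_def c using True by simp
  also have "\<dots> \<le> 13000 * (nverts I * nedges I + 1)"
    using kk_le_nverts nverts_le(1) by simp
  finally have "real ((cmax ^ \<rho> + 1) * (loop_time + 50)) \<le> real (13000 * (nverts I * nedges I + 1))"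
    by (rule of_nat_mono)
  then show ?thesis using budget_nonneg by simp
next
  case False
  then have r: "1 \<le> \<rho>" by simp
  let ?r = "real \<rho>"
  define z where "z = ?r * \<alpha>"
  have r1: "1 \<le> ?r" using r by simp
  have z: "1 \<le> z" "?r \<le> z" "\<alpha> \<le> z"
    unfolding z_def using mult_mono[OF r1 stretch_ge1] mult_left_mono[OF stretch_ge1, of ?r] mult_right_mono[OF r1, of \<alpha>]
      stretch_ge1 r1 by simp_all
  have c: "real cmax \<le> 3 * z" using cmax_real by (simp add: z_def)
  have z\<rho>: "1 \<le> z ^ \<rho>" using z(1) by (rule one_le_power)
  have "real cmax ^ \<rho> \<le> (3 * z) ^ \<rho>" using c by (rule power_mono) simp
  also have "\<dots> = 3 ^ \<rho> * z ^ \<rho>" by (rule power_mult_distrib)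
  finally have "real (cmax ^ \<rho> + 1) \<le> 3 ^ \<rho> * z ^ \<rho> + 1" by simp
  also have "\<dots> \<le> 2 * (3 ^ \<rho> * z ^ \<rho>)"
    using mult_mono[OF one_le_power[of 3 \<rho>] z\<rho>] by (simp add: mult.commute)
  also have "\<dots> \<le> 2 * (27 * ?r ^ \<rho> * z ^ \<rho>)"
    using three_power_le[OF r] z\<rho> by (intro mult_left_mono mult_right_mono) simp_all
  finally have 1: "real (cmax ^ \<rho> + 1) \<le> 54 * (?r ^ \<rho> * z ^ \<rho>)" by simp
  have 2: "real (min \<rho> cmax + 1) \<le> 2 * ?r" using r by simp
  have "real (kk + 1) = real kk + 1" by simp
  then have 3: "real (kk + 1) \<le> 2 * \<alpha>" using kk_le[OF order_refl] stretch_ge1 by linarith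
  have 4: "real (cmax + 1) \<le> 4 * z" using c z(1) by simp
  have "real ((min \<rho> cmax + 1) * (kk + 1) * ((cmax + 1) * (cmax + 1))) \<le> (2 * ?r) * (2 * \<alpha>) * ((4 * z) * (4 * z))"
    unfolding of_nat_mult using 2 3 4 r1 stretch_ge1 z(1) by (intro mult_mono) simp_all
  also have "\<dots> = 64 * z ^ 3" unfolding z_def by (simp add: power3_eq_cube)
  finally have "real (loop_time + 50) \<le> 3000 * (64 * z ^ 3) + 100"
    unfolding loop_time_def step_time_def by simp
  also have "\<dots> \<le> 192100 * z ^ 3" using one_le_power[OF z(1), of 3] by simp
  finally have 5: "real (loop_time + 50) \<le> 192100 * z ^ 3" .
  have "real ((cmax ^ \<rho> + 1) * (loop_time + 50)) \<le> (54 * (?r ^ \<rho> * z ^ \<rho>)) * (192100 * z ^ 3)"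
    unfolding of_nat_mult using 1 5 z(1) r1 by (intro mult_mono) simp_all
  also have "\<dots> = 10373400 * (?r ^ (\<rho> + \<rho> + 3) * \<alpha> ^ (\<rho> + 3))"
  proof -
    have "(54 * (a * (a * b))) * (192100 * (c * d)) = 10373400 * (a * a * c * (b * d))" for a b c d :: real
      by simp
    then show ?thesis unfolding z_def power_mult_distrib power_add by blast
  qed
  also have "\<dots> \<le> 10373400 * budget"
    using power_le_budget[OF r, of "\<rho> + \<rho> + 3" "\<rho> + 3"] r by simp
  also have "\<dots> \<le> 10500000 * budget" using budget_nonneg by simp
  finally have le: "real ((cmax ^ \<rho> + 1) * (loop_time + 50)) \<le> 10500000 * budget" .
  show ?thesis by (rule add_increasing[OF _ le]) simp
qed

lemma total_time_bound: "real total_time \<le> 30000000 * (budget + real (nverts I) * real (nedges I) + 1)"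
proof -
  define Y where "Y = real (nverts I * nedges I + 1)"
  define x where "x = (nverts I + 1) * (nverts I + nedges I + 1)"
  define y where "y = (cmax + 1) * (nverts I + nedges I + cmax + 1)"
  define w where "w = (cmax ^ \<rho> + 1) * (loop_time + 50)"
  have nm: "real (nverts I) \<le> Y" "real (nedges I) \<le> Y"
    unfolding Y_def of_nat_le_iff using nverts_le .
  have "1 \<le> Y" unfolding Y_def by simp
  note n = nm this
  have "x \<le> (nverts I + 1) * (2 * (nedges I + 1))"
    unfolding x_def using nedges_ge by (intro mult_le_mono2) simp
  also have "\<dots> = 2 * (nverts I * nedges I + nverts I + nedges I + 1)" by (simp add: algebra_simps)
  also have "\<dots> \<le> 6 * (nverts I * nedges I + 1)" using nverts_le by simp
  finally have x: "real x \<le> 6 * Y" unfolding Y_def by (metis of_nat_le_iff of_nat_mult of_nat_numeral)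
  have y: "real y \<le> 9 * Y + 216 * budget" unfolding y_def Y_def by (rule compress_cost)
  have w: "real w \<le> 13000 * Y + 10500000 * budget" unfolding w_def Y_def by (rule search_cost)
  have k: "(min (nverts I) (cmax ^ \<rho>) + 1) * (loop_time + 50) \<le> w" "(cmax ^ \<rho> + 1) * loop_time \<le> w"
    unfolding w_def by (intro mult_le_mono; simp)+
  have "total_time \<le> 100 * (nverts I + 1) + 1300 * (nedges I + 1) + 4000 * x + 4000 * y + 30 + 2 * w"
    using k unfolding total_time_def kernel_time_def prep_time_def mult.assoc[of 4000] x_def[symmetric] y_def[symmetric]
    by linarith
  then have "real total_time \<le> real (100 * (nverts I + 1) + 1300 * (nedges I + 1) + 4000 * x + 4000 * y + 30 + 2 * w)"
    by (rule of_nat_mono)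
  also have "\<dots> = 100 * (real (nverts I) + 1) + 1300 * (real (nedges I) + 1) + 4000 * real x + 4000 * real y + 30 + 2 * real w"
    by simp
  also have "\<dots> \<le> 22000000 * budget + 100000 * Y" using n x y w budget_nonneg by argo
  also have "\<dots> \<le> 30000000 * budget + 30000000 * Y" using n(3) budget_nonneg by (intro add_mono mult_right_mono) simp_all
  also have "\<dots> = 30000000 * (budget + Y)" by (rule distrib_left[symmetric])
  finally show ?thesis by (simp add: Y_def)
qed

text \<open>Since \<alpha> is at most its numerator and \<open>x \<le> 2^x\<close>, the budget is a
  power of 2 whose exponent is quadratic in \<open>e = \<rho> + numer\<close>, hence at most
  \<open>5 e^2\<close> and at most \<open>5 * 4^e\<close>.\<close>

lemma budget_le_tower: "budget \<le> real (tower \<rho> (stretch I))"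
proof -
  let ?N = "numer (stretch I)"
  define e where "e = \<rho> + ?N"
  have N: "1 \<le> ?N" using denom_pos denom_le_numer by linarith
  have "\<alpha> \<le> real ?N" unfolding stretch_eq using denom_pos by (simp add: divide_le_eq mult_le_cancel_left1)
  then have "\<alpha> \<le> 2 ^ ?N" using real_le_two_power order_trans by blast
  then have "budget \<le> (2 ^ \<rho>) ^ (2 * \<rho> + 3) * (2 ^ ?N) ^ (2 * \<rho> + 2)"
    unfolding budget_def using real_le_two_power stretch_ge1 by (intro mult_mono power_mono) simp_all
  also have "\<dots> = 2 ^ (\<rho> * (2 * \<rho> + 3) + ?N * (2 * \<rho> + 2))" by (simp only: power_add power_mult)
  also have "\<dots> \<le> 2 ^ (5 * 4 ^ e)"
  proof (rule power_increasing)
    have "\<rho> * (2 * \<rho> + 3) + ?N * (2 * \<rho> + 2) \<le> e * (2 * \<rho> + 3)" by (simp add: e_def algebra_simps)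
    \<comment> \<open>\<open>2 \<rho> + 3 \<le> 2 e + 3 e\<close>, where the second part uses
      \<open>e \<ge> 1\<close>; this is the origin of the 5 in \<open>tower\<close>.\<close>
    also have "\<dots> \<le> e * (5 * e)" using N by (intro mult_le_mono2) (simp add: e_def)
    also have "\<dots> = 5 * (e * e)" by simp
    also have "e * e \<le> 2 ^ e * 2 ^ e" by (intro mult_le_mono) (simp_all add: less_imp_le)
    also have "(2::nat) ^ e * 2 ^ e = 4 ^ e" by (simp flip: power_mult_distrib)
    finally show "\<rho> * (2 * \<rho> + 3) + ?N * (2 * \<rho> + 2) \<le> 5 * 4 ^ e" by simp
  qed simp
  finally show ?thesis by (simp add: tower_def e_def)
qed

end

lemma solves_total:
  "solves_within total_com (\<lambda>I. 30000000 * (real (removals I) ^ (2 * removals I + 3) *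
     real_of_rat (stretch I) ^ (2 * removals I + 2) + real (nverts I) * real (nedges I) + 1))"
  unfolding solves_within_def
proof (intro allI impI)
  fix I assume "basic_instance I"
  then interpret basic_inst I by unfold_locales
  from runs_total obtain t s where ts: "exec total_com (input_state I) t s" "t \<le> total_time" "answered ''in_'' I s"
    unfolding runs_def by blast
  have "real t \<le> real total_time" using ts(2) by simp
  then have "real t \<le> 30000000 * (budget + real (nverts I) * real (nedges I) + 1)"
    using total_time_bound by (rule order_trans)
  then show "\<exists>t s. exec total_com (input_state I) t s \<and> answered ''in_'' I s \<and>
     real t \<le> 30000000 * (real (removals I) ^ (2 * removals I + 3) *
     real_of_rat (stretch I) ^ (2 * removals I + 2) + real (nverts I) * real (nedges I) + 1)"
    using ts(1,3) unfolding budget_def by blast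
qed

lemma fpt_total: "fpt_algorithm total_com"
  unfolding fpt_algorithm_def
proof (rule exI[of _ tower], rule exI[of _ 90000000], rule exI[of _ 2], rule conjI[OF computable_tower],
    unfold solves_within_def, intro allI impI)
  fix I assume I: "basic_instance I"
  then interpret basic_inst I by unfold_locales
  let ?E = "encoding_length I"
  from runs_total obtain t s where ts: "exec total_com (input_state I) t s" "t \<le> total_time" "answered ''in_'' I s"
    unfolding runs_def by blast
  have E: "nverts I \<le> ?E" "nedges I \<le> ?E" "1 \<le> ?E" using nedges_ge nedges_le_encoding[of I] by linarith+
  have E2: "1 \<le> real (?E ^ 2)" using E(3) by simp
  have f: "1 \<le> real (tower \<rho> (stretch I))" by (simp add: tower_def)
  have "real (nverts I) * real (nedges I) \<le> real (?E ^ 2)"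
    unfolding power2_eq_square of_nat_mult using E by (intro mult_mono) simp_all
  also have "\<dots> \<le> real (tower \<rho> (stretch I)) * real (?E ^ 2)" using mult_right_mono[OF f, of "real (?E ^ 2)"] E2 by simp
  finally have 1: "real (nverts I) * real (nedges I) \<le> real (tower \<rho> (stretch I)) * real (?E ^ 2)" .
  have 2: "budget \<le> real (tower \<rho> (stretch I)) * real (?E ^ 2)"
    using budget_le_tower mult_left_mono[OF E2, of "real (tower \<rho> (stretch I))"] by simp
  have 3: "1 \<le> real (tower \<rho> (stretch I)) * real (?E ^ 2)" using mult_mono[OF f E2] by simp
  have "real t \<le> real total_time" using ts(2) by simp
  also have "\<dots> \<le> 30000000 * (budget + real (nverts I) * real (nedges I) + 1)" by (rule total_time_bound)
  also have "\<dots> \<le> 90000000 * (real (tower \<rho> (stretch I)) * real (?E ^ 2))"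
  proof -
    have "30000000 * (b + a + 1) \<le> 90000000 * c" if "a \<le> c" "b \<le> c" "1 \<le> c" for a b c :: real
    proof -
      have "b + a + 1 \<le> 3 * c" using that by linarith
      then have "30000000 * (b + a + 1) \<le> 30000000 * (3 * c)" by (rule mult_left_mono) simp
      then show ?thesis by simp
    qed
    then show ?thesis using 1 2 3 by blast
  qed
  finally have "real t \<le> real (90000000 * (tower (removals I) (stretch I) * ?E ^ 2))" by simp
  then show "\<exists>t s. exec total_com (input_state I) t s \<and> answered ''in_'' I s \<and>
     real t \<le> real (90000000 * (tower (removals I) (stretch I) * ?E ^ 2))"
    using ts(1,3) by blast
qed

text \<open>The summand 1 accounts for the instance with one vertex and \<rho> = 0: there the other
  two summands vanish, whereas every program takes at least one step.\<close>

theorem corollary8: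
  "\<exists>A. kernelization_based A \<and> fpt_algorithm A \<and>
     (\<exists>C::real. solves_within A (\<lambda>I.
        C * (real (removals I) ^ (2 * removals I + 3) *
               real_of_rat (stretch I) ^ (2 * removals I + 2) +
             real (nverts I) * real (nedges I) + 1)))"
proof (intro exI[of _ total_com] conjI)
  show "kernelization_based total_com"
    unfolding kernelization_based_def total_com_def
    using kernelization_kernel_com kernel_solver_solve_com by blast
  show "fpt_algorithm total_com" by (rule fpt_total)
qed (rule exI, rule solves_total)

end
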